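(* Let $\Omega\subseteq\mathbb R^N$ be a bounded connected open set with Lipschitz continuous boundary, let $f:\Omega\times\mathbb R^N\to\overline{\mathbb R}$ be a Borel function and let $F:W^{1,\infty}(\Omega)\to\overline{\mathbb R}$ be the supremal functional $F(u)=\operatorname{ess\,sup}_{x\in\Omega} f(x,Du(x))$. For $\xi\in\mathbb R^N$ set $u_\xi(x):=\xi\cdot x$. Assume that there exists a sequence $(u_n)_{n\in\mathbb N}\subseteq W^{1,\infty}(\Omega)$ such that $$\lim_{n\to\infty}F(u_n)=\inf_{W^{1,\infty}(\Omega)}F=\lim_{n\to\infty}\limsup_{\xi\to0}F(u_n+u_\xi).$$ Then $\Gamma_\tau(F)$ is a level convex functional for each $\tau\in\{\tau_\infty,w^*,w^*_{seq}\}$. In particular $\Gamma_{w^*}(F)=\Gamma_{w^*_{seq}}(F)$.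
   Context: $\overline{\mathbb R}=[-\infty,+\infty]$. Topologies on $W^{1,\infty}(\Omega)$: $\tau_\infty$ is the topology induced by the $L^\infty(\Omega)$ norm (uniform convergence); $w^*$ is the topology induced by the embedding $u\mapsto(u,Du)$ into $L^\infty(\Omega)\times L^\infty(\Omega;\mathbb R^N)$ with its weak* topology; $w^*_{seq}$ is the topology whose closed sets are the sequentially $w^*$-closed sets. For a topology $\tau$, $\Gamma_\tau(F)$ is the $\tau$-lower semicontinuous envelope of $F$, i.e. the pointwise supremum of all $\tau$-lower semicontinuous $G:W^{1,\infty}(\Omega)\to\overline{\mathbb R}$ with $G\le F$ ($G$ is $\tau$-lower semicontinuous if $\{G\le\lambda\}$ is $\tau$-closed for every $\lambda\in\mathbb R$). A functional is level convex if all its sublevel sets $\{\cdot\le\lambda\}$, $\lambda\in\mathbb R$, are convex. *)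

theory Defs
  imports "HOL-Probability.Essential_Supremum"
begin

text \<open>
  Elements of Lebesgue and Sobolev spaces are represented by functions on the whole space; values
  outside \<open>\<Omega>\<close> are irrelevant, and functions that agree almost everywhere on \<open>\<Omega>\<close> are not
  identified. All topologies below are pulled back from the quotient by almost everywhere
  equality: their open and closed sets are invariant under it, so a lower semicontinuous
  functional factors through the quotient, and so does every envelope.
\<close>

section \<open>Domains with Lipschitz boundary\<close>

text \<open>Near each boundary point and after a rotation, \<open>\<Omega>\<close> is the strict epigraph of a Lipschitz
  function \<open>\<gamma>\<close> defined on the hyperplane orthogonal to \<open>\<nu>\<close>.\<close>

definition lipschitz_boundary :: "'a::euclidean_space set \<Rightarrow> bool" where
  "lipschitz_boundary \<Omega> \<longleftrightarrow>
    (\<forall>p\<in>frontier \<Omega>. \<exists>\<nu> r L (\<gamma>::'a \<Rightarrow> real).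
       norm \<nu> = 1 \<and> r > 0 \<and> L-lipschitz_on {y. y \<bullet> \<nu> = 0} \<gamma> \<and>
       \<Omega> \<inter> ball p r = {x \<in> ball p r. \<gamma> (x - (x \<bullet> \<nu>) *\<^sub>R \<nu>) < x \<bullet> \<nu>})"

section \<open>Lebesgue spaces\<close>

definition Linf :: "'a::euclidean_space set \<Rightarrow> ('a \<Rightarrow> 'b::euclidean_space) set" where
  "Linf \<Omega> = {g \<in> borel_measurable (lebesgue_on \<Omega>). \<exists>C. AE x in lebesgue_on \<Omega>. norm (g x) \<le> C}"

definition L1 :: "'a::euclidean_space set \<Rightarrow> ('a \<Rightarrow> 'b::euclidean_space) set" where
  "L1 \<Omega> = {g. integrable (lebesgue_on \<Omega>) g}"

definition Linf_norm :: "'a::euclidean_space set \<Rightarrow> ('a \<Rightarrow> 'b::euclidean_space) \<Rightarrow> ereal" where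
  "Linf_norm \<Omega> g = esssup (lebesgue_on \<Omega>) (\<lambda>x. ereal (norm (g x)))"

definition Linf_norm_topology ::
  "'a::euclidean_space set \<Rightarrow> ('a \<Rightarrow> 'b::euclidean_space) topology" where
  "Linf_norm_topology \<Omega> = topology_generated_by
    {{h \<in> Linf \<Omega>. Linf_norm \<Omega> (\<lambda>x. h x - g x) < ereal e} | g e. g \<in> Linf \<Omega> \<and> 0 < e}"

text \<open>Initial topology with respect to the pairings with the elements of \<open>L\<^sup>1\<close>.\<close>

definition Linf_weak_star_topology ::
  "'a::euclidean_space set \<Rightarrow> ('a \<Rightarrow> 'b::euclidean_space) topology" where
  "Linf_weak_star_topology \<Omega> =
    pullback_topology (Linf \<Omega>) (\<lambda>g. \<lambda>\<phi>\<in>L1 \<Omega>. (\<integral>x. g x \<bullet> \<phi> x \<partial>lebesgue_on \<Omega>))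
      (product_topology (\<lambda>_. euclideanreal) (L1 \<Omega>))"

section \<open>The Sobolev space\<close>

primrec C_k :: "nat \<Rightarrow> ('a::euclidean_space \<Rightarrow> real) \<Rightarrow> bool" where
  "C_k 0 \<phi> \<longleftrightarrow> continuous_on UNIV \<phi>"
| "C_k (Suc k) \<phi> \<longleftrightarrow> (\<forall>x. \<phi> differentiable at x) \<and>
     (\<forall>v. C_k k (\<lambda>x. frechet_derivative \<phi> (at x) v))"

definition test_functions :: "'a::euclidean_space set \<Rightarrow> ('a \<Rightarrow> real) set" where
  "test_functions \<Omega> = {\<phi>. (\<forall>k. C_k k \<phi>) \<and>
     compact (closure {x. \<phi> x \<noteq> 0}) \<and> closure {x. \<phi> x \<noteq> 0} \<subseteq> \<Omega>}"

definition weak_gradient ::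
  "'a::euclidean_space set \<Rightarrow> ('a \<Rightarrow> real) \<Rightarrow> ('a \<Rightarrow> 'a) \<Rightarrow> bool" where
  "weak_gradient \<Omega> u g \<longleftrightarrow>
    (\<forall>\<phi>\<in>test_functions \<Omega>. \<forall>i\<in>Basis.
       (\<integral>x. u x * frechet_derivative \<phi> (at x) i \<partial>lebesgue_on \<Omega>) =
       - (\<integral>x. (g x \<bullet> i) * \<phi> x \<partial>lebesgue_on \<Omega>))"

definition W1inf :: "'a::euclidean_space set \<Rightarrow> ('a \<Rightarrow> real) set" where
  "W1inf \<Omega> = {u \<in> Linf \<Omega>. \<exists>g\<in>Linf \<Omega>. weak_gradient \<Omega> u g}"

text \<open>The choice is immaterial: weak gradients are unique up to null sets.\<close>

definition wgrad :: "'a::euclidean_space set \<Rightarrow> ('a \<Rightarrow> real) \<Rightarrow> 'a \<Rightarrow> 'a" where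
  "wgrad \<Omega> u = (SOME g. g \<in> Linf \<Omega> \<and> weak_gradient \<Omega> u g)"

section \<open>Topologies on the Sobolev space\<close>

definition tau_inf :: "'a::euclidean_space set \<Rightarrow> ('a \<Rightarrow> real) topology" where
  "tau_inf \<Omega> = subtopology (Linf_norm_topology \<Omega>) (W1inf \<Omega>)"

definition w_star :: "'a::euclidean_space set \<Rightarrow> ('a \<Rightarrow> real) topology" where
  "w_star \<Omega> = pullback_topology (W1inf \<Omega>) (\<lambda>u. (u, wgrad \<Omega> u))
     (prod_topology (Linf_weak_star_topology \<Omega>) (Linf_weak_star_topology \<Omega>))"

definition seq_closedin :: "'x topology \<Rightarrow> 'x set \<Rightarrow> bool" where
  "seq_closedin T C \<longleftrightarrow> C \<subseteq> topspace T \<and>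
     (\<forall>s l. (\<forall>n::nat. s n \<in> C) \<and> limitin T s l sequentially \<longrightarrow> l \<in> C)"

definition sequential_topology :: "'x topology \<Rightarrow> 'x topology" where
  "sequential_topology T =
     topology (\<lambda>U. U \<subseteq> topspace T \<and> seq_closedin T (topspace T - U))"

definition w_star_seq :: "'a::euclidean_space set \<Rightarrow> ('a \<Rightarrow> real) topology" where
  "w_star_seq \<Omega> = sequential_topology (w_star \<Omega>)"

section \<open>Functionals\<close>

definition lsc_on :: "'x topology \<Rightarrow> ('x \<Rightarrow> ereal) \<Rightarrow> bool" where
  "lsc_on T G \<longleftrightarrow> (\<forall>c::real. closedin T {u \<in> topspace T. G u \<le> ereal c})"

definition lsc_envelope :: "'x topology \<Rightarrow> ('x \<Rightarrow> ereal) \<Rightarrow> 'x \<Rightarrow> ereal" where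
  "lsc_envelope T F u = (SUP G\<in>{G. lsc_on T G \<and> (\<forall>v\<in>topspace T. G v \<le> F v)}. G u)"

text \<open>The function type is not an instance of \<^class>\<open>real_vector\<close>, so \<^const>\<open>convex\<close> does not
  apply.\<close>

definition convex_funs :: "('a \<Rightarrow> real) set \<Rightarrow> bool" where
  "convex_funs S \<longleftrightarrow>
     (\<forall>u\<in>S. \<forall>v\<in>S. \<forall>t\<in>{0..1}. (\<lambda>x. (1 - t) * u x + t * v x) \<in> S)"

definition level_convex_on :: "('a \<Rightarrow> real) set \<Rightarrow> (('a \<Rightarrow> real) \<Rightarrow> ereal) \<Rightarrow> bool" where
  "level_convex_on X G \<longleftrightarrow> (\<forall>c::real. convex_funs {u \<in> X. G u \<le> ereal c})"

definition supremal ::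
  "'a::euclidean_space set \<Rightarrow> ('a \<times> 'a \<Rightarrow> ereal) \<Rightarrow> ('a \<Rightarrow> real) \<Rightarrow> ereal" where
  "supremal \<Omega> f u = esssup (lebesgue_on \<Omega>) (\<lambda>x. f (x, wgrad \<Omega> u x))"

section \<open>Well-definedness of the topologies\<close>

lemma istopology_sequential:
  "istopology (\<lambda>U. U \<subseteq> topspace T \<and> seq_closedin T (topspace T - U))"
proof -
  have Int: "seq_closedin T (topspace T - U \<inter> V)"
    if U: "seq_closedin T (topspace T - U)" and V: "seq_closedin T (topspace T - V)" for U V
    unfolding seq_closedin_def
  proof (intro conjI allI impI)
    fix s l
    assume "(\<forall>n::nat. s n \<in> topspace T - U \<inter> V) \<and> limitin T s l sequentially"
    then have s: "\<And>n. s n \<in> topspace T - U \<inter> V" and lim: "limitin T s l sequentially"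
      by auto
    have sub: "l \<in> C" if inf: "infinite {n. s n \<in> C}" and C: "seq_closedin T C" for C
    proof -
      have r: "strict_mono (enumerate {n. s n \<in> C})"
        using inf by (rule strict_mono_enumerate)
      have "limitin T (s \<circ> enumerate {n. s n \<in> C}) l sequentially"
        using lim r by (rule limitin_subsequence[rotated])
      moreover have "(s \<circ> enumerate {n. s n \<in> C}) n \<in> C" for n
        using enumerate_in_set[OF inf, of n] by simp
      ultimately show ?thesis
        using C unfolding seq_closedin_def by blast
    qed
    have "{n. s n \<in> topspace T - U} \<union> {n. s n \<in> topspace T - V} = UNIV"
      using s by auto
    then have "infinite {n. s n \<in> topspace T - U} \<or> infinite {n. s n \<in> topspace T - V}"
      by (metis finite_Un infinite_UNIV_nat)
    then show "l \<in> topspace T - U \<inter> V"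
      using sub[OF _ U] sub[OF _ V] by blast
  qed auto
  have Un: "seq_closedin T (topspace T - \<Union>K)"
    if K: "\<forall>U\<in>K. U \<subseteq> topspace T \<and> seq_closedin T (topspace T - U)" for K
    unfolding seq_closedin_def
  proof (intro conjI allI impI)
    fix s l
    assume s: "(\<forall>n::nat. s n \<in> topspace T - \<Union>K) \<and> limitin T s l sequentially"
    then have "l \<in> topspace T"
      by (auto simp: limitin_def)
    moreover have "l \<notin> U" if "U \<in> K" for U
    proof -
      have "\<forall>n. s n \<in> topspace T - U"
        using s that by auto
      then have "l \<in> topspace T - U"
        using K that s unfolding seq_closedin_def by blast
      then show ?thesis by simp
    qed
    ultimately show "l \<in> topspace T - \<Union>K" by blast
  qed auto
  show ?thesis
    unfolding istopology_def using Int Un by blast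
qed

lemma openin_sequential:
  "openin (sequential_topology T) U \<longleftrightarrow> U \<subseteq> topspace T \<and> seq_closedin T (topspace T - U)"
  unfolding sequential_topology_def by (simp add: topology_inverse'[OF istopology_sequential])

lemma topspace_sequential [simp]: "topspace (sequential_topology T) = topspace T"
proof
  show "topspace (sequential_topology T) \<subseteq> topspace T"
    using openin_sequential[of T "topspace (sequential_topology T)"] by simp
  have "openin (sequential_topology T) (topspace T)"
    unfolding openin_sequential by (auto simp: seq_closedin_def)
  then show "topspace T \<subseteq> topspace (sequential_topology T)"
    by (rule openin_subset)
qed

lemma closedin_sequential: "closedin (sequential_topology T) C \<longleftrightarrow> seq_closedin T C"
proof -
  have "C \<subseteq> topspace T \<Longrightarrow> topspace T - (topspace T - C) = C" by auto
  moreover have "seq_closedin T C \<Longrightarrow> C \<subseteq> topspace T"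
    by (simp add: seq_closedin_def)
  ultimately show ?thesis
    unfolding closedin_def openin_sequential topspace_sequential
    by (metis Diff_subset)
qed

lemma wgrad:
  assumes "u \<in> W1inf \<Omega>"
  shows "wgrad \<Omega> u \<in> Linf \<Omega>" and "weak_gradient \<Omega> u (wgrad \<Omega> u)"
proof -
  have "\<exists>g. g \<in> Linf \<Omega> \<and> weak_gradient \<Omega> u g"
    using assms by (auto simp: W1inf_def)
  from someI_ex[OF this]
  show "wgrad \<Omega> u \<in> Linf \<Omega>" and "weak_gradient \<Omega> u (wgrad \<Omega> u)"
    by (auto simp: wgrad_def)
qed

lemma topspace_Linf_norm_topology:
  "topspace (Linf_norm_topology \<Omega> :: ('a::euclidean_space \<Rightarrow> 'b::euclidean_space) topology) = Linf \<Omega>"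
proof
  show "topspace (Linf_norm_topology \<Omega> :: ('a \<Rightarrow> 'b) topology) \<subseteq> Linf \<Omega>"
    by (auto simp: Linf_norm_topology_def)
  show "Linf \<Omega> \<subseteq> topspace (Linf_norm_topology \<Omega> :: ('a \<Rightarrow> 'b) topology)"
  proof
    fix g :: "'a \<Rightarrow> 'b"
    assume g: "g \<in> Linf \<Omega>"
    have "Linf_norm \<Omega> (\<lambda>x. g x - g x) \<le> 0"
      unfolding Linf_norm_def by (rule esssup_I) auto
    also have "0 < ereal 1" by simp
    finally have "g \<in> {h \<in> Linf \<Omega>. Linf_norm \<Omega> (\<lambda>x. h x - g x) < ereal 1}"
      using g by simp
    moreover have "{h \<in> Linf \<Omega>. Linf_norm \<Omega> (\<lambda>x. h x - g x) < ereal 1} \<in>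
      {{h \<in> Linf \<Omega>. Linf_norm \<Omega> (\<lambda>x. h x - g x) < ereal e} | g e. g \<in> Linf \<Omega> \<and> 0 < e}"
      using g by (intro CollectI exI[of _ g] exI[of _ 1] conjI refl) auto
    ultimately show "g \<in> topspace (Linf_norm_topology \<Omega>)"
      unfolding Linf_norm_topology_def topology_generated_by_topspace by (rule UnionI[rotated])
  qed
qed

lemma topspace_Linf_weak_star_topology: "topspace (Linf_weak_star_topology \<Omega>) = Linf \<Omega>"
  by (auto simp: Linf_weak_star_topology_def topspace_pullback_topology)

lemma topspace_tau_inf: "topspace (tau_inf \<Omega>) = W1inf \<Omega>"
  by (auto simp: tau_inf_def topspace_Linf_norm_topology W1inf_def)

lemma topspace_w_star: "topspace (w_star \<Omega>) = W1inf \<Omega>"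
proof -
  have "u \<in> Linf \<Omega> \<and> wgrad \<Omega> u \<in> Linf \<Omega>" if "u \<in> W1inf \<Omega>" for u
    using that wgrad(1)[OF that] by (simp add: W1inf_def)
  then show ?thesis
    by (auto simp: w_star_def topspace_pullback_topology topspace_Linf_weak_star_topology)
qed

lemma topspace_w_star_seq: "topspace (w_star_seq \<Omega>) = W1inf \<Omega>"
  by (simp add: w_star_seq_def topspace_w_star)

end

theory Submission
  imports Defs "HOL-Real_Asymp.Real_Asymp"
begin

text \<open>
  The set \<open>{\<Gamma>(F) \<le> c}\<close> is the intersection over \<open>c' > c\<close> of the closures of \<open>{F \<le> c'}\<close>, so it is
  enough to show that these closures are convex, and that the two weak* closures coincide.
  Given \<open>u\<close>, \<open>v\<close> with \<open>F \<le> c\<close>, let \<open>\<Phi>\<close> be a staircase with slopes \<open>0\<close> and \<open>1\<close> that is uniformly close to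
  \<open>z \<mapsto> t z\<close>. By the chain rule the gradient of \<open>w = u + \<Phi>(v - u)\<close> is almost everywhere that of \<open>u\<close> or
  that of \<open>v\<close>, hence \<open>F(w) \<le> c\<close>, while \<open>w\<close> is uniformly close to \<open>(1 - t) u + t v\<close> and has bounded
  gradient. So \<open>(1 - t) u + t v\<close> lies in each of the three closures, and separate continuity of
  convex combinations makes the closures convex.
  A convex set that is sequentially weak* closed is weak* closed by a Krein--Smulian argument: it
  needs no compactness, since nested bounded closed convex sets intersect already by minimizing the
  \<open>L\<^sup>2\<close> norm.
\<close>

section \<open>Smooth bump functions\<close>

text \<open>One approximating sequence serves all three topologies, because the staircase functions
  converge uniformly with bounded gradients. Joint continuity of convex combinations does not pass
  automatically to a sequential topology, so convexity of the closures is obtained by varying one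
  argument at a time.

  Two obstacles shape the rest. Gradients are known only through integrals against test functions;
  hence test functions are built explicitly and shown to be dense in L1, which gives uniqueness of
  weak gradients, bounds on difference quotients, and the passage from distributional to weak*
  convergence. Secondly, sequences control the weak* topology only on bounded sets, while sublevel
  sets of \<open>F\<close> may be unbounded. The separating functional is therefore assembled over
  the balls of radius \<open>n\<close> in L\<infinity>, each step mixing in a function of L1 norm at
  most \<open>2 / n\<close>; this decay is what lets the construction converge to an integrable
  function.\<close>

definition bump :: "nat \<Rightarrow> real \<Rightarrow> real" where
  "bump m s = (if 0 < s then exp (- (1 / s)) * (1 / s) ^ m else 0)"

lemma bump_tendsto_0: "(bump m \<longlongrightarrow> 0) (at 0)"
proof (rule filterlim_split_at)
  show "(bump m \<longlongrightarrow> 0) (at_left 0)"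
    by (rule tendsto_eventually, rule eventually_at_leftI[of "-1"]) (auto simp: bump_def)
  have "((\<lambda>s. inverse s ^ m / exp (inverse s)) \<longlongrightarrow> (0::real)) (at_right 0)"
    by (rule filterlim_compose[OF tendsto_power_div_exp_0 filterlim_inverse_at_top_right])
  moreover have "eventually (\<lambda>s. inverse s ^ m / exp (inverse s) = bump m s) (at_right 0)"
    by (rule eventually_at_rightI[of 0 1])
      (auto simp: bump_def exp_minus inverse_eq_divide field_simps power_one_over)
  ultimately show "(bump m \<longlongrightarrow> 0) (at_right 0)"
    by (rule Lim_transform_eventually)
qed

text \<open>Differentiating \<open>exp (- (1 / s)) * (1 / s) ^ m\<close> raises the exponent by 2
  and by 1, which is why the powers of \<open>1 / s\<close> are carried along: the family is then
  closed under differentiation, also across 0.\<close>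

lemma bump_deriv:
  "(bump m has_real_derivative bump (m + 2) s - real m * bump (m + 1) s) (at s)"
proof -
  consider "s > 0" | "s < 0" | "s = 0" by linarith
  then show ?thesis
  proof cases
    case 1
    have u: "((\<lambda>s. 1 / s) has_real_derivative - ((1 / s) ^ 2)) (at s)"
      using 1 by (auto intro!: derivative_eq_intros simp: power2_eq_square)
    have f: "((\<lambda>u. exp (- u) * u ^ m) has_real_derivative
        exp (- u) * (real m * u ^ (m - 1)) - exp (- u) * u ^ m) (at u)" for u
      by (auto intro!: derivative_eq_intros)
    have "((\<lambda>s. exp (- (1 / s)) * (1 / s) ^ m) has_real_derivative
        bump (m + 2) s - real m * bump (m + 1) s) (at s)"
      by (rule DERIV_cong[OF DERIV_chain2[OF f u]])
        (use 1 in \<open>cases m; simp add: bump_def algebra_simps add_divide_distrib power2_eq_square del: power_one_over\<close>)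
    then show ?thesis
      by (rule has_field_derivative_transform_within_open[where S="{0<..}"])
        (use 1 in \<open>auto simp: bump_def\<close>)
  next
    case 2
    have "((\<lambda>s. 0) has_real_derivative bump (m + 2) s - real m * bump (m + 1) s) (at s)"
      using 2 by (auto simp: bump_def)
    then show ?thesis
      by (rule has_field_derivative_transform_within_open[where S="{..<0}"])
        (use 2 in \<open>auto simp: bump_def\<close>)
  next
    case 3
    \<comment> \<open>The difference quotient of \<open>bump m\<close> at 0 is
      \<open>bump (Suc m)\<close> itself, so the limit already proved for every exponent
      applies.\<close>
    have "((\<lambda>h. (bump m (0 + h) - bump m 0) / h) \<longlongrightarrow> 0) (at 0)"
      by (rule Lim_transform_within[OF bump_tendsto_0[of "Suc m"] zero_less_one])
        (auto simp: bump_def)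
    then show ?thesis
      using 3 by (simp add: DERIV_def bump_def)
  qed
qed

lemma bump_nonneg: "0 \<le> bump m s"
  by (simp add: bump_def)

lemma bump_0_le_1: "bump 0 s \<le> 1"
  by (simp add: bump_def)

text \<open>This class is closed under directional derivatives, hence contained in every \<^const>\<open>C_k\<close>.\<close>

inductive smooth_bump :: "('a::euclidean_space \<Rightarrow> real) \<Rightarrow> bool" where
  const: "smooth_bump (\<lambda>_. c)"
| bump: "smooth_bump (\<lambda>x. bump m (x \<bullet> v + d))"
| add: "smooth_bump \<phi> \<Longrightarrow> smooth_bump \<psi> \<Longrightarrow> smooth_bump (\<lambda>x. \<phi> x + \<psi> x)"
| mult: "smooth_bump \<phi> \<Longrightarrow> smooth_bump \<psi> \<Longrightarrow> smooth_bump (\<lambda>x. \<phi> x * \<psi> x)"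

text \<open>Induction over the generators with the sum, product and chain rules. The derivative and
  its membership in the class are asserted together, since the product rule uses both for each
  factor.\<close>

lemma smooth_bump_derivative:
  fixes \<phi> :: "'a::euclidean_space \<Rightarrow> real"
  assumes "smooth_bump \<phi>"
  shows "\<exists>D. (\<forall>x. (\<phi> has_derivative D x) (at x)) \<and> (\<forall>v. smooth_bump (\<lambda>x. D x v))"
  using assms
proof induction
  case (const c)
  show ?case by (rule exI[of _ "\<lambda>_ _. 0"]) (auto intro: smooth_bump.const)
next
  case (bump m w d)
  let ?b = "\<lambda>x. bump (m + 2) (x \<bullet> w + d) + (- real m) * bump (m + 1) (x \<bullet> w + d)"
  have D: "((\<lambda>x. bump m (x \<bullet> w + d)) has_derivative (\<lambda>v. (v \<bullet> w) * ?b x)) (at x)" for x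
  proof -
    have "((\<lambda>x. x \<bullet> w + d) has_derivative (\<lambda>v. v \<bullet> w)) (at x)"
      by (auto intro!: derivative_eq_intros)
    from has_derivative_compose[OF this bump_deriv[unfolded has_field_derivative_def]]
    show ?thesis
      by (simp add: mult.commute)
  qed
  have "smooth_bump (\<lambda>x. (v \<bullet> w) * ?b x)" for v
    by (intro smooth_bump.intros)
  with D show ?case
    by (intro exI[of _ "\<lambda>x v. (v \<bullet> w) * ?b x"]) auto
next
  case (add \<phi> \<psi>)
  then obtain D E where
    "\<And>x. (\<phi> has_derivative D x) (at x)" "\<And>v. smooth_bump (\<lambda>x. D x v)"
    "\<And>x. (\<psi> has_derivative E x) (at x)" "\<And>v. smooth_bump (\<lambda>x. E x v)" by metis
  then show ?case
    by (intro exI[of _ "\<lambda>x v. D x v + E x v"]) (auto intro: smooth_bump.intros has_derivative_add)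
next
  case (mult \<phi> \<psi>)
  then obtain D E where
    "\<And>x. (\<phi> has_derivative D x) (at x)" "\<And>v. smooth_bump (\<lambda>x. D x v)"
    "\<And>x. (\<psi> has_derivative E x) (at x)" "\<And>v. smooth_bump (\<lambda>x. E x v)" by metis
  then show ?case
    by (intro exI[of _ "\<lambda>x v. \<phi> x * E x v + D x v * \<psi> x"])
      (auto intro!: smooth_bump.intros has_derivative_mult mult.hyps)
qed

lemma smooth_bump_C_k: "smooth_bump \<phi> \<Longrightarrow> C_k k \<phi>"
proof (induction k arbitrary: \<phi>)
  case 0
  then obtain D where "\<And>x. (\<phi> has_derivative D x) (at x)"
    using smooth_bump_derivative by blast
  then show ?case
    by (auto intro!: continuous_at_imp_continuous_on has_derivative_continuous)
next
  case (Suc k)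
  obtain D where D: "\<And>x. (\<phi> has_derivative D x) (at x)" "\<And>v. smooth_bump (\<lambda>x. D x v)"
    using smooth_bump_derivative[OF Suc.prems] by blast
  then have "frechet_derivative \<phi> (at x) = D x" for x
    by (metis frechet_derivative_at)
  with D Suc.IH show ?case
    by (auto simp: differentiable_def)
qed

lemma smooth_bump_prod:
  "finite I \<Longrightarrow> (\<And>i. i \<in> I \<Longrightarrow> smooth_bump (f i)) \<Longrightarrow> smooth_bump (\<lambda>x. \<Prod>i\<in>I. f i x)"
  by (induction I rule: finite_induct) (auto intro: smooth_bump.intros)

lemma smooth_bump_translate: "smooth_bump \<phi> \<Longrightarrow> smooth_bump (\<lambda>x. \<phi> (x + a))"
proof (induction rule: smooth_bump.induct)
  case (bump m v d)
  have "(\<lambda>x. bump m ((x + a) \<bullet> v + d)) = (\<lambda>x. bump m (x \<bullet> v + (a \<bullet> v + d)))"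
    by (simp add: inner_add_left algebra_simps)
  then show ?case by (simp only: smooth_bump.bump)
qed (auto intro: smooth_bump.intros)

section \<open>Supports, continuity and integrability of test functions\<close>

lemma test_function_differentiable:
  "\<phi> \<in> test_functions \<Omega> \<Longrightarrow> \<phi> differentiable at x"
  unfolding test_functions_def by (auto dest!: spec[of _ 1])

lemma test_function_has_derivative:
  "\<phi> \<in> test_functions \<Omega> \<Longrightarrow> (\<phi> has_derivative frechet_derivative \<phi> (at x)) (at x)"
  using test_function_differentiable frechet_derivative_works by blast

lemma test_function_continuous: "\<phi> \<in> test_functions \<Omega> \<Longrightarrow> continuous_on UNIV \<phi>"
  unfolding test_functions_def by (auto dest!: spec[of _ 0])

lemma test_function_derivative_continuous:
  assumes "\<phi> \<in> test_functions \<Omega>"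
  shows "continuous_on UNIV (\<lambda>x. frechet_derivative \<phi> (at x) v)"
proof -
  have "C_k (Suc 0) \<phi>"
    using assms unfolding test_functions_def by blast
  then show ?thesis by simp
qed

lemma eq_0_outside_support: "x \<notin> closure {x. \<phi> x \<noteq> 0} \<Longrightarrow> \<phi> x = 0"
  by (metis (mono_tags, lifting) closure_subset mem_Collect_eq subsetD)

lemma test_function_derivative_eq_0:
  assumes "x \<notin> closure {x. \<phi> x \<noteq> 0}"
  shows "frechet_derivative \<phi> (at x) v = 0"
proof -
  have "(\<phi> has_derivative (\<lambda>_. 0)) (at x)"
    by (rule has_derivative_transform_within_open[of "\<lambda>_. 0" _ x _ "- closure {x. \<phi> x \<noteq> 0}"])
      (use assms eq_0_outside_support in auto)
  then show ?thesis
    by (metis frechet_derivative_at)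
qed

lemma bounded_compact_support:
  fixes g :: "'a::euclidean_space \<Rightarrow> real"
  assumes "continuous_on UNIV g" "compact K" "\<And>x. x \<notin> K \<Longrightarrow> g x = 0"
  obtains B where "B \<ge> 0" "\<And>x. \<bar>g x\<bar> \<le> B"
proof -
  have "bounded (g ` K)"
    using assms by (metis compact_continuous_image compact_imp_bounded continuous_on_subset subset_UNIV)
  then obtain B where B: "\<And>x. x \<in> K \<Longrightarrow> \<bar>g x\<bar> \<le> B"
    unfolding bounded_iff by auto
  have "\<bar>g x\<bar> \<le> max B 0" for x
    using B[of x] assms(3)[of x] by (cases "x \<in> K") auto
  then show ?thesis
    by (intro that[of "max B 0"]) auto
qed

lemma integrable_compact_support:
  fixes g :: "'a::euclidean_space \<Rightarrow> real"
  assumes g: "continuous_on UNIV g" and K: "compact K" "\<And>x. x \<notin> K \<Longrightarrow> g x = 0"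
  shows "integrable lborel g"
proof -
  have "integrable lborel (\<lambda>x. indicator K x *\<^sub>R g x)"
    by (intro borel_integrable_compact K continuous_on_subset[OF g]) auto
  moreover have "(\<lambda>x. indicator K x *\<^sub>R g x) = g"
    using K(2) by (force simp: indicator_def)
  ultimately show ?thesis by simp
qed

lemma test_function_support:
  assumes "\<phi> \<in> test_functions \<Omega>"
  shows "\<exists>K. compact K \<and> K \<subseteq> \<Omega> \<and>
    (\<forall>x. x \<notin> K \<longrightarrow> \<phi> x = 0 \<and> (\<forall>v. frechet_derivative \<phi> (at x) v = 0))"
  by (rule exI[of _ "closure {x. \<phi> x \<noteq> 0}"])
    (use assms test_function_derivative_eq_0 eq_0_outside_support in \<open>auto simp: test_functions_def\<close>)

lemma test_function_mono: "\<Omega> \<subseteq> \<Omega>' \<Longrightarrow> \<phi> \<in> test_functions \<Omega> \<Longrightarrow> \<phi> \<in> test_functions \<Omega>'"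
  by (auto simp: test_functions_def)

text \<open>Subtracting 1 makes a factor vanish within distance \<open>1 / n\<close> of its face, so
  the support lies in the closed box shrunk by \<open>1 / n\<close> on every side, a compact subset
  of the open box.\<close>

lemma box_bump_test_functions:
  fixes a b :: "'a::euclidean_space"
  assumes ab: "box a b \<subseteq> \<Omega>" and n: "n > 0"
  defines "\<phi> \<equiv> \<lambda>x. \<Prod>i\<in>Basis. bump 0 (n * (x \<bullet> i - a \<bullet> i) - 1) * bump 0 (n * (b \<bullet> i - x \<bullet> i) - 1)"
  shows "smooth_bump \<phi>" and "\<phi> \<in> test_functions \<Omega>"
proof -
  have "smooth_bump (\<lambda>x. bump 0 (x \<bullet> (n *\<^sub>R i) + (- n * (a \<bullet> i) - 1)) *
      bump 0 (x \<bullet> (- n *\<^sub>R i) + (n * (b \<bullet> i) - 1)))" for i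
    by (intro smooth_bump.intros)
  moreover have "(\<lambda>x. bump 0 (x \<bullet> (n *\<^sub>R i) + (- n * (a \<bullet> i) - 1)) *
      bump 0 (x \<bullet> (- n *\<^sub>R i) + (n * (b \<bullet> i) - 1))) =
     (\<lambda>x. bump 0 (n * (x \<bullet> i - a \<bullet> i) - 1) * bump 0 (n * (b \<bullet> i - x \<bullet> i) - 1))" for i
    by (simp add: algebra_simps)
  ultimately show smooth: "smooth_bump \<phi>"
    unfolding \<phi>_def by (intro smooth_bump_prod) simp_all
  let ?c = "a + (\<Sum>i\<in>Basis. (1 / n) *\<^sub>R i)" and ?d = "b - (\<Sum>i\<in>Basis. (1 / n) *\<^sub>R i)"
  have ci: "?c \<bullet> i = a \<bullet> i + 1 / n" "?d \<bullet> i = b \<bullet> i - 1 / n" if "i \<in> Basis" for i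
    using that by (simp_all add: inner_add_left inner_diff_left)
  have "{x. \<phi> x \<noteq> 0} \<subseteq> cbox ?c ?d"
  proof (clarsimp simp only: mem_box ci)
    fix x and i :: 'a assume "\<phi> x \<noteq> 0" and i: "i \<in> Basis"
    then have "bump 0 (n * (x \<bullet> i - a \<bullet> i) - 1) \<noteq> 0" "bump 0 (n * (b \<bullet> i - x \<bullet> i) - 1) \<noteq> 0"
      unfolding \<phi>_def by auto
    then have "n * (x \<bullet> i - a \<bullet> i) - 1 > 0" "n * (b \<bullet> i - x \<bullet> i) - 1 > 0"
      by (auto simp: bump_def split: if_splits)
    then show "a \<bullet> i + 1 / n \<le> x \<bullet> i \<and> x \<bullet> i \<le> b \<bullet> i - 1 / n"
      using n by (simp add: field_simps)
  qed
  then have cl: "closure {x. \<phi> x \<noteq> 0} \<subseteq> cbox ?c ?d"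
    by (rule closure_minimal) (rule closed_cbox)
  also have "cbox ?c ?d \<subseteq> box a b"
  proof
    fix x assume "x \<in> cbox ?c ?d"
    then have "a \<bullet> i + 1 / n \<le> x \<bullet> i \<and> x \<bullet> i \<le> b \<bullet> i - 1 / n" if "i \<in> Basis" for i
      using that by (auto simp only: mem_box ci)
    moreover have "1 / n > 0" using n by simp
    ultimately have "a \<bullet> i < x \<bullet> i \<and> x \<bullet> i < b \<bullet> i" if "i \<in> Basis" for i
      using that by (smt (verit))
    then show "x \<in> box a b"
      by (simp add: mem_box)
  qed
  finally have "closure {x. \<phi> x \<noteq> 0} \<subseteq> \<Omega>"
    using ab by blast
  moreover have "compact (closure {x. \<phi> x \<noteq> 0})"
    using cl by (metis bounded_cbox bounded_subset compact_eq_bounded_closed closed_closure)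
  ultimately show "\<phi> \<in> test_functions \<Omega>"
    using smooth smooth_bump_C_k by (auto simp: test_functions_def)
qed

lemma box_bump_tendsto:
  fixes a b :: "'a::euclidean_space"
  shows "(\<lambda>n. \<Prod>i\<in>Basis. bump 0 (real (Suc n) * (x \<bullet> i - a \<bullet> i) - 1) *
    bump 0 (real (Suc n) * (b \<bullet> i - x \<bullet> i) - 1)) \<longlonglongrightarrow> indicator (box a b) x"
proof -
  \<comment> \<open>For positive \<open>s\<close> the argument tends to infinity, where
    \<open>bump 0\<close> tends to 1; for \<open>s \<le> 0\<close> it never exceeds -1, where
    \<open>bump 0\<close> vanishes.\<close>
  have lim: "(\<lambda>n. bump 0 (real (Suc n) * s - 1)) \<longlonglongrightarrow> (if s > 0 then 1 else 0)" for s
  proof (cases "s > 0")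
    case True
    then have top: "filterlim (\<lambda>n. real (Suc n) * s - 1) at_top sequentially"
      by real_asymp
    have "(\<lambda>n. exp (- (1 / (real (Suc n) * s - 1)))) \<longlonglongrightarrow> exp (- 0)"
      by (intro tendsto_intros tendsto_divide_0[OF tendsto_const] filterlim_at_top_imp_at_infinity top)
    moreover have "eventually (\<lambda>n. exp (- (1 / (real (Suc n) * s - 1))) = bump 0 (real (Suc n) * s - 1)) sequentially"
      using filterlim_at_top_dense[THEN iffD1, OF top, rule_format, of 0]
      by eventually_elim (simp add: bump_def)
    ultimately have "(\<lambda>n. bump 0 (real (Suc n) * s - 1)) \<longlonglongrightarrow> exp (- 0)"
      by (rule Lim_transform_eventually)
    with True show ?thesis by simp
  next
    case False
    then have "real (Suc n) * s \<le> 0" for n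
      by (simp add: mult_nonneg_nonpos)
    then have "\<not> 0 < real (Suc n) * s - 1" for n
      by (smt (verit))
    then show ?thesis
      using False by (simp add: bump_def)
  qed
  have "(\<lambda>n. \<Prod>i\<in>Basis. bump 0 (real (Suc n) * (x \<bullet> i - a \<bullet> i) - 1) *
    bump 0 (real (Suc n) * (b \<bullet> i - x \<bullet> i) - 1)) \<longlonglongrightarrow>
     (\<Prod>i\<in>Basis. (if x \<bullet> i - a \<bullet> i > 0 then 1 else 0) * (if b \<bullet> i - x \<bullet> i > 0 then 1 else 0))"
    by (intro tendsto_prod tendsto_mult lim)
  also have "(\<Prod>i\<in>Basis. (if x \<bullet> i - a \<bullet> i > 0 then 1 else 0) * (if b \<bullet> i - x \<bullet> i > 0 then 1 else 0))
     = (indicator (box a b) x :: real)"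
  proof (cases "x \<in> box a b")
    case True
    then have "\<And>i. i \<in> Basis \<Longrightarrow> x \<bullet> i - a \<bullet> i > 0 \<and> b \<bullet> i - x \<bullet> i > 0"
      by (simp add: mem_box)
    then show ?thesis using True by simp
  next
    case False
    then obtain i where "i \<in> Basis" "\<not> (x \<bullet> i - a \<bullet> i > 0 \<and> b \<bullet> i - x \<bullet> i > 0)"
      by (force simp: mem_box)
    then have "\<exists>i\<in>Basis. (if x \<bullet> i - a \<bullet> i > 0 then 1 else 0) * (if b \<bullet> i - x \<bullet> i > 0 then 1 else 0) = (0::real)"
      by auto
    then show ?thesis using False by (simp add: prod_zero_iff)
  qed
  finally show ?thesis .
qed

section \<open>Density of test functions\<close>

text \<open>Translation and composition with Borel functions are safe for Borel functions on the
  whole space. A Lebesgue measurable function is therefore replaced, coordinate by coordinate, by a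
  Borel one that vanishes off \<open>S\<close>.\<close>

lemma lebesgue_on_borel_representative:
  fixes g :: "'a::euclidean_space \<Rightarrow> 'b::euclidean_space"
  assumes g: "g \<in> borel_measurable (lebesgue_on S)" and S[measurable]: "S \<in> sets borel"
  obtains g' where "g' \<in> borel_measurable borel" "AE x in lebesgue_on S. g x = g' x"
    "\<And>x. x \<notin> S \<Longrightarrow> g' x = 0"
proof -
  have SL: "S \<in> sets lebesgue"
    using S by simp
  have gm: "(\<lambda>x. indicator S x *\<^sub>R g x) \<in> borel_measurable lebesgue"
    using g SL by (subst (asm) borel_measurable_restrict_space_iff) (auto simp: mult.commute)
  have "\<exists>h\<in>borel_measurable lborel. AE x in lborel. (indicator S x *\<^sub>R g x) \<bullet> i = h x" for i
    by (rule completion_ex_borel_measurable_real) (use gm in measurable)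
  then obtain h where h: "\<And>i. h i \<in> borel_measurable lborel"
    "\<And>i. AE x in lborel. (indicator S x *\<^sub>R g x) \<bullet> i = h i x"
    by metis
  have [measurable]: "h i \<in> borel_measurable borel" for i
    using h(1)[of i] by simp
  define g' where "g' x = indicator S x *\<^sub>R (\<Sum>i\<in>Basis. h i x *\<^sub>R i)" for x
  have "AE x in lborel. \<forall>i\<in>Basis. (indicator S x *\<^sub>R g x) \<bullet> i = h i x"
    using h(2) by (intro AE_finite_allI) auto
  then have "AE x in lebesgue. \<forall>i\<in>Basis. (indicator S x *\<^sub>R g x) \<bullet> i = h i x"
    by (rule AE_completion)
  then have ae: "AE x in lebesgue_on S. g x = g' x"
  proof (subst AE_restrict_space_iff, simp add: SL, eventually_elim, intro impI)
    fix x assume *: "\<forall>i\<in>Basis. (indicator S x *\<^sub>R g x) \<bullet> i = h i x" and "x \<in> S"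
    then have "(\<Sum>i\<in>Basis. (g x \<bullet> i) *\<^sub>R i) = (\<Sum>i\<in>Basis. h i x *\<^sub>R i)"
      by (intro sum.cong) auto
    then show "g x = g' x"
      using \<open>x \<in> S\<close> by (simp add: g'_def euclidean_representation)
  qed
  show thesis
    by (rule that[OF _ ae]) (auto simp: g'_def)
qed

text \<open>Vanishing outside \<open>S\<close> removes the restriction of the measure, and Borel
  measurability removes its completion.\<close>

lemma integral_lebesgue_on_borel:
  fixes g :: "'a::euclidean_space \<Rightarrow> 'b::euclidean_space"
  assumes g[measurable]: "g \<in> borel_measurable borel" and S[measurable]: "S \<in> sets borel"
    and 0: "\<And>x. x \<notin> S \<Longrightarrow> g x = 0"
  shows "integrable (lebesgue_on S) g \<longleftrightarrow> integrable lborel g"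
    and "integral\<^sup>L (lebesgue_on S) g = integral\<^sup>L lborel g"
proof -
  have *: "(\<lambda>x. indicator S x *\<^sub>R g x) = g"
    using 0 by (force simp: indicator_def)
  have **: "g \<in> borel_measurable lborel" by simp
  show "integrable (lebesgue_on S) g \<longleftrightarrow> integrable lborel g"
    by (simp add: integrable_restrict_space * integrable_completion[OF **])
  show "integral\<^sup>L (lebesgue_on S) g = integral\<^sup>L lborel g"
    by (simp add: integral_restrict_space * integral_completion[OF **])
qed

text \<open>The explicit class is used for density because sums, multiples and translates stay
  inside it by its inductive description, whereas membership in every \<open>C_k\<close> would have
  to be re-established each time.\<close>

definition test_bumps :: "'a::euclidean_space set \<Rightarrow> ('a \<Rightarrow> real) set" where
  "test_bumps \<Omega> = {\<phi> \<in> test_functions \<Omega>. smooth_bump \<phi>}"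

lemma test_function_borel [measurable_dest]: "\<phi> \<in> test_functions \<Omega> \<Longrightarrow> \<phi> \<in> borel_measurable borel"
  by (rule borel_measurable_continuous_onI) (rule test_function_continuous)

lemma test_function_derivative_borel [measurable_dest]:
  "\<phi> \<in> test_functions \<Omega> \<Longrightarrow> (\<lambda>x. frechet_derivative \<phi> (at x) v) \<in> borel_measurable borel"
  by (rule borel_measurable_continuous_onI) (rule test_function_derivative_continuous)

lemma test_function_integrable:
  assumes "\<phi> \<in> test_functions \<Omega>"
  shows "integrable lborel \<phi>"
proof -
  obtain K where K: "compact K" "\<forall>x. x \<notin> K \<longrightarrow> \<phi> x = 0"
    using test_function_support[OF assms] by blast
  show ?thesis
    by (rule integrable_compact_support[OF test_function_continuous[OF assms] K(1)]) (use K in blast)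
qed

lemma test_bumpsI:
  assumes \<phi>: "smooth_bump \<phi>" and K: "compact K" "K \<subseteq> \<Omega>" "\<And>x. x \<notin> K \<Longrightarrow> \<phi> x = 0"
  shows "\<phi> \<in> test_bumps \<Omega>"
proof -
  have "{x. \<phi> x \<noteq> 0} \<subseteq> K"
    using K(3) by blast
  then have "closure {x. \<phi> x \<noteq> 0} \<subseteq> K"
    using K(1) by (simp add: closure_minimal compact_imp_closed)
  moreover from this have "compact (closure {x. \<phi> x \<noteq> 0})"
    using K(1) by (meson bounded_subset closed_closure compact_eq_bounded_closed)
  ultimately show ?thesis
    unfolding test_bumps_def test_functions_def using \<phi> K(2) smooth_bump_C_k[OF \<phi>] by blast
qed

lemma test_bumps_support:
  assumes "\<phi> \<in> test_bumps \<Omega>"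
  shows "\<exists>K. compact K \<and> K \<subseteq> \<Omega> \<and> (\<forall>x. x \<notin> K \<longrightarrow> \<phi> x = 0)"
proof -
  have "\<phi> \<in> test_functions \<Omega>"
    using assms by (simp add: test_bumps_def)
  from test_function_support[OF this] show ?thesis by blast
qed

lemma test_bumps_add:
  assumes \<phi>: "\<phi> \<in> test_bumps \<Omega>" and \<psi>: "\<psi> \<in> test_bumps \<Omega>"
  shows "(\<lambda>x. \<phi> x + \<psi> x) \<in> test_bumps \<Omega>"
proof -
  obtain K where K: "compact K" "K \<subseteq> \<Omega>" "\<forall>x. x \<notin> K \<longrightarrow> \<phi> x = 0"
    using test_bumps_support[OF \<phi>] by blast
  obtain L where L: "compact L" "L \<subseteq> \<Omega>" "\<forall>x. x \<notin> L \<longrightarrow> \<psi> x = 0"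
    using test_bumps_support[OF \<psi>] by blast
  have "smooth_bump (\<lambda>x. \<phi> x + \<psi> x)"
    using \<phi> \<psi> by (intro smooth_bump.add) (auto simp: test_bumps_def)
  then show ?thesis
    by (rule test_bumpsI[of _ "K \<union> L"]) (use K L in auto)
qed

lemma test_bumps_cmult:
  assumes \<phi>: "\<phi> \<in> test_bumps \<Omega>"
  shows "(\<lambda>x. c * \<phi> x) \<in> test_bumps \<Omega>"
proof -
  obtain K where K: "compact K" "K \<subseteq> \<Omega>" "\<forall>x. x \<notin> K \<longrightarrow> \<phi> x = 0"
    using test_bumps_support[OF \<phi>] by blast
  have "smooth_bump (\<lambda>x. c * \<phi> x)"
    using \<phi> by (intro smooth_bump.mult smooth_bump.const) (auto simp: test_bumps_def)
  then show ?thesis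
    by (rule test_bumpsI[of _ K]) (use K in auto)
qed

text \<open>Membership in the L1 closure of \<open>test_bumps \<Omega>\<close> with respect to
  \<open>lborel\<close>.\<close>

definition test_approx :: "'a::euclidean_space set \<Rightarrow> ('a \<Rightarrow> real) \<Rightarrow> bool" where
  "test_approx \<Omega> f \<longleftrightarrow> integrable lborel f \<and>
     (\<forall>e>0. \<exists>\<phi>\<in>test_bumps \<Omega>. (\<integral>x. \<bar>f x - \<phi> x\<bar> \<partial>lborel) < e)"

lemma test_bumps_integrable: "\<phi> \<in> test_bumps \<Omega> \<Longrightarrow> integrable lborel \<phi>"
  by (auto simp: test_bumps_def test_function_integrable)

lemma test_bumps_approx: "\<phi> \<in> test_bumps \<Omega> \<Longrightarrow> test_approx \<Omega> \<phi>"
  by (auto simp: test_approx_def test_bumps_integrable intro!: bexI[of _ \<phi>])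

lemma integral_abs_triangle:
  fixes f g h :: "'a \<Rightarrow> real"
  assumes "integrable M f" "integrable M g" "integrable M h"
  shows "(\<integral>x. \<bar>f x - h x\<bar> \<partial>M) \<le> (\<integral>x. \<bar>f x - g x\<bar> \<partial>M) + (\<integral>x. \<bar>g x - h x\<bar> \<partial>M)"
proof -
  have "(\<integral>x. \<bar>f x - h x\<bar> \<partial>M) \<le> (\<integral>x. \<bar>f x - g x\<bar> + \<bar>g x - h x\<bar> \<partial>M)"
    using assms by (intro integral_mono) auto
  also have "\<dots> = (\<integral>x. \<bar>f x - g x\<bar> \<partial>M) + (\<integral>x. \<bar>g x - h x\<bar> \<partial>M)"
    using assms by (intro Bochner_Integration.integral_add) auto
  finally show ?thesis .
qed

lemma test_approx_limit:
  assumes f: "integrable lborel f" and "\<And>e. e > 0 \<Longrightarrow> \<exists>g. test_approx \<Omega> g \<and> (\<integral>x. \<bar>f x - g x\<bar> \<partial>lborel) < e"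
  shows "test_approx \<Omega> f"
  unfolding test_approx_def
proof (intro conjI allI impI f)
  fix e :: real assume "e > 0"
  then obtain g where g: "test_approx \<Omega> g" "(\<integral>x. \<bar>f x - g x\<bar> \<partial>lborel) < e / 2"
    using assms(2)[of "e / 2"] by auto
  then obtain \<phi> where \<phi>: "\<phi> \<in> test_bumps \<Omega>" "(\<integral>x. \<bar>g x - \<phi> x\<bar> \<partial>lborel) < e / 2"
    using \<open>e > 0\<close> unfolding test_approx_def by (meson half_gt_zero)
  have "(\<integral>x. \<bar>f x - \<phi> x\<bar> \<partial>lborel) \<le> (\<integral>x. \<bar>f x - g x\<bar> \<partial>lborel) + (\<integral>x. \<bar>g x - \<phi> x\<bar> \<partial>lborel)"
    using f g(1) test_bumps_integrable[OF \<phi>(1)] unfolding test_approx_def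
    by (intro integral_abs_triangle) auto
  with g \<phi> show "\<exists>\<phi>\<in>test_bumps \<Omega>. (\<integral>x. \<bar>f x - \<phi> x\<bar> \<partial>lborel) < e"
    by (intro bexI[of _ \<phi>]) auto
qed

text \<open>Dominated convergence turns pointwise limits into L1 limits, under which the closure is
  stable. All later limit passages towards density go through this lemma.\<close>

lemma test_approx_tendsto:
  assumes s: "\<And>n. test_approx \<Omega> (s n)" and w: "integrable lborel w"
    and bound: "\<And>n x. \<bar>s n x\<bar> \<le> w x" and lim: "\<And>x. (\<lambda>n. s n x) \<longlonglongrightarrow> f x"
  shows "test_approx \<Omega> f"
proof -
  have si: "integrable lborel (s n)" for n
    using s by (auto simp: test_approx_def)
  then have [measurable]: "s n \<in> borel_measurable borel" for n
    using borel_measurable_integrable[OF si, of n] by simp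
  have fm[measurable]: "f \<in> borel_measurable borel"
    by (rule borel_measurable_LIMSEQ_real[OF lim]) measurable
  have fw: "\<bar>f x\<bar> \<le> w x" for x
    by (rule LIMSEQ_le_const2[OF tendsto_rabs[OF lim]]) (use bound in auto)
  have f: "integrable lborel f"
    by (rule Bochner_Integration.integrable_bound[OF w]) (use fw in \<open>auto intro!: AE_I2 intro: order.trans[OF _ abs_ge_self]\<close>)
  have "(\<lambda>n. \<integral>x. \<bar>f x - s n x\<bar> \<partial>lborel) \<longlonglongrightarrow> (\<integral>x. \<bar>f x - f x\<bar> \<partial>lborel)"
  proof (rule integral_dominated_convergence[where w="\<lambda>x. 2 * w x"])
    show "AE x in lborel. (\<lambda>n. \<bar>f x - s n x\<bar>) \<longlonglongrightarrow> \<bar>f x - f x\<bar>"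
      by (intro AE_I2 tendsto_intros lim)
    show "AE x in lborel. norm \<bar>f x - s n x\<bar> \<le> 2 * w x" for n
      proof (intro AE_I2)
      fix x
      show "norm \<bar>f x - s n x\<bar> \<le> 2 * w x"
        using fw[of x] bound[of n x] by (smt (verit) real_norm_def)
    qed
  qed (use w in auto)
  then have "(\<lambda>n. \<integral>x. \<bar>f x - s n x\<bar> \<partial>lborel) \<longlonglongrightarrow> 0" by simp
  note lim0 = this
  have "\<exists>g. test_approx \<Omega> g \<and> (\<integral>x. \<bar>f x - g x\<bar> \<partial>lborel) < e" if e: "e > 0" for e
  proof -
    obtain n where "(\<integral>x. \<bar>f x - s n x\<bar> \<partial>lborel) < e"
      using eventually_happens[OF order_tendstoD(2)[OF lim0 e]] by auto
    with s[of n] show ?thesis by blast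
  qed
  with f show ?thesis by (rule test_approx_limit)
qed

lemma test_approx_add:
  assumes f: "test_approx \<Omega> f" and g: "test_approx \<Omega> g"
  shows "test_approx \<Omega> (\<lambda>x. f x + g x)"
  unfolding test_approx_def
proof (intro conjI allI impI)
  have fi: "integrable lborel f" and gi: "integrable lborel g"
    using f g by (auto simp: test_approx_def)
  then show "integrable lborel (\<lambda>x. f x + g x)" by simp
  fix e :: real assume "e > 0"
  obtain \<phi> where \<phi>: "\<phi> \<in> test_bumps \<Omega>" "(\<integral>x. \<bar>f x - \<phi> x\<bar> \<partial>lborel) < e / 2"
    using f \<open>e > 0\<close> unfolding test_approx_def by (meson half_gt_zero)
  obtain \<psi> where \<psi>: "\<psi> \<in> test_bumps \<Omega>" "(\<integral>x. \<bar>g x - \<psi> x\<bar> \<partial>lborel) < e / 2"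
    using g \<open>e > 0\<close> unfolding test_approx_def by (meson half_gt_zero)
  note i = fi gi test_bumps_integrable[OF \<phi>(1)] test_bumps_integrable[OF \<psi>(1)]
  have "(\<integral>x. \<bar>(f x + g x) - (\<phi> x + \<psi> x)\<bar> \<partial>lborel) \<le> (\<integral>x. \<bar>f x - \<phi> x\<bar> + \<bar>g x - \<psi> x\<bar> \<partial>lborel)"
    using i by (intro integral_mono) auto
  also have "\<dots> = (\<integral>x. \<bar>f x - \<phi> x\<bar> \<partial>lborel) + (\<integral>x. \<bar>g x - \<psi> x\<bar> \<partial>lborel)"
    using i by (intro Bochner_Integration.integral_add) auto
  finally show "\<exists>\<phi>\<in>test_bumps \<Omega>. (\<integral>x. \<bar>f x + g x - \<phi> x\<bar> \<partial>lborel) < e"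
    using \<phi> \<psi> test_bumps_add[OF \<phi>(1) \<psi>(1)] by (intro bexI[of _ "\<lambda>x. \<phi> x + \<psi> x"]) auto
qed

lemma test_approx_cmult:
  assumes f: "test_approx \<Omega> f"
  shows "test_approx \<Omega> (\<lambda>x. c * f x)"
  unfolding test_approx_def
proof (intro conjI allI impI)
  have fi: "integrable lborel f"
    using f by (auto simp: test_approx_def)
  then show "integrable lborel (\<lambda>x. c * f x)" by simp
  fix e :: real assume "e > 0"
  then have "e / (\<bar>c\<bar> + 1) > 0" by simp
  then obtain \<phi> where \<phi>: "\<phi> \<in> test_bumps \<Omega>" "(\<integral>x. \<bar>f x - \<phi> x\<bar> \<partial>lborel) < e / (\<bar>c\<bar> + 1)"
    using f unfolding test_approx_def by meson
  have "(\<integral>x. \<bar>c * f x - c * \<phi> x\<bar> \<partial>lborel) = (\<integral>x. \<bar>c\<bar> * \<bar>f x - \<phi> x\<bar> \<partial>lborel)"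
    by (simp flip: right_diff_distrib add: abs_mult)
  also have "\<dots> = \<bar>c\<bar> * (\<integral>x. \<bar>f x - \<phi> x\<bar> \<partial>lborel)"
    by (rule integral_mult_right_zero)
  also have "\<dots> \<le> (\<bar>c\<bar> + 1) * (\<integral>x. \<bar>f x - \<phi> x\<bar> \<partial>lborel)"
    by (intro mult_right_mono integral_nonneg) auto
  also have "\<dots> < e"
    using \<phi>(2) by (simp add: field_simps)
  finally show "\<exists>\<phi>\<in>test_bumps \<Omega>. (\<integral>x. \<bar>c * f x - \<phi> x\<bar> \<partial>lborel) < e"
    using test_bumps_cmult[OF \<phi>(1)] by (intro bexI[of _ "\<lambda>x. c * \<phi> x"]) auto
qed

lemma test_approx_zero: "test_approx \<Omega> (\<lambda>x. 0)"
  by (intro test_bumps_approx test_bumpsI[of _ "{}"] smooth_bump.const) auto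

lemma test_approx_diff:
  assumes "test_approx \<Omega> f" "test_approx \<Omega> g"
  shows "test_approx \<Omega> (\<lambda>x. f x - g x)"
  using test_approx_add[OF assms(1) test_approx_cmult[OF assms(2), of "-1"]] by simp

lemma integrable_indicator_lborel:
  "A \<in> sets borel \<Longrightarrow> emeasure lborel A < \<infinity> \<Longrightarrow> integrable lborel (indicator A :: _ \<Rightarrow> real)"
  by simp

text \<open>All factors lie between 0 and 1 and one of them vanishes at each point off the box, so
  the indicator of the box is itself the dominating function.\<close>

lemma test_approx_box:
  assumes "box a b \<subseteq> \<Omega>"
  shows "test_approx \<Omega> (indicator (box a b))"
proof (rule test_approx_tendsto[OF _ _ _ box_bump_tendsto, where w="indicator (box a b)"])
  let ?\<phi> = "\<lambda>n x. \<Prod>i\<in>Basis. bump 0 (real (Suc n) * (x \<bullet> i - a \<bullet> i) - 1) *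
    bump 0 (real (Suc n) * (b \<bullet> i - x \<bullet> i) - 1)"
  show "test_approx \<Omega> (?\<phi> n)" for n
    using box_bump_test_functions[OF assms, of "real (Suc n)"]
    by (intro test_bumps_approx) (auto simp: test_bumps_def)
  show "integrable lborel (indicator (box a b) :: 'a \<Rightarrow> real)"
    by (intro integrable_indicator_lborel) (auto simp: emeasure_lborel_box_eq)
  show "\<bar>?\<phi> n x\<bar> \<le> indicator (box a b) x" for n x
  proof (cases "x \<in> box a b")
    case True
    have "\<bar>?\<phi> n x\<bar> \<le> 1"
      unfolding abs_prod
      by (intro prod_le_1 conjI) (auto simp: abs_mult bump_nonneg intro!: mult_le_one bump_0_le_1)
    then show ?thesis using True by simp
  next
    case False
    then obtain i where i: "i \<in> Basis" "x \<bullet> i \<le> a \<bullet> i \<or> b \<bullet> i \<le> x \<bullet> i"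
      by (force simp: mem_box)
    have neg: "bump 0 (real (Suc n) * s - 1) = 0" if "s \<le> 0" for s
    proof -
      have "real (Suc n) * s \<le> 0"
        using that by (simp add: mult_nonneg_nonpos)
      then have "\<not> 0 < real (Suc n) * s - 1" by linarith
      then show ?thesis by (simp add: bump_def)
    qed
    have "bump 0 (real (Suc n) * (x \<bullet> i - a \<bullet> i) - 1) * bump 0 (real (Suc n) * (b \<bullet> i - x \<bullet> i) - 1) = 0"
      using i(2) neg[of "x \<bullet> i - a \<bullet> i"] neg[of "b \<bullet> i - x \<bullet> i"] by auto
    then have "?\<phi> n x = 0"
      using i(1) by (intro prod_zero[OF finite_Basis]) blast
    then show ?thesis by (simp only: abs_zero indicator_pos_le)
  qed
qed

text \<open>Dynkin argument: boxes form an intersection-stable generator of the Borel sets. Cutting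
  with a fixed box keeps all measures finite, so complements become differences and countable unions
  become limits dominated by one indicator.\<close>

lemma test_approx_borel_Int_box:
  fixes A :: "'a::euclidean_space set"
  assumes ab: "box a b \<subseteq> \<Omega>" and A: "A \<in> sets borel"
  shows "test_approx \<Omega> (indicator (A \<inter> box a b))"
proof -
  let ?G = "range (\<lambda>(a, b). box a b :: 'a set)"
  have fin: "emeasure lborel (B \<inter> box a b) < \<infinity>" if "B \<in> sets borel" for B :: "'a set"
  proof -
    have "emeasure lborel (B \<inter> box a b) \<le> emeasure lborel (box a b)"
      by (intro emeasure_mono) auto
    also have "\<dots> < \<infinity>" by (auto simp: emeasure_lborel_box_eq)
    finally show ?thesis .
  qed
  have A': "A \<in> sigma_sets UNIV ?G"
    using A by (simp add: borel_eq_box)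
  have st: "Int_stable ?G"
    by (auto simp: Int_stable_def box_Int_box)
  have pw: "?G \<subseteq> Pow UNIV" by auto
  from st pw A' show ?thesis
  proof (induction rule: sigma_sets_induct_disjoint)
    case (basic A)
    then obtain c d where "A = box c d" by auto
    moreover have "box c d \<inter> box a b \<subseteq> \<Omega>" using ab by auto
    ultimately show ?case
      using test_approx_box by (auto simp: box_Int_box)
  next
    case empty
    then show ?case using test_approx_zero[of \<Omega>] by simp
  next
    case (compl A)
    have "indicator ((UNIV - A) \<inter> box a b) = (\<lambda>x. indicator (box a b) x - indicator (A \<inter> box a b) x :: real)"
      by (auto simp: indicator_def)
    then show ?case
      using test_approx_diff[OF test_approx_box[OF ab] compl(2)] by simp
  next
    case (union F)
    have F: "F i \<in> sets borel" for i
      using union(2) by (auto simp: borel_eq_box)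
    have part: "test_approx \<Omega> (indicator ((\<Union>i<n. F i) \<inter> box a b))" for n
    proof (induction n)
      case 0
      then show ?case using test_approx_zero[of \<Omega>] by simp
    next
      case (Suc n)
      have "F n \<inter> F i = {}" if "i < n" for i
        using union(1) that by (auto simp: disjoint_family_on_def)
      then have "indicator ((\<Union>i<Suc n. F i) \<inter> box a b) =
        (\<lambda>x. indicator ((\<Union>i<n. F i) \<inter> box a b) x + indicator (F n \<inter> box a b) x :: real)"
        by (fastforce simp: indicator_def less_Suc_eq)
      then show ?case
        using test_approx_add[OF Suc union(3)[of n]] by simp
    qed
    show ?case
    proof (rule test_approx_tendsto[OF part, where w="indicator (box a b)"])
      show "(\<lambda>n. indicator ((\<Union>i<n. F i) \<inter> box a b) x) \<longlonglongrightarrow> (indicator (\<Union> (range F) \<inter> box a b) x :: real)" for x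
        by (cases "x \<in> box a b")
          (use LIMSEQ_indicator_UN[of F x, where 'a=real] in \<open>auto simp: indicator_inter_arith\<close>)
    qed (use fin[of UNIV] in \<open>auto simp: indicator_def\<close>)
  qed
qed

lemma test_approx_borel:
  fixes A :: "'a::euclidean_space set"
  assumes \<Omega>: "open \<Omega>" and A: "A \<in> sets borel" "emeasure lborel A < \<infinity>"
  shows "test_approx \<Omega> (indicator (A \<inter> \<Omega>))"
proof -
  obtain D where D: "countable D" "\<Union>D = \<Omega>" "\<And>X. X \<in> D \<Longrightarrow> \<exists>a b. X = box a b"
    using open_countable_Union_open_box[OF \<Omega>] by metis
  define B where "B = from_nat_into (insert {} D)"
  \<comment> \<open>The empty set was added so that the enumeration also makes sense when
    \<open>D\<close> is empty.\<close>
  have rB: "range B = insert {} D"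
    unfolding B_def using D(1) by (intro range_from_nat_into) auto
  then have UB: "(\<Union>i. B i) = \<Omega>"
    using D(2) by auto
  have Bb: "\<exists>a b. B n = box a b" for n
  proof -
    have "B n \<in> insert {} D" using rB by blast
    then show ?thesis
      using D(3) by (metis box_eq_empty(1) inner_Basis inner_zero_left insertE nonempty_Basis all_not_in_conv order_refl)
  qed
  then have Bm: "B n \<in> sets borel" for n
    by (metis open_box borel_open)
  \<comment> \<open>\<open>A'\<close> is generalised because the induction step passes to
    \<open>A' - B n\<close>, which makes the two pieces disjoint and their indicators
    additive.\<close>
  have part: "test_approx \<Omega> (indicator (A' \<inter> (\<Union>i<n. B i)))" if "A' \<in> sets borel" for n A'
    using that
  proof (induction n arbitrary: A')
    case 0
    then show ?case using test_approx_zero[of \<Omega>] by simp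
  next
    case (Suc n)
    obtain a b where ab: "B n = box a b" using Bb by blast
    then have sub: "box a b \<subseteq> \<Omega>" using UB by auto
    have "(A' - B n) \<in> sets borel" using Suc.prems Bm by auto
    from Suc.IH[OF this] have "test_approx \<Omega> (indicator ((A' - B n) \<inter> (\<Union>i<n. B i)))" .
    moreover have "indicator (A' \<inter> (\<Union>i<Suc n. B i)) =
        (\<lambda>x. indicator ((A' - B n) \<inter> (\<Union>i<n. B i)) x + indicator (A' \<inter> B n) x :: real)"
      by (fastforce simp: indicator_def less_Suc_eq)
    ultimately show ?case
      using test_approx_add test_approx_borel_Int_box[OF sub Suc.prems] ab by simp
  qed
  show ?thesis
  proof (rule test_approx_tendsto[OF part[OF A(1)], where w="indicator A"])
    show "(\<lambda>n. indicator (A \<inter> (\<Union>i<n. B i)) x) \<longlonglongrightarrow> (indicator (A \<inter> \<Omega>) x :: real)" for x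
      using LIMSEQ_indicator_UN[of B x, where 'a=real] UB by (auto simp: indicator_inter_arith intro!: tendsto_intros)
  qed (use A in \<open>auto simp: indicator_def\<close>)
qed

lemma test_approx_integrable:
  fixes f :: "'a::euclidean_space \<Rightarrow> real"
  assumes \<Omega>: "open \<Omega>" and f: "integrable lborel f"
  shows "test_approx \<Omega> (\<lambda>x. indicator \<Omega> x * f x)"
  using f
proof (induction rule: integrable_induct)
  case (base A c)
  then have "test_approx \<Omega> (\<lambda>x. c * indicator (A \<inter> \<Omega>) x)"
    by (intro test_approx_cmult test_approx_borel \<Omega>) auto
  then show ?case
    by (simp add: indicator_inter_arith ac_simps)
next
  case (add f g)
  then show ?case
    using test_approx_add by (fastforce simp: distrib_left)
next
  case (lim f s)
  show ?case
  \<comment> \<open>The dominating function \<open>2 * norm (f x)\<close> is the one supplied by the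
    induction rule for integrable functions.\<close>
  proof (rule test_approx_tendsto[OF lim(5), where w="\<lambda>x. 2 * norm (f x)"])
    show "(\<lambda>n. indicator \<Omega> x * s n x) \<longlonglongrightarrow> indicator \<Omega> x * f x" for x
      using lim(2)[of x] by (auto intro!: tendsto_intros)
    show "\<bar>indicator \<Omega> x * s n x\<bar> \<le> 2 * norm (f x)" for n x
      using lim(3)[of x n] by (auto simp: indicator_def abs_mult)
  qed (use lim in auto)
qed

lemma L1_test_approx:
  fixes f :: "'a::euclidean_space \<Rightarrow> real"
  assumes \<Omega>: "open \<Omega>" and f: "f \<in> L1 \<Omega>" and e: "e > 0"
  shows "\<exists>\<phi>\<in>test_bumps \<Omega>. (\<integral>x. \<bar>f x - \<phi> x\<bar> \<partial>lebesgue_on \<Omega>) < e"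
proof -
  have \<Omega>m[measurable]: "\<Omega> \<in> sets borel" using \<Omega> by simp
  have fi: "integrable (lebesgue_on \<Omega>) f"
    using f by (simp add: L1_def)
  obtain g where g[measurable]: "g \<in> borel_measurable borel" and ae: "AE x in lebesgue_on \<Omega>. f x = g x"
    and g0: "\<And>x. x \<notin> \<Omega> \<Longrightarrow> g x = 0"
    using lebesgue_on_borel_representative[OF borel_measurable_integrable[OF fi] \<Omega>m] by blast
  have gm: "g \<in> borel_measurable (lebesgue_on \<Omega>)"
    by (simp add: measurable_restrict_space1 measurable_completion)
  have "integrable (lebesgue_on \<Omega>) g"
    using fi integrable_cong_AE[OF borel_measurable_integrable[OF fi] gm ae] by simp
  then have "integrable lborel g"
    using integral_lebesgue_on_borel[OF g \<Omega>m g0] by simp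
  from test_approx_integrable[OF \<Omega> this]
  obtain \<phi> where \<phi>: "\<phi> \<in> test_bumps \<Omega>" "(\<integral>x. \<bar>indicator \<Omega> x * g x - \<phi> x\<bar> \<partial>lborel) < e"
    using e unfolding test_approx_def by meson
  have ti: "\<phi> \<in> test_functions \<Omega>" using \<phi>(1) by (simp add: test_bumps_def)
  then have [measurable]: "\<phi> \<in> borel_measurable borel"
    by (rule test_function_borel)
  have \<phi>0: "\<phi> x = 0" if "x \<notin> \<Omega>" for x
    using test_function_support[OF ti] that by blast
  have \<phi>m: "\<phi> \<in> borel_measurable (lebesgue_on \<Omega>)"
    by (simp add: measurable_restrict_space1 measurable_completion)
  have "(\<lambda>x. indicator \<Omega> x * g x) = g"
    using g0 by (force simp: indicator_def)
  have "(\<integral>x. \<bar>f x - \<phi> x\<bar> \<partial>lebesgue_on \<Omega>) = (\<integral>x. \<bar>g x - \<phi> x\<bar> \<partial>lebesgue_on \<Omega>)"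
    by (rule integral_cong_AE) (use ae gm \<phi>m fi in \<open>auto elim: eventually_mono\<close>)
  also have "\<dots> = (\<integral>x. \<bar>g x - \<phi> x\<bar> \<partial>lborel)"
    by (rule integral_lebesgue_on_borel(2)) (use g0 \<phi>0 in auto)
  also have "(\<lambda>x. \<bar>g x - \<phi> x\<bar>) = (\<lambda>x. \<bar>indicator \<Omega> x * g x - \<phi> x\<bar>)"
    using g0 by (force simp: indicator_def)
  finally show ?thesis
    using \<phi> by (intro bexI[of _ \<phi>]) simp_all
qed

section \<open>Duality between bounded and integrable functions\<close>

lemma LinfE:
  assumes "g \<in> Linf \<Omega>"
  obtains C where "C \<ge> 0" "AE x in lebesgue_on \<Omega>. norm (g x) \<le> C"
proof -
  obtain C where "AE x in lebesgue_on \<Omega>. norm (g x) \<le> C"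
    using assms by (auto simp: Linf_def)
  then have "AE x in lebesgue_on \<Omega>. norm (g x) \<le> max C 0"
    by eventually_elim auto
  then show thesis using that[of "max C 0"] by auto
qed

lemma LinfI:
  "g \<in> borel_measurable (lebesgue_on \<Omega>) \<Longrightarrow> AE x in lebesgue_on \<Omega>. norm (g x) \<le> C \<Longrightarrow> g \<in> Linf \<Omega>"
  by (auto simp: Linf_def)

lemma Linf_measurable: "g \<in> Linf \<Omega> \<Longrightarrow> g \<in> borel_measurable (lebesgue_on \<Omega>)"
  by (simp add: Linf_def)

lemma L1_integrable: "\<phi> \<in> L1 \<Omega> \<Longrightarrow> integrable (lebesgue_on \<Omega>) \<phi>"
  by (simp add: L1_def)

lemma L1_measurable: "\<phi> \<in> L1 \<Omega> \<Longrightarrow> \<phi> \<in> borel_measurable (lebesgue_on \<Omega>)"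
  by (simp add: L1_def)

lemma Linf_L1_integrable:
  assumes g: "g \<in> Linf \<Omega>" and \<phi>: "\<phi> \<in> L1 \<Omega>"
  shows "integrable (lebesgue_on \<Omega>) (\<lambda>x. g x \<bullet> \<phi> x)"
proof -
  obtain C where C: "C \<ge> 0" "AE x in lebesgue_on \<Omega>. norm (g x) \<le> C"
    using g by (rule LinfE)
  note [measurable] = Linf_measurable[OF g] L1_measurable[OF \<phi>]
  have "integrable (lebesgue_on \<Omega>) (\<lambda>x. C * norm (\<phi> x))"
    using L1_integrable[OF \<phi>] by auto
  then show ?thesis
  proof (rule Bochner_Integration.integrable_bound)
    show "AE x in lebesgue_on \<Omega>. norm (g x \<bullet> \<phi> x) \<le> norm (C * norm (\<phi> x))"
      using C(2)
    proof eventually_elim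
      case (elim x)
      then have "norm (g x) * norm (\<phi> x) \<le> C * norm (\<phi> x)"
        by (intro mult_right_mono) auto
      then show ?case
        using Cauchy_Schwarz_ineq2[of "g x" "\<phi> x"] C(1) by (simp add: abs_mult)
    qed
  qed measurable
qed

lemma Linf_L1_mult_integrable:
  fixes g \<phi> :: "'a::euclidean_space \<Rightarrow> real"
  shows "g \<in> Linf \<Omega> \<Longrightarrow> \<phi> \<in> L1 \<Omega> \<Longrightarrow> integrable (lebesgue_on \<Omega>) (\<lambda>x. g x * \<phi> x)"
  using Linf_L1_integrable[of g \<Omega> \<phi>] by simp

lemma Linf_L1_bound:
  fixes g \<phi> :: "'a::euclidean_space \<Rightarrow> real"
  assumes g: "g \<in> borel_measurable (lebesgue_on \<Omega>)" "AE x in lebesgue_on \<Omega>. \<bar>g x\<bar> \<le> C" and \<phi>: "\<phi> \<in> L1 \<Omega>"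
  shows "\<bar>\<integral>x. g x * \<phi> x \<partial>lebesgue_on \<Omega>\<bar> \<le> C * (\<integral>x. \<bar>\<phi> x\<bar> \<partial>lebesgue_on \<Omega>)"
proof -
  have gL: "g \<in> Linf \<Omega>" using g by (intro LinfI[of _ _ C]) auto
  have "\<bar>\<integral>x. g x * \<phi> x \<partial>lebesgue_on \<Omega>\<bar> \<le> (\<integral>x. \<bar>g x * \<phi> x\<bar> \<partial>lebesgue_on \<Omega>)"
    by (rule integral_abs_bound)
  also have "\<dots> \<le> (\<integral>x. C * \<bar>\<phi> x\<bar> \<partial>lebesgue_on \<Omega>)"
  proof (rule integral_mono_AE)
    show "integrable (lebesgue_on \<Omega>) (\<lambda>x. \<bar>g x * \<phi> x\<bar>)"
      using Linf_L1_mult_integrable[OF gL \<phi>] by simp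
    show "integrable (lebesgue_on \<Omega>) (\<lambda>x. C * \<bar>\<phi> x\<bar>)"
      using L1_integrable[OF \<phi>] by simp
    show "AE x in lebesgue_on \<Omega>. \<bar>g x * \<phi> x\<bar> \<le> C * \<bar>\<phi> x\<bar>"
      using g(2) by eventually_elim (simp add: abs_mult mult_right_mono)
  qed
  also have "\<dots> = C * (\<integral>x. \<bar>\<phi> x\<bar> \<partial>lebesgue_on \<Omega>)" by simp
  finally show ?thesis .
qed

lemma borel_measurable_lebesgue_on:
  "g \<in> borel_measurable borel \<Longrightarrow> g \<in> borel_measurable (lebesgue_on \<Omega>)"
  by (simp add: measurable_restrict_space1 measurable_completion)

lemma integrable_lebesgue_on:
  fixes g :: "'a::euclidean_space \<Rightarrow> real"
  assumes g: "integrable lborel g" and \<Omega>: "\<Omega> \<in> sets borel"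
  shows "integrable (lebesgue_on \<Omega>) g"
proof -
  have [measurable]: "g \<in> borel_measurable borel"
    using borel_measurable_integrable[OF g] by simp
  have "(\<lambda>x. indicator \<Omega> x * g x) \<in> borel_measurable lborel"
    using \<Omega> by measurable
  moreover have "integrable lborel (\<lambda>x. indicator \<Omega> x * g x)"
    using integrable_mult_indicator[OF _ g, of \<Omega>] \<Omega> by simp
  ultimately show ?thesis
    using \<Omega> by (simp add: integrable_restrict_space integrable_completion)
qed

lemma test_function_L1:
  assumes "\<phi> \<in> test_functions \<Omega>" "\<Omega> \<in> sets borel"
  shows "\<phi> \<in> L1 \<Omega>" and "(\<lambda>x. frechet_derivative \<phi> (at x) v) \<in> L1 \<Omega>"
proof -
  obtain K where K: "compact K" "\<forall>x. x \<notin> K \<longrightarrow> frechet_derivative \<phi> (at x) v = 0"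
    using test_function_support[OF assms(1)] by blast
  have "integrable lborel (\<lambda>x. frechet_derivative \<phi> (at x) v)"
    by (rule integrable_compact_support[OF test_function_derivative_continuous[OF assms(1)] K(1)])
      (use K in blast)
  then show "(\<lambda>x. frechet_derivative \<phi> (at x) v) \<in> L1 \<Omega>"
    using assms(2) by (simp add: L1_def integrable_lebesgue_on)
  show "\<phi> \<in> L1 \<Omega>"
    using test_function_integrable[OF assms(1)] assms(2) by (simp add: L1_def integrable_lebesgue_on)
qed

lemma test_bumps_L1: "\<phi> \<in> test_bumps \<Omega> \<Longrightarrow> \<Omega> \<in> sets borel \<Longrightarrow> \<phi> \<in> L1 \<Omega>"
  by (simp add: test_bumps_def test_function_L1)

text \<open>A uniform L\<infinity> bound makes the pairings equicontinuous on L1, so convergence on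
  the dense set of bumps spreads to all of L1. This is what makes distributional convergence of
  bounded gradients weak* convergence.\<close>

lemma L1_weak_convergence:
  fixes g :: "nat \<Rightarrow> 'a::euclidean_space \<Rightarrow> real"
  assumes \<Omega>: "open \<Omega>"
    and gn: "\<And>n. g n \<in> borel_measurable (lebesgue_on \<Omega>)" "\<And>n. AE x in lebesgue_on \<Omega>. \<bar>g n x\<bar> \<le> C"
    and h: "h \<in> borel_measurable (lebesgue_on \<Omega>)" "AE x in lebesgue_on \<Omega>. \<bar>h x\<bar> \<le> C"
    and lim: "\<And>\<phi>. \<phi> \<in> test_bumps \<Omega> \<Longrightarrow>
      (\<lambda>n. \<integral>x. g n x * \<phi> x \<partial>lebesgue_on \<Omega>) \<longlonglongrightarrow> (\<integral>x. h x * \<phi> x \<partial>lebesgue_on \<Omega>)"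
    and f: "f \<in> L1 \<Omega>"
  shows "(\<lambda>n. \<integral>x. g n x * f x \<partial>lebesgue_on \<Omega>) \<longlonglongrightarrow> (\<integral>x. h x * f x \<partial>lebesgue_on \<Omega>)"
proof (rule LIMSEQ_I)
  have \<Omega>m: "\<Omega> \<in> sets borel" using \<Omega> by simp
  fix e :: real assume "e > 0"
  \<comment> \<open>Replacing \<open>f\<close> by the bump changes each of the two pairings by at
    most \<open>e / 3\<close>; the \<open>+ 1\<close> avoids division by zero when \<open>C\<close>
    is 0.\<close>
  then have "e / (3 * (\<bar>C\<bar> + 1)) > 0" by simp
  then obtain \<phi> where \<phi>: "\<phi> \<in> test_bumps \<Omega>"
    and f\<phi>: "(\<integral>x. \<bar>f x - \<phi> x\<bar> \<partial>lebesgue_on \<Omega>) < e / (3 * (\<bar>C\<bar> + 1))"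
    using L1_test_approx[OF \<Omega> f] by blast
  have \<phi>L: "\<phi> \<in> L1 \<Omega>" using \<phi> \<Omega>m by (rule test_bumps_L1)
  have dL: "(\<lambda>x. f x - \<phi> x) \<in> L1 \<Omega>" using f \<phi>L by (simp add: L1_def)
  have small: "\<bar>(\<integral>x. k x * f x \<partial>lebesgue_on \<Omega>) - (\<integral>x. k x * \<phi> x \<partial>lebesgue_on \<Omega>)\<bar> \<le> e / 3"
    if k: "k \<in> borel_measurable (lebesgue_on \<Omega>)" "AE x in lebesgue_on \<Omega>. \<bar>k x\<bar> \<le> C" for k
  proof -
    have kL: "k \<in> Linf \<Omega>" using k by (intro LinfI[of _ _ C]) auto
    have k': "AE x in lebesgue_on \<Omega>. \<bar>k x\<bar> \<le> \<bar>C\<bar> + 1"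
      using k(2) by eventually_elim auto
    have "(\<integral>x. k x * f x \<partial>lebesgue_on \<Omega>) - (\<integral>x. k x * \<phi> x \<partial>lebesgue_on \<Omega>) =
        (\<integral>x. k x * (f x - \<phi> x) \<partial>lebesgue_on \<Omega>)"
      using Linf_L1_mult_integrable[OF kL f] Linf_L1_mult_integrable[OF kL \<phi>L]
      by (simp add: right_diff_distrib)
    also have "\<bar>\<dots>\<bar> \<le> (\<bar>C\<bar> + 1) * (\<integral>x. \<bar>f x - \<phi> x\<bar> \<partial>lebesgue_on \<Omega>)"
      by (rule Linf_L1_bound[OF k(1) k' dL])
    also have "\<dots> \<le> (\<bar>C\<bar> + 1) * (e / (3 * (\<bar>C\<bar> + 1)))"
      using f\<phi> by (intro mult_left_mono) auto
    also have "\<dots> = e / 3"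
    proof -
      have *: "k * (e / (3 * k)) = e / 3" if "k \<noteq> 0" for k :: real
        using that by simp
      show ?thesis by (rule *) linarith
    qed
    finally show ?thesis .
  qed
  obtain N where N: "\<And>n. n \<ge> N \<Longrightarrow>
     norm ((\<integral>x. g n x * \<phi> x \<partial>lebesgue_on \<Omega>) - (\<integral>x. h x * \<phi> x \<partial>lebesgue_on \<Omega>)) < e / 3"
    using LIMSEQ_D[OF lim[OF \<phi>], of "e / 3"] \<open>e > 0\<close> by auto
  show "\<exists>N. \<forall>n\<ge>N. norm ((\<integral>x. g n x * f x \<partial>lebesgue_on \<Omega>) - (\<integral>x. h x * f x \<partial>lebesgue_on \<Omega>)) < e"
  proof (intro exI allI impI)
    fix n assume "n \<ge> N"
    then show "norm ((\<integral>x. g n x * f x \<partial>lebesgue_on \<Omega>) - (\<integral>x. h x * f x \<partial>lebesgue_on \<Omega>)) < e"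
      using N[of n] small[OF gn, of n] small[OF h]
      unfolding real_norm_def abs_less_iff abs_le_iff by linarith
  qed
qed

text \<open>Density extends the estimate from bumps to all of L1. The choice
  \<open>f = sgn g\<close> on the part of \<open>{\<bar>g\<bar> > C}\<close> inside a ball then
  gives a nonpositive integral of the nonnegative function \<open>\<bar>g\<bar> - C\<close> over
  that part, which must be a null set.\<close>

lemma test_duality_bound:
  fixes g :: "'a::euclidean_space \<Rightarrow> real"
  assumes \<Omega>: "open \<Omega>" and g: "g \<in> Linf \<Omega>" and C: "C \<ge> 0"
    and bound: "\<And>\<phi>. \<phi> \<in> test_bumps \<Omega> \<Longrightarrow>
      \<bar>\<integral>x. g x * \<phi> x \<partial>lebesgue_on \<Omega>\<bar> \<le> C * (\<integral>x. \<bar>\<phi> x\<bar> \<partial>lebesgue_on \<Omega>)"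
  shows "AE x in lebesgue_on \<Omega>. \<bar>g x\<bar> \<le> C"
proof -
  have \<Omega>m: "\<Omega> \<in> sets borel" using \<Omega> by simp
  note gm[measurable] = Linf_measurable[OF g]
  obtain B where B: "B \<ge> 0" "AE x in lebesgue_on \<Omega>. norm (g x) \<le> B"
    using g by (rule LinfE)
  have all: "(\<integral>x. g x * f x \<partial>lebesgue_on \<Omega>) \<le> C * (\<integral>x. \<bar>f x\<bar> \<partial>lebesgue_on \<Omega>)" if f: "f \<in> L1 \<Omega>" for f
  proof (rule field_le_epsilon)
    fix e :: real assume "e > 0"
    \<comment> \<open>The approximation error enters twice, through the bound \<open>B\<close> on
      \<open>g\<close> and through the constant \<open>C\<close>, hence with the factor
      \<open>B + C\<close>.\<close>
    then have "e / (B + C + 1) > 0" using B C by simp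
    then obtain \<phi> where \<phi>: "\<phi> \<in> test_bumps \<Omega>"
      and f\<phi>: "(\<integral>x. \<bar>f x - \<phi> x\<bar> \<partial>lebesgue_on \<Omega>) < e / (B + C + 1)"
      using L1_test_approx[OF \<Omega> f] by blast
    have \<phi>L: "\<phi> \<in> L1 \<Omega>" using \<phi> \<Omega>m by (rule test_bumps_L1)
    have dL: "(\<lambda>x. f x - \<phi> x) \<in> L1 \<Omega>" using f \<phi>L by (simp add: L1_def)
    have "(\<integral>x. g x * f x \<partial>lebesgue_on \<Omega>) =
        (\<integral>x. g x * \<phi> x \<partial>lebesgue_on \<Omega>) + (\<integral>x. g x * (f x - \<phi> x) \<partial>lebesgue_on \<Omega>)"
      using Linf_L1_mult_integrable[OF g f] Linf_L1_mult_integrable[OF g \<phi>L]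
      by (simp add: right_diff_distrib)
    also have "(\<integral>x. g x * (f x - \<phi> x) \<partial>lebesgue_on \<Omega>) \<le> B * (\<integral>x. \<bar>f x - \<phi> x\<bar> \<partial>lebesgue_on \<Omega>)"
      using Linf_L1_bound[OF gm _ dL, of B] B(2) by simp
    also have "(\<integral>x. g x * \<phi> x \<partial>lebesgue_on \<Omega>) \<le> C * (\<integral>x. \<bar>\<phi> x\<bar> \<partial>lebesgue_on \<Omega>)"
      using bound[OF \<phi>] by simp
    also have "C * (\<integral>x. \<bar>\<phi> x\<bar> \<partial>lebesgue_on \<Omega>) \<le>
        C * ((\<integral>x. \<bar>f x\<bar> \<partial>lebesgue_on \<Omega>) + (\<integral>x. \<bar>f x - \<phi> x\<bar> \<partial>lebesgue_on \<Omega>))"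
      using integral_abs_triangle[OF L1_integrable[OF \<phi>L] L1_integrable[OF f], of "\<lambda>x. 0"] C
      by (intro mult_left_mono) (simp_all add: abs_minus_commute)
    finally have "(\<integral>x. g x * f x \<partial>lebesgue_on \<Omega>) \<le> C * (\<integral>x. \<bar>f x\<bar> \<partial>lebesgue_on \<Omega>) +
        (B + C) * (\<integral>x. \<bar>f x - \<phi> x\<bar> \<partial>lebesgue_on \<Omega>)"
      by (simp add: algebra_simps)
    also have "(B + C) * (\<integral>x. \<bar>f x - \<phi> x\<bar> \<partial>lebesgue_on \<Omega>) \<le> (B + C + 1) * (e / (B + C + 1))"
      using B C f\<phi> by (intro mult_mono Bochner_Integration.integral_nonneg) auto
    also have "\<dots> = e" using B C by simp
    finally show "(\<integral>x. g x * f x \<partial>lebesgue_on \<Omega>) \<le> C * (\<integral>x. \<bar>f x\<bar> \<partial>lebesgue_on \<Omega>) + e"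
      by simp
  qed
  have "AE x in lebesgue_on \<Omega>. norm x < real n \<longrightarrow> \<bar>g x\<bar> \<le> C" for n
  proof -
    \<comment> \<open>The ball makes the measure of \<open>A\<close> finite, so that the sign
      function on it is integrable; the balls are exhausted at the end.\<close>
    define A where "A = {x \<in> space (lebesgue_on \<Omega>). C < \<bar>g x\<bar>} \<inter> ball 0 (real n)"
    have bm: "ball 0 (real n) \<inter> \<Omega> \<in> sets (lebesgue_on \<Omega>)"
      using \<Omega>m by (auto simp: sets_restrict_space)
    have "{x \<in> space (lebesgue_on \<Omega>). C < \<bar>g x\<bar>} \<in> sets (lebesgue_on \<Omega>)"
      by measurable
    moreover have "A = {x \<in> space (lebesgue_on \<Omega>). C < \<bar>g x\<bar>} \<inter> (ball 0 (real n) \<inter> \<Omega>)"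
      by (auto simp: A_def)
    ultimately have A[measurable]: "A \<in> sets (lebesgue_on \<Omega>)"
      using bm by auto
    have "emeasure (lebesgue_on \<Omega>) A \<le> emeasure lborel (ball 0 (real n) :: 'a set)"
    proof -
      have "emeasure (lebesgue_on \<Omega>) A \<le> emeasure (lebesgue_on \<Omega>) (ball 0 (real n) \<inter> \<Omega>)"
        by (rule emeasure_mono[OF _ bm]) (auto simp: A_def)
      also have "\<dots> = emeasure lebesgue (ball 0 (real n) \<inter> \<Omega>)"
        using \<Omega>m by (intro emeasure_restrict_space) auto
      also have "\<dots> = emeasure lborel (ball 0 (real n) \<inter> \<Omega>)"
        using \<Omega>m by simp
      also have "\<dots> \<le> emeasure lborel (ball 0 (real n) :: 'a set)"
        by (rule emeasure_mono) auto
      finally show ?thesis .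
    qed
    also have "\<dots> < \<infinity>"
      by (intro emeasure_bounded_finite) auto
    finally have fin: "emeasure (lebesgue_on \<Omega>) A < \<infinity>" .
    have iA: "integrable (lebesgue_on \<Omega>) (indicator A :: 'a \<Rightarrow> real)"
      using A fin by simp
    define f where "f x = sgn (g x) * indicator A x" for x
    have f: "f \<in> L1 \<Omega>"
      unfolding L1_def mem_Collect_eq
      by (rule Bochner_Integration.integrable_bound[OF iA])
        (auto simp: f_def[abs_def] indicator_def abs_sgn_eq)
    \<comment> \<open>On \<open>A\<close> the function \<open>g\<close> is nonzero because
      \<open>C \<ge> 0\<close>, so its sign has absolute value 1 there.\<close>
    have fa: "\<bar>f x\<bar> = indicator A x" for x
      using C by (auto simp: f_def A_def indicator_def abs_sgn_eq)
    have gf: "g x * f x = \<bar>g x\<bar> * indicator A x" for x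
      by (simp add: f_def abs_sgn mult_ac)
    have igf: "integrable (lebesgue_on \<Omega>) (\<lambda>x. \<bar>g x\<bar> * indicator A x)"
      using Linf_L1_mult_integrable[OF g f] by (simp add: gf)
    have "(\<integral>x. (\<bar>g x\<bar> - C) * indicator A x \<partial>lebesgue_on \<Omega>) =
        (\<integral>x. \<bar>g x\<bar> * indicator A x \<partial>lebesgue_on \<Omega>) - (\<integral>x. C * indicator A x \<partial>lebesgue_on \<Omega>)"
      unfolding left_diff_distrib using iA igf by (intro Bochner_Integration.integral_diff) auto
    also have "\<dots> \<le> 0"
      using all[OF f] by (simp add: gf fa)
    finally have le: "(\<integral>x. (\<bar>g x\<bar> - C) * indicator A x \<partial>lebesgue_on \<Omega>) \<le> 0" .
    have nn: "0 \<le> (\<bar>g x\<bar> - C) * indicator A x" for x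
      by (auto simp: A_def indicator_def)
    have int: "integrable (lebesgue_on \<Omega>) (\<lambda>x. (\<bar>g x\<bar> - C) * indicator A x)"
      unfolding left_diff_distrib using iA igf by auto
    have "(\<integral>x. (\<bar>g x\<bar> - C) * indicator A x \<partial>lebesgue_on \<Omega>) = 0"
      using le Bochner_Integration.integral_nonneg[of "lebesgue_on \<Omega>", OF nn] by (intro antisym) auto
    then have "AE x in lebesgue_on \<Omega>. (\<bar>g x\<bar> - C) * indicator A x = 0"
      using integral_nonneg_eq_0_iff_AE[OF int] nn by auto
    then show ?thesis
      using AE_space[of "lebesgue_on \<Omega>"]
    proof eventually_elim
      case (elim x)
      then show ?case
        by (cases "x \<in> A") (auto simp: A_def)
    qed
  qed
  then have "AE x in lebesgue_on \<Omega>. \<forall>n. norm x < real n \<longrightarrow> \<bar>g x\<bar> \<le> C"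
    unfolding AE_all_countable by blast
  then show ?thesis
    by eventually_elim (use reals_Archimedean2 in blast)
qed

section \<open>Linear operations on bounded functions and on weak gradients\<close>

lemma Linf_inner: "g \<in> Linf \<Omega> \<Longrightarrow> (\<lambda>x. g x \<bullet> v) \<in> Linf \<Omega>"
proof -
  assume g: "g \<in> Linf \<Omega>"
  obtain C where C: "C \<ge> 0" "AE x in lebesgue_on \<Omega>. norm (g x) \<le> C"
    using g by (rule LinfE)
  show ?thesis
  proof (rule LinfI)
    show "(\<lambda>x. g x \<bullet> v) \<in> borel_measurable (lebesgue_on \<Omega>)"
      using Linf_measurable[OF g] by measurable
    show "AE x in lebesgue_on \<Omega>. norm (g x \<bullet> v) \<le> C * norm v"
      using C(2)
    proof eventually_elim
      case (elim x)
      then have "norm (g x) * norm v \<le> C * norm v"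
        by (intro mult_right_mono) auto
      then show ?case
        using Cauchy_Schwarz_ineq2[of "g x" v] by simp
    qed
  qed
qed

lemma Linf_linear_combination:
  assumes f: "f \<in> Linf \<Omega>" and g: "g \<in> Linf \<Omega>"
  shows "(\<lambda>x. a *\<^sub>R f x + b *\<^sub>R g x) \<in> Linf \<Omega>"
proof -
  obtain C where C: "C \<ge> 0" "AE x in lebesgue_on \<Omega>. norm (f x) \<le> C"
    using f by (rule LinfE)
  obtain D where D: "D \<ge> 0" "AE x in lebesgue_on \<Omega>. norm (g x) \<le> D"
    using g by (rule LinfE)
  show ?thesis
  proof (rule LinfI)
    show "(\<lambda>x. a *\<^sub>R f x + b *\<^sub>R g x) \<in> borel_measurable (lebesgue_on \<Omega>)"
      using Linf_measurable[OF f] Linf_measurable[OF g] by measurable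
    show "AE x in lebesgue_on \<Omega>. norm (a *\<^sub>R f x + b *\<^sub>R g x) \<le> \<bar>a\<bar> * C + \<bar>b\<bar> * D"
      using C(2) D(2)
      by eventually_elim (auto intro!: norm_triangle_le add_mono mult_left_mono)
  qed
qed

lemma Linf_diff: "f \<in> Linf \<Omega> \<Longrightarrow> g \<in> Linf \<Omega> \<Longrightarrow> (\<lambda>x. f x - g x) \<in> Linf \<Omega>"
  using Linf_linear_combination[of f \<Omega> g 1 "-1"] by simp

text \<open>The difference of the two gradients pairs to 0 with every bump, so the duality bound
  holds with constant 0 in every coordinate.\<close>

lemma weak_gradient_unique:
  assumes \<Omega>: "open \<Omega>" and g: "g \<in> Linf \<Omega>" "weak_gradient \<Omega> u g"
    and h: "h \<in> Linf \<Omega>" "weak_gradient \<Omega> u h"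
  shows "AE x in lebesgue_on \<Omega>. g x = h x"
proof -
  have \<Omega>m: "\<Omega> \<in> sets borel" using \<Omega> by simp
  have "AE x in lebesgue_on \<Omega>. \<bar>g x \<bullet> i - h x \<bullet> i\<bar> \<le> 0" if i: "i \<in> Basis" for i
  proof (rule test_duality_bound[OF \<Omega>])
    show "(\<lambda>x. g x \<bullet> i - h x \<bullet> i) \<in> Linf \<Omega>"
      by (intro Linf_diff Linf_inner g h)
    fix \<phi> assume "\<phi> \<in> test_bumps \<Omega>"
    then have \<phi>: "\<phi> \<in> test_functions \<Omega>" by (simp add: test_bumps_def)
    have "(\<integral>x. (g x \<bullet> i) * \<phi> x \<partial>lebesgue_on \<Omega>) = (\<integral>x. (h x \<bullet> i) * \<phi> x \<partial>lebesgue_on \<Omega>)"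
      using g(2) h(2) \<phi> i by (fastforce simp: weak_gradient_def)
    then have "(\<integral>x. (g x \<bullet> i - h x \<bullet> i) * \<phi> x \<partial>lebesgue_on \<Omega>) = 0"
      using Linf_L1_mult_integrable[OF Linf_inner[OF g(1), of i] test_function_L1(1)[OF \<phi> \<Omega>m]]
        Linf_L1_mult_integrable[OF Linf_inner[OF h(1), of i] test_function_L1(1)[OF \<phi> \<Omega>m]]
      by (simp add: left_diff_distrib)
    then show "\<bar>\<integral>x. (g x \<bullet> i - h x \<bullet> i) * \<phi> x \<partial>lebesgue_on \<Omega>\<bar> \<le> 0 * (\<integral>x. \<bar>\<phi> x\<bar> \<partial>lebesgue_on \<Omega>)"
      by simp
  qed simp
  then have "AE x in lebesgue_on \<Omega>. \<forall>i\<in>Basis. \<bar>g x \<bullet> i - h x \<bullet> i\<bar> \<le> 0"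
    by (intro AE_finite_allI) auto
  then show ?thesis
    by eventually_elim (simp add: euclidean_eq_iff[of "g _"])
qed

text \<open>Any explicitly constructed weak gradient may stand in for the one picked by
  \<open>wgrad\<close>; this is how all gradients below are computed.\<close>

lemma wgrad_AE:
  assumes "open \<Omega>" "u \<in> Linf \<Omega>" "g \<in> Linf \<Omega>" "weak_gradient \<Omega> u g"
  shows "u \<in> W1inf \<Omega>" and "AE x in lebesgue_on \<Omega>. wgrad \<Omega> u x = g x"
proof -
  show W: "u \<in> W1inf \<Omega>"
    using assms by (auto simp: W1inf_def)
  show "AE x in lebesgue_on \<Omega>. wgrad \<Omega> u x = g x"
    using weak_gradient_unique[OF assms(1) wgrad[OF W] assms(3,4)] .
qed

lemma W1inf_Linf: "u \<in> W1inf \<Omega> \<Longrightarrow> u \<in> Linf \<Omega>"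
  by (simp add: W1inf_def)

lemma weak_gradient_linear_combination:
  assumes \<Omega>: "open \<Omega>" and u: "u \<in> Linf \<Omega>" "g \<in> Linf \<Omega>" "weak_gradient \<Omega> u g"
    and v: "v \<in> Linf \<Omega>" "h \<in> Linf \<Omega>" "weak_gradient \<Omega> v h"
  shows "weak_gradient \<Omega> (\<lambda>x. a * u x + b * v x) (\<lambda>x. a *\<^sub>R g x + b *\<^sub>R h x)"
  unfolding weak_gradient_def
proof (intro ballI)
  have \<Omega>m: "\<Omega> \<in> sets borel" using \<Omega> by simp
  fix \<phi> and i :: 'a assume \<phi>: "\<phi> \<in> test_functions \<Omega>" and i: "i \<in> Basis"
  let ?D = "\<lambda>x. frechet_derivative \<phi> (at x) i"
  note t = test_function_L1[OF \<phi> \<Omega>m]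
  have "(\<integral>x. (a * u x + b * v x) * ?D x \<partial>lebesgue_on \<Omega>) =
      (\<integral>x. a * (u x * ?D x) + b * (v x * ?D x) \<partial>lebesgue_on \<Omega>)"
    by (intro Bochner_Integration.integral_cong) (auto simp: algebra_simps)
  also have "\<dots> = a * (\<integral>x. u x * ?D x \<partial>lebesgue_on \<Omega>) + b * (\<integral>x. v x * ?D x \<partial>lebesgue_on \<Omega>)"
    using Linf_L1_mult_integrable[OF u(1) t(2)[of i]] Linf_L1_mult_integrable[OF v(1) t(2)[of i]]
    by (simp add: Bochner_Integration.integral_add)
  also have "\<dots> = - (a * (\<integral>x. (g x \<bullet> i) * \<phi> x \<partial>lebesgue_on \<Omega>) + b * (\<integral>x. (h x \<bullet> i) * \<phi> x \<partial>lebesgue_on \<Omega>))"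
    using u(3) v(3) \<phi> i by (simp add: weak_gradient_def)
  also have "a * (\<integral>x. (g x \<bullet> i) * \<phi> x \<partial>lebesgue_on \<Omega>) + b * (\<integral>x. (h x \<bullet> i) * \<phi> x \<partial>lebesgue_on \<Omega>) =
      (\<integral>x. a * ((g x \<bullet> i) * \<phi> x) + b * ((h x \<bullet> i) * \<phi> x) \<partial>lebesgue_on \<Omega>)"
    using Linf_L1_mult_integrable[OF Linf_inner[OF u(2), of i] t(1)]
      Linf_L1_mult_integrable[OF Linf_inner[OF v(2), of i] t(1)]
    by (simp add: Bochner_Integration.integral_add)
  also have "\<dots> = (\<integral>x. ((a *\<^sub>R g x + b *\<^sub>R h x) \<bullet> i) * \<phi> x \<partial>lebesgue_on \<Omega>)"
    by (intro Bochner_Integration.integral_cong) (auto simp: inner_add_left algebra_simps)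
  finally show "(\<integral>x. (a * u x + b * v x) * ?D x \<partial>lebesgue_on \<Omega>) =
      - (\<integral>x. ((a *\<^sub>R g x + b *\<^sub>R h x) \<bullet> i) * \<phi> x \<partial>lebesgue_on \<Omega>)" .
qed

lemma W1inf_linear_combination:
  assumes \<Omega>: "open \<Omega>" and u: "u \<in> W1inf \<Omega>" and v: "v \<in> W1inf \<Omega>"
  shows "(\<lambda>x. a * u x + b * v x) \<in> W1inf \<Omega>"
    and "AE x in lebesgue_on \<Omega>. wgrad \<Omega> (\<lambda>x. a * u x + b * v x) x = a *\<^sub>R wgrad \<Omega> u x + b *\<^sub>R wgrad \<Omega> v x"
proof -
  note uv = W1inf_Linf[OF u] wgrad[OF u] W1inf_Linf[OF v] wgrad[OF v]
  have "(\<lambda>x. a * u x + b * v x) \<in> Linf \<Omega>"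
    using Linf_linear_combination[OF uv(1,4), of a b] by simp
  note * = wgrad_AE[OF \<Omega> this Linf_linear_combination[OF uv(2,5), of a b]
      weak_gradient_linear_combination[OF \<Omega> uv]]
  show "(\<lambda>x. a * u x + b * v x) \<in> W1inf \<Omega>"
    by (rule *)
  show "AE x in lebesgue_on \<Omega>. wgrad \<Omega> (\<lambda>x. a * u x + b * v x) x = a *\<^sub>R wgrad \<Omega> u x + b *\<^sub>R wgrad \<Omega> v x"
    by (rule *)
qed

section \<open>Difference quotients and the chain rule\<close>

lemma test_function_line_derivative:
  assumes "\<phi> \<in> test_functions \<Omega>"
  shows "((\<lambda>r. \<phi> (x + r *\<^sub>R e)) has_real_derivative frechet_derivative \<phi> (at (x + r *\<^sub>R e)) e) (at r)"
proof -
  have 1: "((\<lambda>r. x + r *\<^sub>R e) has_derivative (\<lambda>h. h *\<^sub>R e)) (at r)"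
    by (auto intro!: derivative_eq_intros)
  have "((\<lambda>r. \<phi> (x + r *\<^sub>R e)) has_derivative (\<lambda>h. frechet_derivative \<phi> (at (x + r *\<^sub>R e)) (h *\<^sub>R e))) (at r)"
    by (rule has_derivative_compose[OF 1 test_function_has_derivative[OF assms]])
  moreover have "frechet_derivative \<phi> (at (x + r *\<^sub>R e)) (h *\<^sub>R e) = frechet_derivative \<phi> (at (x + r *\<^sub>R e)) e * h" for h
    using linear_scale[OF linear_frechet_derivative[OF test_function_differentiable[OF assms]], of "x + r *\<^sub>R e" h e]
    by (simp add: mult.commute)
  ultimately show ?thesis
    by (simp add: has_field_derivative_def)
qed

lemma test_function_derivative_bounded:
  assumes "\<phi> \<in> test_functions \<Omega>"
  obtains D where "D \<ge> 0" "\<And>x. \<bar>frechet_derivative \<phi> (at x) e\<bar> \<le> D"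
proof -
  obtain K where K: "compact K" "\<forall>x. x \<notin> K \<longrightarrow> frechet_derivative \<phi> (at x) e = 0"
    using test_function_support[OF assms] by blast
  show thesis
    by (rule bounded_compact_support[OF test_function_derivative_continuous[OF assms, of e] K(1)])
      (use K(2) that in blast)+
qed

text \<open>Dominated convergence: the mean value inequality bounds the quotients by the bound of
  the derivative, and bounded steps confine them to one ball.\<close>

lemma test_function_difference_quotient_tendsto:
  fixes H :: "'a::euclidean_space \<Rightarrow> real"
  assumes \<phi>: "\<phi> \<in> test_functions \<Omega>" and H[measurable]: "H \<in> borel_measurable borel"
    and B: "\<And>x. \<bar>H x\<bar> \<le> B" and s: "s \<longlonglongrightarrow> 0" "\<And>n. s n \<noteq> 0"
  shows "(\<lambda>n. \<integral>x. H x * ((\<phi> (x + s n *\<^sub>R e) - \<phi> x) / s n) \<partial>lborel)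
    \<longlonglongrightarrow> (\<integral>x. H x * frechet_derivative \<phi> (at x) e \<partial>lborel)"
proof -
  note [measurable] = test_function_borel[OF \<phi>] test_function_derivative_borel[OF \<phi>, of e]
  obtain K where K: "compact K" "\<forall>x. x \<notin> K \<longrightarrow> \<phi> x = 0"
    using test_function_support[OF \<phi>] by blast
  obtain R where R: "\<And>x. x \<in> K \<Longrightarrow> norm x \<le> R"
    using compact_imp_bounded[OF K(1)] by (auto simp: bounded_iff)
  obtain M where M: "\<And>n. \<bar>s n\<bar> \<le> M"
    using convergent_imp_Bseq[of s] s(1) by (auto simp: convergent_def Bseq_def)
  obtain D where D: "D \<ge> 0" "\<And>x. \<bar>frechet_derivative \<phi> (at x) e\<bar> \<le> D"
    using test_function_derivative_bounded[OF \<phi>] by blast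
  have B0: "B \<ge> 0" using B[of undefined] by linarith
  have quot: "\<bar>(\<phi> (x + r *\<^sub>R e) - \<phi> x) / r\<bar> \<le> D" if "r \<noteq> 0" for x r
  proof -
    have "norm (\<phi> (x + r *\<^sub>R e) - \<phi> (x + 0 *\<^sub>R e)) \<le> D * norm (r - 0)"
      by (rule field_differentiable_bound[of UNIV, OF _ _ _ UNIV_I UNIV_I])
        (use D(2) test_function_line_derivative[OF \<phi>] in auto)
    then show ?thesis
      using that by (simp add: abs_divide divide_le_eq)
  qed
  show ?thesis
  \<comment> \<open>\<open>R\<close> bounds the support of \<open>\<phi>\<close> and
    \<open>M * norm e\<close> the length of a shift, so outside this ball both \<open>\<phi>\<close>
    and its translate vanish.\<close>
  proof (rule integral_dominated_convergence[where w="\<lambda>x. (B * D) * indicator (cball 0 (R + M * norm e)) x"])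
    show "integrable lborel (\<lambda>x. (B * D) * indicator (cball (0::'a) (R + M * norm e)) x)"
      by (intro integrable_mult_right integrable_indicator_lborel emeasure_bounded_finite) auto
    show "AE x in lborel. (\<lambda>n. H x * ((\<phi> (x + s n *\<^sub>R e) - \<phi> x) / s n)) \<longlonglongrightarrow> H x * frechet_derivative \<phi> (at x) e"
    proof (intro AE_I2 tendsto_mult tendsto_const)
      fix x
      have lim0: "((\<lambda>h. (\<phi> (x + (0 + h) *\<^sub>R e) - \<phi> (x + 0 *\<^sub>R e)) / h) \<longlongrightarrow> frechet_derivative \<phi> (at (x + 0 *\<^sub>R e)) e) (at 0)"
        using test_function_line_derivative[OF \<phi>, of x e 0] unfolding DERIV_def .
      have "filterlim s (at 0) sequentially"
        using s by (auto simp: filterlim_at)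
      from filterlim_compose[OF lim0 this]
      show "(\<lambda>n. (\<phi> (x + s n *\<^sub>R e) - \<phi> x) / s n) \<longlonglongrightarrow> frechet_derivative \<phi> (at x) e"
        by simp
    qed
    show "AE x in lborel. norm (H x * ((\<phi> (x + s n *\<^sub>R e) - \<phi> x) / s n)) \<le>
        (B * D) * indicator (cball 0 (R + M * norm e)) x" for n
    proof (intro AE_I2)
      fix x
      show "norm (H x * ((\<phi> (x + s n *\<^sub>R e) - \<phi> x) / s n)) \<le> (B * D) * indicator (cball 0 (R + M * norm e)) x"
      proof (cases "norm x \<le> R + M * norm e")
        case True
        have "\<bar>H x\<bar> * \<bar>(\<phi> (x + s n *\<^sub>R e) - \<phi> x) / s n\<bar> \<le> B * D"
          using B quot[OF s(2)] B0 by (intro mult_mono) auto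
        then show ?thesis using True by (simp add: abs_mult)
      next
        case False
        have M0: "\<bar>s n\<bar> * norm e \<le> M * norm e" using M by (intro mult_right_mono) auto
        then have "x \<notin> K" using False R[of x] by (smt (verit, best) abs_ge_zero mult_nonneg_nonneg norm_ge_zero)
        moreover have "norm x \<le> norm (x + s n *\<^sub>R e) + norm (s n *\<^sub>R e)"
          by (metis add_diff_cancel_right' norm_triangle_ineq4)
        then have "x + s n *\<^sub>R e \<notin> K"
          using False R[of "x + s n *\<^sub>R e"] M0 by force
        ultimately show ?thesis using K(2) B0 D(1) by simp
      qed
    qed
  qed measurable
qed

lemma lborel_integral_translate:
  fixes f :: "'a::euclidean_space \<Rightarrow> real"
  assumes [measurable]: "f \<in> borel_measurable borel"
  shows "(\<integral>x. f (x + a) \<partial>lborel) = (\<integral>x. f x \<partial>lborel)"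
proof -
  have "(\<integral>x. f x \<partial>lborel) = (\<integral>x. f x \<partial>distr lborel borel ((+) a))"
    by (simp add: lborel_distr_plus)
  also have "\<dots> = (\<integral>x. f (x + a) \<partial>lborel)"
    by (subst integral_distr) (auto simp: add.commute)
  finally show ?thesis by simp
qed

lemma test_bumps_translate:
  assumes \<phi>: "\<phi> \<in> test_bumps U" and U: "\<And>x. x \<in> U \<Longrightarrow> x - a \<in> \<Omega>"
  shows "(\<lambda>x. \<phi> (x + a)) \<in> test_bumps \<Omega>"
proof -
  obtain K where K: "compact K" "K \<subseteq> U" "\<forall>x. x \<notin> K \<longrightarrow> \<phi> x = 0"
    using test_bumps_support[OF \<phi>] by blast
  have "smooth_bump \<phi>" using \<phi> by (simp add: test_bumps_def)
  from smooth_bump_translate[OF this] show ?thesis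
  proof (rule test_bumpsI)
    show "compact ((\<lambda>x. x - a) ` K)"
      using K(1) by (intro compact_continuous_image continuous_intros)
    show "(\<lambda>x. x - a) ` K \<subseteq> \<Omega>" using K(2) U by blast
    show "\<phi> (x + a) = 0" if "x \<notin> (\<lambda>x. x - a) ` K" for x
    proof -
      have "x + a \<notin> K"
        using that by (metis add_diff_cancel_right' imageI)
      then show ?thesis using K(3) by blast
    qed
  qed
qed

text \<open>Discrete integration by parts: translation invariance of Lebesgue measure moves the
  quotient from \<open>\<phi>\<close> to \<open>H\<close> and reverses the shift.\<close>

lemma integral_difference_quotient_transfer:
  fixes H \<phi> :: "'a::euclidean_space \<Rightarrow> real"
  assumes [measurable]: "H \<in> borel_measurable borel" and B: "\<And>x. \<bar>H x\<bar> \<le> B"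
    and \<phi>: "integrable lborel \<phi>"
  shows "(\<integral>x. H x * ((\<phi> (x + s *\<^sub>R e) - \<phi> x) / s) \<partial>lborel) =
    (\<integral>x. ((H (x - s *\<^sub>R e) - H x) / s) * \<phi> x \<partial>lborel)"
proof -
  have [measurable]: "\<phi> \<in> borel_measurable borel"
    using borel_measurable_integrable[OF \<phi>] by simp
  have Hi: "integrable lborel (\<lambda>x. H' x * f x)"
    if [measurable]: "H' \<in> borel_measurable borel" and "\<And>x. \<bar>H' x\<bar> \<le> B" "integrable lborel f" for f H'
  proof (rule Bochner_Integration.integrable_bound)
    show "integrable lborel (\<lambda>x. B * \<bar>f x\<bar>)"
      using that by simp
    have [measurable]: "f \<in> borel_measurable borel"
      using borel_measurable_integrable[OF that(3)] by simp
    show "(\<lambda>x. H' x * f x) \<in> borel_measurable lborel" by measurable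
    show "AE x in lborel. norm (H' x * f x) \<le> norm (B * \<bar>f x\<bar>)"
    proof (intro AE_I2)
      fix x
      have "\<bar>H' x\<bar> * \<bar>f x\<bar> \<le> B * \<bar>f x\<bar>" using that(2) by (intro mult_right_mono) auto
      also have "\<dots> \<le> \<bar>B * \<bar>f x\<bar>\<bar>" by simp
      finally show "norm (H' x * f x) \<le> norm (B * \<bar>f x\<bar>)" by (simp add: abs_mult)
    qed
  qed
  have \<phi>t: "integrable lborel (\<lambda>x. \<phi> (x + s *\<^sub>R e))"
  proof -
    have "integrable (distr lborel borel ((+) (s *\<^sub>R e))) \<phi>"
      using \<phi> by (simp add: lborel_distr_plus)
    then show ?thesis
      by (subst (asm) integrable_distr_eq) (auto simp: add.commute)
  qed
  have "(\<integral>x. H x * ((\<phi> (x + s *\<^sub>R e) - \<phi> x) / s) \<partial>lborel) =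
      (\<integral>x. (H x * \<phi> (x + s *\<^sub>R e) - H x * \<phi> x) / s \<partial>lborel)"
    by (intro Bochner_Integration.integral_cong) (auto simp: algebra_simps diff_divide_distrib)
  also have "\<dots> = ((\<integral>x. H x * \<phi> (x + s *\<^sub>R e) \<partial>lborel) - (\<integral>x. H x * \<phi> x \<partial>lborel)) / s"
    using Hi[OF _ B \<phi>t] Hi[OF _ B \<phi>] by simp
  also have "(\<integral>x. H x * \<phi> (x + s *\<^sub>R e) \<partial>lborel) = (\<integral>x. H (x - s *\<^sub>R e) * \<phi> x \<partial>lborel)"
    using lborel_integral_translate[of "\<lambda>x. H (x - s *\<^sub>R e) * \<phi> x" "s *\<^sub>R e"] by simp
  also have "((\<integral>x. H (x - s *\<^sub>R e) * \<phi> x \<partial>lborel) - (\<integral>x. H x * \<phi> x \<partial>lborel)) / s =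
      (\<integral>x. (H (x - s *\<^sub>R e) * \<phi> x - H x * \<phi> x) / s \<partial>lborel)"
    using Hi[OF _ B \<phi>] Hi[of "\<lambda>x. H (x - s *\<^sub>R e)", OF _ B \<phi>] by simp
  also have "\<dots> = (\<integral>x. ((H (x - s *\<^sub>R e) - H x) / s) * \<phi> x \<partial>lborel)"
    by (intro Bochner_Integration.integral_cong) (auto simp: algebra_simps diff_divide_distrib)
  finally show ?thesis .
qed

text \<open>The function \<open>r \<mapsto> \<integral> H(x) \<phi>(x + r e) dx\<close> has derivative \<open>- \<integral> g(x) \<phi>(x + r e) dx\<close>.\<close>

lemma weak_derivative_difference_bound:
  fixes H g :: "'a::euclidean_space \<Rightarrow> real"
  assumes H: "H \<in> borel_measurable borel" "\<And>x. \<bar>H x\<bar> \<le> B"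
    and g: "g \<in> borel_measurable borel" "\<And>x. \<bar>g x\<bar> \<le> C"
    and weak: "\<And>\<phi>. \<phi> \<in> test_functions \<Omega> \<Longrightarrow>
      (\<integral>x. H x * frechet_derivative \<phi> (at x) e \<partial>lborel) = - (\<integral>x. g x * \<phi> x \<partial>lborel)"
    and U: "\<And>x r. x \<in> U \<Longrightarrow> \<bar>r\<bar> \<le> \<rho> \<Longrightarrow> x - r *\<^sub>R e \<in> \<Omega>"
    and \<phi>: "\<phi> \<in> test_bumps U" and s: "\<bar>s\<bar> \<le> \<rho>" "s \<noteq> 0"
  shows "\<bar>\<integral>x. ((H (x - s *\<^sub>R e) - H x) / s) * \<phi> x \<partial>lborel\<bar> \<le> C * (\<integral>x. \<bar>\<phi> x\<bar> \<partial>lborel)"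
proof -
  note [measurable] = H(1) g(1)
  have \<phi>i: "integrable lborel \<phi>" by (rule test_bumps_integrable[OF \<phi>])
  have \<phi>m[measurable]: "\<phi> \<in> borel_measurable borel"
    using borel_measurable_integrable[OF \<phi>i] by simp
  have B0: "0 \<le> B" using H(2)[of undefined] by linarith
  have C0: "0 \<le> C" using g(2)[of undefined] by linarith
  have \<phi>ti: "integrable lborel (\<lambda>x. \<phi> (x + a))" for a
  proof -
    have "integrable (distr lborel borel ((+) a)) \<phi>"
      using \<phi>i by (simp add: lborel_distr_plus)
    then show ?thesis
      by (subst (asm) integrable_distr_eq) (auto simp: add.commute)
  qed
  have Hi: "integrable lborel (\<lambda>x. H x * \<phi> (x + a))" for a
  proof (rule Bochner_Integration.integrable_bound)
    show "integrable lborel (\<lambda>x. B * \<bar>\<phi> (x + a)\<bar>)"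
      using \<phi>ti by simp
    show "AE x in lborel. norm (H x * \<phi> (x + a)) \<le> norm (B * \<bar>\<phi> (x + a)\<bar>)"
      using H(2) B0 by (intro AE_I2) (simp add: abs_mult mult_right_mono)
  qed measurable
  define F where "F r = (\<integral>x. H x * \<phi> (x + r *\<^sub>R e) \<partial>lborel)" for r
  have deriv: "(F has_real_derivative - (\<integral>x. g x * \<phi> (x + r *\<^sub>R e) \<partial>lborel)) (at r)" if r: "\<bar>r\<bar> \<le> \<rho>" for r
  proof -
    \<comment> \<open>The margin around \<open>U\<close> keeps the support of the translate inside
      \<open>\<Omega>\<close>, so the weak derivative may be tested with it.\<close>
    have tr: "(\<lambda>x. \<phi> (x + r *\<^sub>R e)) \<in> test_functions \<Omega>"
      using test_bumps_translate[OF \<phi>, of "r *\<^sub>R e" \<Omega>] U r by (auto simp: test_bumps_def)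
    have "((\<lambda>h. (F (r + h) - F r) / h) \<longlongrightarrow> - (\<integral>x. g x * \<phi> (x + r *\<^sub>R e) \<partial>lborel)) (at 0)"
      unfolding tendsto_at_iff_sequentially
    proof (intro allI impI)
      fix X :: "nat \<Rightarrow> real" assume X: "\<forall>i. X i \<in> UNIV - {0}" "X \<longlonglongrightarrow> 0"
      have "(\<lambda>n. \<integral>x. H x * ((\<phi> ((x + X n *\<^sub>R e) + r *\<^sub>R e) - \<phi> (x + r *\<^sub>R e)) / X n) \<partial>lborel)
          \<longlonglongrightarrow> (\<integral>x. H x * frechet_derivative (\<lambda>x. \<phi> (x + r *\<^sub>R e)) (at x) e \<partial>lborel)"
        using X by (intro test_function_difference_quotient_tendsto[OF tr H]) auto
      also have "(\<integral>x. H x * frechet_derivative (\<lambda>x. \<phi> (x + r *\<^sub>R e)) (at x) e \<partial>lborel) =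
          - (\<integral>x. g x * \<phi> (x + r *\<^sub>R e) \<partial>lborel)"
        by (rule weak[OF tr])
      also have "(\<lambda>n. \<integral>x. H x * ((\<phi> ((x + X n *\<^sub>R e) + r *\<^sub>R e) - \<phi> (x + r *\<^sub>R e)) / X n) \<partial>lborel) =
          (\<lambda>h. (F (r + h) - F r) / h) \<circ> X"
      proof
        fix n
        have "(\<integral>x. H x * ((\<phi> ((x + X n *\<^sub>R e) + r *\<^sub>R e) - \<phi> (x + r *\<^sub>R e)) / X n) \<partial>lborel) =
            (\<integral>x. (H x * \<phi> (x + (r + X n) *\<^sub>R e) - H x * \<phi> (x + r *\<^sub>R e)) / X n \<partial>lborel)"
          by (intro Bochner_Integration.integral_cong) (auto simp: algebra_simps diff_divide_distrib)
        also have "\<dots> = (F (r + X n) - F r) / X n"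
          unfolding F_def using Hi by simp
        finally show "(\<integral>x. H x * ((\<phi> ((x + X n *\<^sub>R e) + r *\<^sub>R e) - \<phi> (x + r *\<^sub>R e)) / X n) \<partial>lborel) =
          ((\<lambda>h. (F (r + h) - F r) / h) \<circ> X) n"
          by simp
      qed
      finally show "((\<lambda>h. (F (r + h) - F r) / h) \<circ> X) \<longlonglongrightarrow> - (\<integral>x. g x * \<phi> (x + r *\<^sub>R e) \<partial>lborel)" .
    qed
    then show ?thesis by (simp add: DERIV_def)
  qed
  \<comment> \<open>Mean value inequality on the interval of admissible shifts; the bound on the
    derivative is the same at every \<open>r\<close>, since the L1 norm of a translate is that of
    \<open>\<phi>\<close>.\<close>
  have "norm (F s - F 0) \<le> (C * (\<integral>x. \<bar>\<phi> x\<bar> \<partial>lborel)) * norm (s - 0)"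
  proof (rule field_differentiable_bound[of "{-\<rho>..\<rho>}"])
    show "convex {-\<rho>..\<rho>}" by simp
    show "s \<in> {-\<rho>..\<rho>}" "0 \<in> {-\<rho>..\<rho>}" using s by auto
    fix r assume "r \<in> {-\<rho>..\<rho>}"
    then have r: "\<bar>r\<bar> \<le> \<rho>" by auto
    show "(F has_real_derivative - (\<integral>x. g x * \<phi> (x + r *\<^sub>R e) \<partial>lborel)) (at r within {-\<rho>..\<rho>})"
      using deriv[OF r] by (rule has_field_derivative_at_within)
    have "norm (- (\<integral>x. g x * \<phi> (x + r *\<^sub>R e) \<partial>lborel)) \<le> (\<integral>x. \<bar>g x * \<phi> (x + r *\<^sub>R e)\<bar> \<partial>lborel)"
      using integral_abs_bound by simp
    also have "\<dots> \<le> (\<integral>x. C * \<bar>\<phi> (x + r *\<^sub>R e)\<bar> \<partial>lborel)"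
      using \<phi>ti g(2) C0 by (intro integral_mono') (auto simp: abs_mult intro!: mult_mono)
    also have "\<dots> = C * (\<integral>x. \<bar>\<phi> (x + r *\<^sub>R e)\<bar> \<partial>lborel)" by simp
    also have "(\<integral>x. \<bar>\<phi> (x + r *\<^sub>R e)\<bar> \<partial>lborel) = (\<integral>x. \<bar>\<phi> x\<bar> \<partial>lborel)"
      by (rule lborel_integral_translate) measurable
    finally show "norm (- (\<integral>x. g x * \<phi> (x + r *\<^sub>R e) \<partial>lborel)) \<le> C * (\<integral>x. \<bar>\<phi> x\<bar> \<partial>lborel)" .
  qed
  moreover have "(\<integral>x. ((H (x - s *\<^sub>R e) - H x) / s) * \<phi> x \<partial>lborel) = (F s - F 0) / s"
  proof -
    have "(\<integral>x. ((H (x - s *\<^sub>R e) - H x) / s) * \<phi> x \<partial>lborel) =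
        (\<integral>x. H x * ((\<phi> (x + s *\<^sub>R e) - \<phi> x) / s) \<partial>lborel)"
      by (rule integral_difference_quotient_transfer[OF H \<phi>i, symmetric])
    also have "\<dots> = (\<integral>x. (H x * \<phi> (x + s *\<^sub>R e) - H x * \<phi> (x + 0)) / s \<partial>lborel)"
      by (intro Bochner_Integration.integral_cong) (auto simp: algebra_simps diff_divide_distrib)
    also have "\<dots> = (F s - F 0) / s"
      unfolding F_def using Hi Hi[of 0] by simp
    finally show ?thesis .
  qed
  ultimately show ?thesis
    using s(2) by (simp add: abs_divide divide_le_eq)
qed

text \<open>Supplies the margin for difference quotients: from the neighbourhood \<open>U\<close> of
  a compact support, shifts by at most \<open>\<rho>\<close> stay in \<open>\<Omega>\<close>. Radius
  \<open>e / 2\<close> and shifts up to \<open>e / 4\<close> remain within the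
  \<open>e\<close>-neighbourhood of \<open>K\<close>.\<close>

lemma open_compact_room:
  fixes K \<Omega> :: "'a::euclidean_space set"
  assumes "open \<Omega>" "compact K" "K \<subseteq> \<Omega>"
  obtains U \<rho> where "open U" "K \<subseteq> U" "\<rho> > 0" "\<And>x y. x \<in> U \<Longrightarrow> norm y \<le> \<rho> \<Longrightarrow> x - y \<in> \<Omega>"
proof -
  obtain e where e: "e > 0" "(\<Union>x\<in>K. ball x e) \<subseteq> \<Omega>"
    using compact_subset_open_imp_ball_epsilon_subset[OF assms(2,1,3)] by blast
  show thesis
  proof (rule that[of "\<Union>x\<in>K. ball x (e / 2)" "e / 4"])
    fix x y :: 'a assume "x \<in> (\<Union>x\<in>K. ball x (e / 2))" and y: "norm y \<le> e / 4"
    then obtain z where z: "z \<in> K" "dist z x < e / 2" by auto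
    have "dist z (x - y) \<le> dist z x + dist x (x - y)" by (rule dist_triangle)
    also have "\<dots> < e" using z(2) y e(1) by (simp add: dist_norm)
    finally have "x - y \<in> ball z e" by simp
    then show "x - y \<in> \<Omega>" using z(1) e(2) by blast
  qed (use e in auto)
qed

text \<open>Requiring the corners \<open>N\<close> of \<open>\<Phi>\<close> to have null preimage avoids having to know that
  the gradient vanishes almost everywhere on level sets.\<close>

lemma weak_derivative_chain_rule:
  fixes H g :: "'a::euclidean_space \<Rightarrow> real"
  assumes \<Omega>: "open \<Omega>" and e: "norm e \<le> 1"
    and H[measurable]: "H \<in> borel_measurable borel" and B: "\<And>x. \<bar>H x\<bar> \<le> B"
    and g[measurable]: "g \<in> borel_measurable borel" and C: "\<And>x. \<bar>g x\<bar> \<le> C"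
    and weak: "\<And>\<phi>. \<phi> \<in> test_functions \<Omega> \<Longrightarrow>
      (\<integral>x. H x * frechet_derivative \<phi> (at x) e \<partial>lborel) = - (\<integral>x. g x * \<phi> x \<partial>lborel)"
    and \<Phi>: "\<And>a b. \<bar>\<Phi> a - \<Phi> b\<bar> \<le> \<bar>a - b\<bar>"
    and P[measurable]: "P \<in> borel_measurable borel" and P1: "\<And>z. \<bar>P z\<bar> \<le> 1"
    and deriv: "\<And>z. z \<notin> N \<Longrightarrow> (\<Phi> has_real_derivative P z) (at z)"
    and N: "AE x in lebesgue_on \<Omega>. H x \<notin> N"
    and \<psi>: "\<psi> \<in> test_functions \<Omega>"
  shows "(\<integral>x. \<Phi> (H x) * frechet_derivative \<psi> (at x) e \<partial>lborel) = - (\<integral>x. (P (H x) * g x) * \<psi> x \<partial>lborel)"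
proof -
  note \<psi>m[measurable] = test_function_borel[OF \<psi>]
  have B0: "0 \<le> B" using B[of undefined] by linarith
  have C0: "0 \<le> C" using C[of undefined] by linarith
  have \<Phi>m[measurable]: "\<Phi> \<in> borel_measurable borel"
  proof (intro borel_measurable_continuous_onI)
    have "1-lipschitz_on UNIV \<Phi>"
      using \<Phi> by (auto simp: lipschitz_on_def dist_real_def)
    then show "continuous_on UNIV \<Phi>" by (rule lipschitz_on_continuous_on)
  qed
  obtain K where K: "compact K" "K \<subseteq> \<Omega>" "\<forall>x. x \<notin> K \<longrightarrow> \<psi> x = 0"
    using test_function_support[OF \<psi>] by blast
  obtain U \<rho> where U: "open U" "K \<subseteq> U" "\<rho> > 0" "\<And>x y. x \<in> U \<Longrightarrow> norm y \<le> \<rho> \<Longrightarrow> x - y \<in> \<Omega>"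
    using open_compact_room[OF \<Omega> K(1,2)] by metis
  have Um[measurable]: "U \<in> sets borel" using U(1) by simp
  have U\<Omega>: "U \<subseteq> \<Omega>" using U(4)[of _ 0] U(3) by auto
  have Ur: "x - r *\<^sub>R e \<in> \<Omega>" if "x \<in> U" "\<bar>r\<bar> \<le> \<rho>" for x r
  proof (rule U(4)[OF that(1)])
    have "\<bar>r\<bar> * norm e \<le> \<rho> * 1"
      using that(2) e U(3) by (intro mult_mono) auto
    then show "norm (r *\<^sub>R e) \<le> \<rho>" by simp
  qed
  define s where "s n = \<rho> / real (Suc n)" for n
  have s0: "s n \<noteq> 0" "s n > 0" for n using U(3) by (auto simp: s_def)
  have s\<rho>: "\<bar>s n\<bar> \<le> \<rho>" for n
    using U(3) by (simp add: s_def field_simps)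
  have s: "s \<longlonglongrightarrow> 0"
    unfolding s_def by real_asymp
  \<comment> \<open>The shift is by \<open>- s n\<close> along \<open>e\<close>, so the weak limit
    of these quotients is \<open>- g\<close> rather than \<open>g\<close>.\<close>
  define D where "D n x = (H (x - s n *\<^sub>R e) - H x) / s n" for n x
  have Dm[measurable]: "D n \<in> borel_measurable borel" for n
    unfolding D_def by measurable
  note lm = borel_measurable_lebesgue_on
  have DL: "D n \<in> Linf U" for n
  proof (rule LinfI[OF lm[OF Dm]])
    have "\<bar>D n x\<bar> \<le> 2 * B / s n" for x
      using B[of x] B[of "x - s n *\<^sub>R e"] s0(2)[of n]
      by (auto simp: D_def abs_divide intro!: divide_right_mono)
    then show "AE x in lebesgue_on U. norm (D n x) \<le> 2 * B / s n" by simp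
  qed
  have zero: "\<phi> x = 0" if "\<phi> \<in> test_bumps U" "x \<notin> U" for \<phi> x
    using test_bumps_support[OF that(1)] that(2) by blast
  have tb: "\<phi> \<in> borel_measurable borel" if "\<phi> \<in> test_bumps U" for \<phi>
    using that test_function_borel by (auto simp: test_bumps_def)
  have t\<Omega>: "\<phi> \<in> test_functions \<Omega>" if "\<phi> \<in> test_bumps U" for \<phi>
    using that test_function_mono[OF U\<Omega>] by (auto simp: test_bumps_def)
  \<comment> \<open>Duality upgrades the integrated estimate to a pointwise one: the quotients of
    \<open>H\<close> inherit the bound of its weak derivative.\<close>
  have Dbound: "AE x in lebesgue_on U. \<bar>D n x\<bar> \<le> C" for n
  proof (rule test_duality_bound[OF U(1) DL C0])
    fix \<phi> assume \<phi>: "\<phi> \<in> test_bumps U"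
    note [measurable] = tb[OF \<phi>]
    have "(\<integral>x. D n x * \<phi> x \<partial>lebesgue_on U) = (\<integral>x. D n x * \<phi> x \<partial>lborel)"
      by (rule integral_lebesgue_on_borel(2)) (use zero[OF \<phi>] in auto)
    moreover have "(\<integral>x. \<bar>\<phi> x\<bar> \<partial>lebesgue_on U) = (\<integral>x. \<bar>\<phi> x\<bar> \<partial>lborel)"
      by (rule integral_lebesgue_on_borel(2)) (use zero[OF \<phi>] in auto)
    moreover have "\<bar>\<integral>x. D n x * \<phi> x \<partial>lborel\<bar> \<le> C * (\<integral>x. \<bar>\<phi> x\<bar> \<partial>lborel)"
      unfolding D_def
      by (rule weak_derivative_difference_bound[OF H B g C weak Ur \<phi> s\<rho> s0(1)])
    ultimately show "\<bar>\<integral>x. D n x * \<phi> x \<partial>lebesgue_on U\<bar> \<le> C * (\<integral>x. \<bar>\<phi> x\<bar> \<partial>lebesgue_on U)"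
      by simp
  qed
  \<comment> \<open>Against bumps, the quotient is moved onto the bump and converges to its
    derivative; the uniform bound \<open>C\<close> then allows arbitrary L1 functions.\<close>
  have Dconv: "(\<lambda>n. \<integral>x. D n x * f x \<partial>lebesgue_on U) \<longlonglongrightarrow> (\<integral>x. - g x * f x \<partial>lebesgue_on U)"
    if f: "f \<in> L1 U" for f
  proof (rule L1_weak_convergence[OF U(1) lm[OF Dm] Dbound _ _ _ f])
    show "AE x in lebesgue_on U. \<bar>- g x\<bar> \<le> C" using C by simp
    fix \<phi> assume \<phi>: "\<phi> \<in> test_bumps U"
    note [measurable] = tb[OF \<phi>]
    have "(\<integral>x. D n x * \<phi> x \<partial>lebesgue_on U) = (\<integral>x. H x * ((\<phi> (x + s n *\<^sub>R e) - \<phi> x) / s n) \<partial>lborel)" for n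
    proof -
      have "(\<integral>x. D n x * \<phi> x \<partial>lebesgue_on U) = (\<integral>x. D n x * \<phi> x \<partial>lborel)"
        by (rule integral_lebesgue_on_borel(2)) (use zero[OF \<phi>] in auto)
      also have "\<dots> = (\<integral>x. H x * ((\<phi> (x + s n *\<^sub>R e) - \<phi> x) / s n) \<partial>lborel)"
        unfolding D_def
        by (rule integral_difference_quotient_transfer[OF H B test_bumps_integrable[OF \<phi>], symmetric])
      finally show ?thesis .
    qed
    moreover have "(\<integral>x. - g x * \<phi> x \<partial>lebesgue_on U) = (\<integral>x. H x * frechet_derivative \<phi> (at x) e \<partial>lborel)"
    proof -
      have "(\<integral>x. - g x * \<phi> x \<partial>lebesgue_on U) = (\<integral>x. - g x * \<phi> x \<partial>lborel)"
        by (rule integral_lebesgue_on_borel(2)) (use zero[OF \<phi>] in auto)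
      then show ?thesis using weak[OF t\<Omega>[OF \<phi>]] by simp
    qed
    ultimately show "(\<lambda>n. \<integral>x. D n x * \<phi> x \<partial>lebesgue_on U) \<longlonglongrightarrow> (\<integral>x. - g x * \<phi> x \<partial>lebesgue_on U)"
      using test_function_difference_quotient_tendsto[OF t\<Omega>[OF \<phi>] H B s s0(1), of e] by simp
  qed (use g in \<open>auto intro!: lm\<close>)
  have \<psi>L: "\<psi> \<in> L1 U"
    unfolding L1_def using integrable_lebesgue_on[OF test_function_integrable[OF \<psi>] Um] by simp
  have PL: "(\<lambda>x. P (H x) * \<psi> x) \<in> L1 U"
    unfolding L1_def mem_Collect_eq
  proof (rule Linf_L1_mult_integrable[OF _ \<psi>L])
    show "(\<lambda>x. P (H x)) \<in> Linf U"
      using P1 by (intro LinfI[of _ _ 1] lm) auto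
  qed
  define Q where "Q n x = (\<Phi> (H (x - s n *\<^sub>R e)) - \<Phi> (H x)) / s n" for n x
  have Qm[measurable]: "Q n \<in> borel_measurable borel" for n
    unfolding Q_def by measurable
  have QD: "\<bar>Q n x\<bar> \<le> \<bar>D n x\<bar>" for n x
    using \<Phi>[of "H (x - s n *\<^sub>R e)" "H x"] s0(2)[of n]
    by (auto simp: Q_def D_def abs_divide intro!: divide_right_mono)
  have Dall: "AE x in lebesgue_on U. \<forall>n. \<bar>D n x\<bar> \<le> C"
    unfolding AE_all_countable using Dbound by blast
  have NU: "AE x in lebesgue_on U. H x \<notin> N"
  proof -
    have "AE x in lebesgue. x \<in> \<Omega> \<longrightarrow> H x \<notin> N"
      using N \<Omega> by (simp add: AE_restrict_space_iff)
    then have "AE x in lebesgue. x \<in> U \<longrightarrow> H x \<notin> N"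
      by eventually_elim (use U\<Omega> in auto)
    then show ?thesis
      by (simp add: AE_restrict_space_iff)
  qed
  \<comment> \<open>Linearisation: \<open>Q n\<close> is compared with
    \<open>P (H x) * D n x\<close>. The error is controlled pointwise by differentiability of
    \<open>\<Phi>\<close>, while in the main term the factor \<open>P (H x)\<close> is shifted to
    the test function, giving the fixed L1 function against which \<open>D n\<close> converges
    weakly.\<close>
  have rem: "(\<lambda>n. \<integral>x. (Q n x - P (H x) * D n x) * \<psi> x \<partial>lebesgue_on U) \<longlonglongrightarrow> (\<integral>x. 0 \<partial>lebesgue_on U)"
  proof (rule integral_dominated_convergence[where w="\<lambda>x. 2 * C * \<bar>\<psi> x\<bar>"])
    show "integrable (lebesgue_on U) (\<lambda>x. 2 * C * \<bar>\<psi> x\<bar>)"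
      using L1_integrable[OF \<psi>L] by simp
    show "AE x in lebesgue_on U. (\<lambda>n. (Q n x - P (H x) * D n x) * \<psi> x) \<longlonglongrightarrow> 0"
      using Dall NU
    proof eventually_elim
      case (elim x)
      define z y where "z = H x" and "y n = H (x - s n *\<^sub>R e) - H x" for n
      \<comment> \<open>The bound on the quotients forces \<open>H (x - s n *\<^sub>R e)\<close> to
        tend to \<open>H x\<close> at almost every \<open>x\<close>, which stands in for continuity
        of \<open>H\<close>.\<close>
      have y: "\<bar>y n\<bar> \<le> C * s n" for n
        using elim(1)[rule_format, of n] s0(2)[of n]
        by (simp add: D_def y_def abs_divide divide_le_eq)
      have "(\<lambda>n. C * s n) \<longlonglongrightarrow> 0" using tendsto_mult_right_zero[OF s] .
      then have y0: "y \<longlonglongrightarrow> 0"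
        by (rule Lim_null_comparison[rotated]) (use y in auto)
      \<comment> \<open>The error of the derivative at \<open>z\<close>; its value 0 at
        \<open>h = 0\<close> makes it continuous there and covers indices with
        \<open>y n = 0\<close>.\<close>
      define r where "r h = (if h = 0 then 0 else (\<Phi> (z + h) - \<Phi> z) / h - P z)" for h
      have "((\<lambda>h. (\<Phi> (z + h) - \<Phi> z) / h) \<longlongrightarrow> P z) (at 0)"
        using deriv[of z] elim(2) by (simp add: z_def DERIV_def)
      then have "((\<lambda>h. (\<Phi> (z + h) - \<Phi> z) / h - P z) \<longlongrightarrow> 0) (at 0)"
        by (simp add: LIM_zero_iff)
      then have "(r \<longlongrightarrow> 0) (at 0)"
        by (rule Lim_transform_within[OF _ zero_less_one]) (auto simp: r_def)
      then have "isCont r 0"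
        by (simp add: isCont_def r_def)
      then have ry: "(\<lambda>n. r (y n)) \<longlonglongrightarrow> 0"
        using isCont_tendsto_compose[OF _ y0, of r] by (simp add: r_def)
      have eq: "Q n x - P (H x) * D n x = r (y n) * D n x" for n
      proof (cases "y n = 0")
        case True
        then have "H (x - s n *\<^sub>R e) = H x" by (simp add: y_def)
        then show ?thesis by (simp add: Q_def D_def)
      next
        case False
        have alg: "(A / y - p) * (y / s) = A / s - p * (y / s)" if "y \<noteq> 0" for A y p s :: real
          using that by (simp add: left_diff_distrib diff_divide_distrib)
        have zy: "z + y n = H (x - s n *\<^sub>R e)"
          by (simp add: z_def y_def)
        have D: "D n x = y n / s n"
          by (simp add: y_def D_def)
        have "r (y n) * (y n / s n) = (\<Phi> (z + y n) - \<Phi> z) / s n - P z * (y n / s n)"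
          using False alg[of "y n" "\<Phi> (z + y n) - \<Phi> z" "P z" "s n"] by (simp add: r_def)
        then show ?thesis
          unfolding D by (simp add: Q_def zy) (simp add: z_def)
      qed
      have "(\<lambda>n. r (y n) * D n x) \<longlonglongrightarrow> 0"
      proof (rule Lim_null_comparison)
        show "\<forall>\<^sub>F n in sequentially. norm (r (y n) * D n x) \<le> \<bar>r (y n)\<bar> * C"
          using elim(1) by (intro always_eventually allI) (auto simp: abs_mult intro!: mult_left_mono)
        show "(\<lambda>n. \<bar>r (y n)\<bar> * C) \<longlonglongrightarrow> 0"
          by (rule tendsto_mult_left_zero) (rule tendsto_rabs_zero[OF ry])
      qed
      then have "(\<lambda>n. (r (y n) * D n x) * \<psi> x) \<longlonglongrightarrow> 0"
        by (rule tendsto_mult_left_zero)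
      then show ?case by (simp add: eq)
    qed
    show "AE x in lebesgue_on U. norm ((Q n x - P (H x) * D n x) * \<psi> x) \<le> 2 * C * \<bar>\<psi> x\<bar>" for n
      using Dall
    proof eventually_elim
      case (elim x)
      have "\<bar>P (H x)\<bar> * \<bar>D n x\<bar> \<le> 1 * C"
        using P1[of "H x"] elim by (intro mult_mono) auto
      then have "\<bar>P (H x) * D n x\<bar> \<le> C" by (simp add: abs_mult)
      moreover have "\<bar>Q n x\<bar> \<le> C" using QD[of n x] elim by (meson order.trans)
      ultimately have "\<bar>Q n x - P (H x) * D n x\<bar> \<le> 2 * C" by linarith
      then show ?case by (simp add: abs_mult mult_right_mono)
    qed
    show "(\<lambda>x. (Q n x - P (H x) * D n x) * \<psi> x) \<in> borel_measurable (lebesgue_on U)" for n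
      by (rule lm) measurable
  qed simp
  have QL: "Q n \<in> Linf U" for n
    using Dbound[of n] by (intro LinfI[of _ _ C] lm) (auto elim!: eventually_mono intro: order.trans[OF QD])
  have split: "(\<integral>x. Q n x * \<psi> x \<partial>lebesgue_on U) =
      (\<integral>x. (Q n x - P (H x) * D n x) * \<psi> x \<partial>lebesgue_on U) + (\<integral>x. D n x * (P (H x) * \<psi> x) \<partial>lebesgue_on U)" for n
  proof -
    have "integrable (lebesgue_on U) (\<lambda>x. Q n x * \<psi> x)"
      by (rule Linf_L1_mult_integrable[OF QL \<psi>L])
    moreover have "integrable (lebesgue_on U) (\<lambda>x. D n x * (P (H x) * \<psi> x))"
      by (rule Linf_L1_mult_integrable[OF DL PL])
    ultimately have "(\<integral>x. Q n x * \<psi> x - D n x * (P (H x) * \<psi> x) \<partial>lebesgue_on U) =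
       (\<integral>x. Q n x * \<psi> x \<partial>lebesgue_on U) - (\<integral>x. D n x * (P (H x) * \<psi> x) \<partial>lebesgue_on U)"
      by (rule Bochner_Integration.integral_diff)
    moreover have "(\<lambda>x. Q n x * \<psi> x - D n x * (P (H x) * \<psi> x)) = (\<lambda>x. (Q n x - P (H x) * D n x) * \<psi> x)"
      by (auto simp: algebra_simps)
    ultimately show ?thesis by simp
  qed
  have "(\<lambda>n. \<integral>x. Q n x * \<psi> x \<partial>lebesgue_on U) \<longlonglongrightarrow> 0 + (\<integral>x. - g x * (P (H x) * \<psi> x) \<partial>lebesgue_on U)"
    unfolding split using rem by (intro tendsto_add Dconv PL) simp
  moreover have "(\<integral>x. Q n x * \<psi> x \<partial>lebesgue_on U) = (\<integral>x. \<Phi> (H x) * ((\<psi> (x + s n *\<^sub>R e) - \<psi> x) / s n) \<partial>lborel)" for n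
  proof -
    have "\<bar>\<Phi> (H x)\<bar> \<le> B + \<bar>\<Phi> 0\<bar>" for x
      using \<Phi>[of "H x" 0] B[of x] by linarith
    then have "(\<integral>x. \<Phi> (H x) * ((\<psi> (x + s n *\<^sub>R e) - \<psi> x) / s n) \<partial>lborel) = (\<integral>x. Q n x * \<psi> x \<partial>lborel)"
      unfolding Q_def
      by (intro integral_difference_quotient_transfer[OF _ _ test_function_integrable[OF \<psi>]]) auto
    also have "\<dots> = (\<integral>x. Q n x * \<psi> x \<partial>lebesgue_on U)"
      by (rule integral_lebesgue_on_borel(2)[symmetric]) (use K(3) U(2) in auto)
    finally show ?thesis by simp
  qed
  moreover have "(\<lambda>n. \<integral>x. \<Phi> (H x) * ((\<psi> (x + s n *\<^sub>R e) - \<psi> x) / s n) \<partial>lborel)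
      \<longlonglongrightarrow> (\<integral>x. \<Phi> (H x) * frechet_derivative \<psi> (at x) e \<partial>lborel)"
  proof (rule test_function_difference_quotient_tendsto[OF \<psi> _ _ s s0(1)])
    show "\<bar>\<Phi> (H x)\<bar> \<le> B + \<bar>\<Phi> 0\<bar>" for x
      using \<Phi>[of "H x" 0] B[of x] by linarith
  qed measurable
  ultimately have "(\<integral>x. \<Phi> (H x) * frechet_derivative \<psi> (at x) e \<partial>lborel) =
      (\<integral>x. - g x * (P (H x) * \<psi> x) \<partial>lebesgue_on U)"
    using LIMSEQ_unique by fastforce
  also have "\<dots> = (\<integral>x. - g x * (P (H x) * \<psi> x) \<partial>lborel)"
    by (rule integral_lebesgue_on_borel(2)) (use K(3) U(2) in auto)
  also have "\<dots> = - (\<integral>x. (P (H x) * g x) * \<psi> x \<partial>lborel)"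
    by (simp add: mult_ac)
  finally show ?thesis .
qed

section \<open>Functions interpolating between two Sobolev functions\<close>

lemma Linf_borel_representative:
  fixes f :: "'a::euclidean_space \<Rightarrow> 'b::euclidean_space"
  assumes f: "f \<in> Linf \<Omega>" and \<Omega>: "\<Omega> \<in> sets borel"
  obtains f' C where "f' \<in> borel_measurable borel" "AE x in lebesgue_on \<Omega>. f x = f' x"
    "\<And>x. x \<notin> \<Omega> \<Longrightarrow> f' x = 0" "\<And>x. norm (f' x) \<le> C"
proof -
  obtain C where C: "C \<ge> 0" "AE x in lebesgue_on \<Omega>. norm (f x) \<le> C"
    using f by (rule LinfE)
  obtain h where h[measurable]: "h \<in> borel_measurable borel" and ae: "AE x in lebesgue_on \<Omega>. f x = h x"
    and h0: "\<And>x. x \<notin> \<Omega> \<Longrightarrow> h x = 0"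
    using lebesgue_on_borel_representative[OF Linf_measurable[OF f] \<Omega>] by blast
  show thesis
  \<comment> \<open>Values beyond the essential bound are reset to 0, so that the bound holds at
    every point, as translation arguments require.\<close>
  proof (rule that[of "\<lambda>x. if norm (h x) \<le> C then h x else 0" C])
    show "AE x in lebesgue_on \<Omega>. f x = (if norm (h x) \<le> C then h x else 0)"
      using C(2) ae by eventually_elim auto
  qed (use C(1) h0 in auto)
qed

text \<open>The previous chain rule is applied in each coordinate direction to Borel representatives
  of \<open>h\<close> and of its gradient. They vanish off \<open>\<Omega>\<close>, which permits
  integration over the whole space, where translation is available.\<close>

lemma W1inf_chain_rule:
  fixes h :: "'a::euclidean_space \<Rightarrow> real"
  assumes \<Omega>: "open \<Omega>" and h: "h \<in> W1inf \<Omega>"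
    and \<Phi>: "\<And>a b. \<bar>\<Phi> a - \<Phi> b\<bar> \<le> \<bar>a - b\<bar>"
    and P[measurable]: "P \<in> borel_measurable borel" and P1: "\<And>z. \<bar>P z\<bar> \<le> 1"
    and deriv: "\<And>z. z \<notin> N \<Longrightarrow> (\<Phi> has_real_derivative P z) (at z)"
    and N: "AE x in lebesgue_on \<Omega>. h x \<notin> N"
  shows "(\<lambda>x. \<Phi> (h x)) \<in> W1inf \<Omega>"
    and "AE x in lebesgue_on \<Omega>. wgrad \<Omega> (\<lambda>x. \<Phi> (h x)) x = P (h x) *\<^sub>R wgrad \<Omega> h x"
proof -
  have \<Omega>m: "\<Omega> \<in> sets borel" using \<Omega> by simp
  note hL = W1inf_Linf[OF h] and Dh = wgrad[OF h]
  note [measurable] = Linf_measurable[OF hL] Linf_measurable[OF Dh(1)]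
  have \<Phi>m[measurable]: "\<Phi> \<in> borel_measurable borel"
  proof (intro borel_measurable_continuous_onI)
    have "1-lipschitz_on UNIV \<Phi>"
      using \<Phi> by (auto simp: lipschitz_on_def dist_real_def)
    then show "continuous_on UNIV \<Phi>" by (rule lipschitz_on_continuous_on)
  qed
  obtain H B where H[measurable]: "H \<in> borel_measurable borel" and hH: "AE x in lebesgue_on \<Omega>. h x = H x"
    and H0: "\<And>x. x \<notin> \<Omega> \<Longrightarrow> H x = 0" and B: "\<And>x. norm (H x) \<le> B"
    using Linf_borel_representative[OF hL \<Omega>m] by metis
  obtain G C where G[measurable]: "G \<in> borel_measurable borel"
    and hG: "AE x in lebesgue_on \<Omega>. wgrad \<Omega> h x = G x"
    and G0: "\<And>x. x \<notin> \<Omega> \<Longrightarrow> G x = 0" and C: "\<And>x. norm (G x) \<le> C"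
    using Linf_borel_representative[OF Dh(1) \<Omega>m] by metis
  note lm = borel_measurable_lebesgue_on
  have \<Phi>L: "(\<lambda>x. \<Phi> (h x)) \<in> Linf \<Omega>"
  proof (rule LinfI)
    show "AE x in lebesgue_on \<Omega>. norm (\<Phi> (h x)) \<le> \<bar>\<Phi> 0\<bar> + B"
      using hH
    proof eventually_elim
      case (elim x)
      then show ?case
        using \<Phi>[of "h x" 0] B[of x] by simp
    qed
  qed measurable
  have DL: "(\<lambda>x. P (h x) *\<^sub>R wgrad \<Omega> h x) \<in> Linf \<Omega>"
  proof (rule LinfI)
    show "AE x in lebesgue_on \<Omega>. norm (P (h x) *\<^sub>R wgrad \<Omega> h x) \<le> 1 * C"
      using hG
    proof eventually_elim
      case (elim x)
      then show ?case
        using P1[of "h x"] C[of x] unfolding norm_scaleR by (intro mult_mono) auto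
    qed
  qed measurable
  have weak: "weak_gradient \<Omega> (\<lambda>x. \<Phi> (h x)) (\<lambda>x. P (h x) *\<^sub>R wgrad \<Omega> h x)"
    unfolding weak_gradient_def
  proof (intro ballI)
    fix \<psi> and i :: 'a assume \<psi>: "\<psi> \<in> test_functions \<Omega>" and i: "i \<in> Basis"
    have Gi: "(\<lambda>x. G x \<bullet> i) \<in> borel_measurable borel" by measurable
    have tz: "\<phi> x = 0" "frechet_derivative \<phi> (at x) i = 0"
      if "\<phi> \<in> test_functions \<Omega>" "x \<notin> \<Omega>" for \<phi> x
      using test_function_support[OF that(1)] that(2) by blast+
    have "(\<integral>x. \<Phi> (H x) * frechet_derivative \<psi> (at x) i \<partial>lborel) = - (\<integral>x. (P (H x) * (G x \<bullet> i)) * \<psi> x \<partial>lborel)"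
    proof (rule weak_derivative_chain_rule[OF \<Omega>, where N=N and C=C])
      show "norm i \<le> 1" using i by simp
      show "\<bar>G x \<bullet> i\<bar> \<le> C" for x
        using Basis_le_norm[OF i, of "G x"] C[of x] by linarith
      show "AE x in lebesgue_on \<Omega>. H x \<notin> N"
        using N hH by eventually_elim auto
      fix \<phi> assume \<phi>: "\<phi> \<in> test_functions \<Omega>"
      note [measurable] = test_function_borel[OF \<phi>] test_function_derivative_borel[OF \<phi>, of i]
      have "(\<integral>x. H x * frechet_derivative \<phi> (at x) i \<partial>lborel) = (\<integral>x. H x * frechet_derivative \<phi> (at x) i \<partial>lebesgue_on \<Omega>)"
        by (rule integral_lebesgue_on_borel(2)[symmetric]) (use H0 \<Omega>m in auto)
      also have "\<dots> = (\<integral>x. h x * frechet_derivative \<phi> (at x) i \<partial>lebesgue_on \<Omega>)"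
        using hH
        by (intro integral_cong_AE borel_measurable_times Linf_measurable[OF hL] lm[OF H]
            lm[OF test_function_derivative_borel[OF \<phi>]]) (auto elim: eventually_mono)
      also have "\<dots> = - (\<integral>x. (wgrad \<Omega> h x \<bullet> i) * \<phi> x \<partial>lebesgue_on \<Omega>)"
        using Dh(2) \<phi> i by (simp add: weak_gradient_def)
      also have "(\<integral>x. (wgrad \<Omega> h x \<bullet> i) * \<phi> x \<partial>lebesgue_on \<Omega>) = (\<integral>x. (G x \<bullet> i) * \<phi> x \<partial>lebesgue_on \<Omega>)"
        using hG
        by (intro integral_cong_AE borel_measurable_times Linf_measurable[OF Linf_inner[OF Dh(1)]]
            lm[OF Gi] lm[OF test_function_borel[OF \<phi>]]) (auto elim: eventually_mono)
      also have "\<dots> = (\<integral>x. (G x \<bullet> i) * \<phi> x \<partial>lborel)"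
        by (rule integral_lebesgue_on_borel(2)) (use G0 \<Omega>m in auto)
      finally show "(\<integral>x. H x * frechet_derivative \<phi> (at x) i \<partial>lborel) = - (\<integral>x. (G x \<bullet> i) * \<phi> x \<partial>lborel)" .
    qed (use B \<Phi> P1 deriv \<psi> in auto)
    note * = this
    note [measurable] = test_function_borel[OF \<psi>] test_function_derivative_borel[OF \<psi>, of i]
    have "(\<integral>x. \<Phi> (h x) * frechet_derivative \<psi> (at x) i \<partial>lebesgue_on \<Omega>) =
        (\<integral>x. \<Phi> (H x) * frechet_derivative \<psi> (at x) i \<partial>lebesgue_on \<Omega>)"
    proof (rule integral_cong_AE)
      show "(\<lambda>x. \<Phi> (H x) * frechet_derivative \<psi> (at x) i) \<in> borel_measurable (lebesgue_on \<Omega>)"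
        by (rule lm) measurable
      show "(\<lambda>x. \<Phi> (h x) * frechet_derivative \<psi> (at x) i) \<in> borel_measurable (lebesgue_on \<Omega>)"
        by (intro borel_measurable_times Linf_measurable[OF \<Phi>L] lm[OF test_function_derivative_borel[OF \<psi>]])
    qed (use hH in \<open>auto elim: eventually_mono\<close>)
    also have "\<dots> = (\<integral>x. \<Phi> (H x) * frechet_derivative \<psi> (at x) i \<partial>lborel)"
      by (rule integral_lebesgue_on_borel(2)) (use tz(2)[OF \<psi>] \<Omega>m in auto)
    also have "\<dots> = - (\<integral>x. (P (H x) * (G x \<bullet> i)) * \<psi> x \<partial>lborel)" by (rule *)
    also have "(\<integral>x. (P (H x) * (G x \<bullet> i)) * \<psi> x \<partial>lborel) = (\<integral>x. (P (H x) * (G x \<bullet> i)) * \<psi> x \<partial>lebesgue_on \<Omega>)"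
      by (rule integral_lebesgue_on_borel(2)[symmetric]) (use tz(1)[OF \<psi>] \<Omega>m in auto)
    also have "\<dots> = (\<integral>x. ((P (h x) *\<^sub>R wgrad \<Omega> h x) \<bullet> i) * \<psi> x \<partial>lebesgue_on \<Omega>)"
    proof (rule integral_cong_AE)
      show "(\<lambda>x. (P (H x) * (G x \<bullet> i)) * \<psi> x) \<in> borel_measurable (lebesgue_on \<Omega>)"
        by (rule lm) measurable
      show "(\<lambda>x. ((P (h x) *\<^sub>R wgrad \<Omega> h x) \<bullet> i) * \<psi> x) \<in> borel_measurable (lebesgue_on \<Omega>)"
        by (intro borel_measurable_times Linf_measurable[OF Linf_inner[OF DL]] lm[OF test_function_borel[OF \<psi>]])
      show "AE x in lebesgue_on \<Omega>. P (H x) * (G x \<bullet> i) * \<psi> x = ((P (h x) *\<^sub>R wgrad \<Omega> h x) \<bullet> i) * \<psi> x"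
        using hH hG by eventually_elim simp
    qed
    finally show "(\<integral>x. \<Phi> (h x) * frechet_derivative \<psi> (at x) i \<partial>lebesgue_on \<Omega>) =
        - (\<integral>x. ((P (h x) *\<^sub>R wgrad \<Omega> h x) \<bullet> i) * \<psi> x \<partial>lebesgue_on \<Omega>)" .
  qed
  show "(\<lambda>x. \<Phi> (h x)) \<in> W1inf \<Omega>"
    and "AE x in lebesgue_on \<Omega>. wgrad \<Omega> (\<lambda>x. \<Phi> (h x)) x = P (h x) *\<^sub>R wgrad \<Omega> h x"
    using wgrad_AE[OF \<Omega> \<Phi>L DL weak] by auto
qed

text \<open>For \<open>0 \<le> t \<le> 1\<close> each unit interval carries a rise of slope 1 over
  length \<open>t\<close> followed by a flat piece, a gain of \<open>t\<close> per unit; hence the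
  average slope \<open>t\<close> from slopes 0 and 1 only.\<close>

definition staircase :: "real \<Rightarrow> real \<Rightarrow> real" where
  "staircase t z = t * of_int \<lfloor>z\<rfloor> + min (frac z) t"

lemma staircase_increment:
  assumes t: "0 \<le> t" "t \<le> 1" and ab: "a \<le> b"
  shows "0 \<le> staircase t b - staircase t a" and "staircase t b - staircase t a \<le> b - a"
proof -
  define m n where "m = real_of_int \<lfloor>a\<rfloor>" and "n = real_of_int \<lfloor>b\<rfloor>"
  define f g where "f = frac a" and "g = frac b"
  have ab': "a = m + f" "b = n + g" by (simp_all add: m_def n_def f_def g_def frac_def)
  have s: "staircase t a = t * m + min f t" "staircase t b = t * n + min g t"
    by (simp_all add: staircase_def m_def n_def f_def g_def)
  have fg: "0 \<le> f" "f < 1" "0 \<le> g" "g < 1"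
    by (simp_all add: f_def g_def frac_lt_1)
  have "\<lfloor>a\<rfloor> \<le> \<lfloor>b\<rfloor>" using ab by (rule floor_mono)
  then consider "m = n" | "\<lfloor>a\<rfloor> + 1 \<le> \<lfloor>b\<rfloor>" by (force simp: m_def n_def)
  then have "0 \<le> staircase t b - staircase t a \<and> staircase t b - staircase t a \<le> b - a"
  proof cases
    case 1
    show ?thesis unfolding s using ab 1 unfolding ab' by (auto simp: min_def)
  next
    case 2
    then have mn: "1 \<le> n - m" unfolding m_def n_def by linarith
    \<comment> \<open>The product with \<open>t\<close> gives monotonicity, since
      \<open>min f t\<close> is at most \<open>t\<close>; the product with \<open>1 - t\<close>
      gives the Lipschitz bound, since \<open>f - min f t\<close> is at most
      \<open>1 - t\<close>.\<close>
    have "t * 1 \<le> t * (n - m)" "(1 - t) * 1 \<le> (1 - t) * (n - m)"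
      using t mult_left_mono[OF mn, of t] mult_left_mono[OF mn, of "1 - t"] by simp_all
    then show ?thesis
      unfolding s using fg t unfolding ab' by (auto simp: algebra_simps min_def)
  qed
  then show "0 \<le> staircase t b - staircase t a" "staircase t b - staircase t a \<le> b - a" by auto
qed

lemma staircase_lipschitz:
  assumes "0 \<le> t" "t \<le> 1"
  shows "\<bar>staircase t a - staircase t b\<bar> \<le> \<bar>a - b\<bar>"
  using staircase_increment[OF assms, of a b] staircase_increment[OF assms, of b a] by linarith

lemma staircase_close:
  assumes "0 \<le> t" "t \<le> 1"
  shows "\<bar>staircase t z - t * z\<bar> \<le> 1"
proof -
  have z: "staircase t z - t * z = min (frac z) t - t * frac z"
    by (simp add: staircase_def frac_def algebra_simps)
  have f: "0 \<le> frac z" "frac z < 1" by (simp_all add: frac_lt_1)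
  have "t * frac z \<le> frac z" "t * frac z \<le> t" "0 \<le> t * frac z"
    using assms f mult_right_mono[of t 1 "frac z"] mult_left_mono[of "frac z" 1 t] by simp_all
  then show ?thesis
    unfolding z min_def using assms f by (smt (verit))
qed

lemma staircase_derivative:
  assumes t: "0 \<le> t" "t \<le> 1" and z: "frac z \<noteq> 0" "frac z \<noteq> t"
  shows "(staircase t has_real_derivative (if frac z < t then 1 else 0)) (at z)"
proof -
  define m where "m = \<lfloor>z\<rfloor>"
  have zm: "real_of_int m < z" "z < real_of_int m + 1"
    using z(1) unfolding m_def frac_def by linarith+
  have st: "staircase t w = t * m + min (w - m) t" if "w \<in> {real_of_int m<..<real_of_int m + 1}" for w
  proof -
    have "\<lfloor>w\<rfloor> = m" using that by (intro floor_unique) auto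
    then show ?thesis by (simp add: staircase_def frac_def)
  qed
  show ?thesis
  proof (cases "frac z < t")
    case True
    have "((\<lambda>w. t * m + (w - m)) has_real_derivative 1) (at z)"
      by (auto intro!: derivative_eq_intros)
    then have "(staircase t has_real_derivative 1) (at z)"
      by (rule has_field_derivative_transform_within_open[where S="{real_of_int m<..<real_of_int m + 1} \<inter> {..<m + t}"])
        (use zm True st in \<open>auto simp: m_def frac_def min_def\<close>)
    then show ?thesis using True by simp
  next
    case False
    then have "t < frac z" using z(2) by simp
    have "((\<lambda>w. t * m + t) has_real_derivative 0) (at z)"
      by (auto intro!: derivative_eq_intros)
    then have "(staircase t has_real_derivative 0) (at z)"
      by (rule has_field_derivative_transform_within_open[where S="{real_of_int m<..<real_of_int m + 1} \<inter> {m + t<..}"])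
        (use zm \<open>t < frac z\<close> st in \<open>auto simp: m_def frac_def min_def\<close>)
    then show ?thesis using False by simp
  qed
qed

lemma finite_measure_lebesgue_on:
  fixes \<Omega> :: "'a::euclidean_space set"
  assumes "bounded \<Omega>" "open \<Omega>"
  shows "finite_measure (lebesgue_on \<Omega>)"
proof
  have "emeasure (lebesgue_on \<Omega>) \<Omega> = emeasure lborel \<Omega>"
    using assms(2) by (subst emeasure_restrict_space) auto
  also have "\<dots> < \<infinity>" by (rule emeasure_bounded_finite[OF assms(1)])
  finally show "emeasure (lebesgue_on \<Omega>) (space (lebesgue_on \<Omega>)) \<noteq> \<infinity>"
    by (simp add: space_restrict_space)
qed

text \<open>The image of a finite measure has at most countably many atoms. Only countably many
  shifts move a point of the countable set \<open>S\<close> onto an atom, so some real shift avoids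
  all of them.\<close>

lemma exists_null_level_shift:
  fixes h :: "'a \<Rightarrow> real"
  assumes "finite_measure M" and h[measurable]: "h \<in> borel_measurable M" and S: "countable S"
  obtains a where "AE x in M. \<forall>c\<in>S. h x \<noteq> a + c"
proof -
  interpret M: finite_measure "distr M borel h"
    using finite_measure.finite_measure_distr[OF assms(1) h] .
  let ?B = "{c. measure (distr M borel h) {c} \<noteq> 0}"
  have "countable (\<Union>c\<in>S. (\<lambda>b. b - c) ` ?B)"
    using M.countable_support S by auto
  then have "(\<Union>c\<in>S. (\<lambda>b. b - c) ` ?B) \<noteq> UNIV"
    using uncountable_UNIV_real by metis
  then obtain a where a: "a \<notin> (\<Union>c\<in>S. (\<lambda>b. b - c) ` ?B)" by blast
  have "AE x in M. h x \<noteq> a + c" if c: "c \<in> S" for c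
  proof -
    have "a + c \<notin> ?B"
    proof
      assume "a + c \<in> ?B"
      then have "a + c - c \<in> (\<lambda>b. b - c) ` ?B" by blast
      then show False using a c by simp
    qed
    then have "measure (distr M borel h) {a + c} = 0" by simp
    then have "emeasure (distr M borel h) {a + c} = 0"
      by (simp add: M.emeasure_eq_measure)
    then have "emeasure M (h -` {a + c} \<inter> space M) = 0"
      by (simp add: emeasure_distr)
    moreover have "h -` {a + c} \<inter> space M \<in> sets M" by measurable
    ultimately have "h -` {a + c} \<inter> space M \<in> null_sets M" by (simp add: null_setsI)
    then have "AE x in M. x \<notin> h -` {a + c} \<inter> space M" by (rule AE_not_in)
    then show ?thesis using AE_space by eventually_elim auto
  qed
  then have "AE x in M. \<forall>c\<in>S. h x \<noteq> a + c"
    using S by (simp add: AE_ball_countable)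
  then show thesis by (rule that)
qed

lemma W1inf_interpolation:
  fixes \<Omega> :: "'a::euclidean_space set"
  assumes \<Omega>: "open \<Omega>" "bounded \<Omega>" and u: "u \<in> W1inf \<Omega>" and v: "v \<in> W1inf \<Omega>"
    and t: "0 \<le> t" "t \<le> 1" and \<epsilon>: "\<epsilon> > 0"
  shows "\<exists>w\<in>W1inf \<Omega>. (\<forall>x. \<bar>w x - ((1 - t) * u x + t * v x)\<bar> \<le> \<epsilon>) \<and>
    (AE x in lebesgue_on \<Omega>. wgrad \<Omega> w x = wgrad \<Omega> u x \<or> wgrad \<Omega> w x = wgrad \<Omega> v x)"
proof -
  define h where "h x = v x - u x" for x
  have h: "h \<in> W1inf \<Omega>" and Dh: "AE x in lebesgue_on \<Omega>. wgrad \<Omega> h x = wgrad \<Omega> v x - wgrad \<Omega> u x"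
    using W1inf_linear_combination[OF \<Omega>(1) v u, of 1 "-1"] by (simp_all add: h_def[abs_def])
  \<comment> \<open>The corners of the rescaled staircase before the shift: ends of flat pieces at
    multiples of \<open>\<epsilon>\<close>, ends of rises \<open>\<epsilon> * t\<close> further
    on.\<close>
  define S where "S = range (\<lambda>k::int. \<epsilon> * of_int k) \<union> range (\<lambda>k::int. \<epsilon> * (of_int k + t))"
  have "countable S" by (simp add: S_def)
  then obtain a where a: "AE x in lebesgue_on \<Omega>. \<forall>c\<in>S. h x \<noteq> a + c"
    using exists_null_level_shift[OF finite_measure_lebesgue_on[OF \<Omega>(2,1)] Linf_measurable[OF W1inf_Linf[OF h]]]
    by blast
  \<comment> \<open>The shift by \<open>a\<close> moves the corners off the charged levels of
    \<open>h\<close>; adding \<open>t * a\<close> recentres the graph, which stays within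
    \<open>\<epsilon>\<close> of \<open>t * z\<close>.\<close>
  define \<Phi> where "\<Phi> z = \<epsilon> * staircase t ((z - a) / \<epsilon>) + t * a" for z
  define P where "P z = (if frac ((z - a) / \<epsilon>) < t then 1 else 0::real)" for z
  define N where "N = {z. frac ((z - a) / \<epsilon>) = 0 \<or> frac ((z - a) / \<epsilon>) = t}"
  have "\<bar>\<Phi> z - t * z\<bar> \<le> \<epsilon>" for z
  proof -
    have "\<Phi> z - t * z = \<epsilon> * (staircase t ((z - a) / \<epsilon>) - t * ((z - a) / \<epsilon>))"
      using \<epsilon> by (simp add: \<Phi>_def field_simps)
    then show ?thesis
      using staircase_close[OF t, of "(z - a) / \<epsilon>"] \<epsilon> by (simp add: abs_mult)
  qed
  note close = this
  have lip: "\<bar>\<Phi> z - \<Phi> y\<bar> \<le> \<bar>z - y\<bar>" for z y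
  proof -
    have "\<bar>\<Phi> z - \<Phi> y\<bar> = \<epsilon> * \<bar>staircase t ((z - a) / \<epsilon>) - staircase t ((y - a) / \<epsilon>)\<bar>"
      using \<epsilon> by (simp add: \<Phi>_def abs_mult flip: right_diff_distrib)
    also have "\<dots> \<le> \<epsilon> * \<bar>(z - a) / \<epsilon> - (y - a) / \<epsilon>\<bar>"
      using \<epsilon> by (intro mult_left_mono staircase_lipschitz[OF t]) auto
    also have "\<dots> = \<bar>z - y\<bar>"
      using \<epsilon> by (simp add: abs_divide flip: diff_divide_distrib)
    finally show ?thesis .
  qed
  have Pm: "P \<in> borel_measurable borel"
    unfolding P_def frac_def by measurable
  have deriv: "(\<Phi> has_real_derivative P z) (at z)" if "z \<notin> N" for z
  proof -
    have 1: "((\<lambda>z. (z - a) / \<epsilon>) has_real_derivative 1 / \<epsilon>) (at z)"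
      using \<epsilon> by (auto intro!: derivative_eq_intros)
    have 2: "(staircase t has_real_derivative P z) (at ((z - a) / \<epsilon>))"
      unfolding P_def using that by (intro staircase_derivative t) (auto simp: N_def)
    have "((\<lambda>z. \<epsilon> * staircase t ((z - a) / \<epsilon>) + t * a) has_real_derivative \<epsilon> * (P z * (1 / \<epsilon>)) + 0) (at z)"
      by (intro DERIV_add DERIV_cmult DERIV_const DERIV_chain2[OF 2 1])
    then show ?thesis using \<epsilon> by (simp add: \<Phi>_def[abs_def])
  qed
  have "a + \<epsilon> * y = z" if "y = (z - a) / \<epsilon>" for y z
    using \<epsilon> that by simp
  note zy = this
  have aeN: "AE x in lebesgue_on \<Omega>. h x \<notin> N"
    using a
  proof eventually_elim
    case (elim x)
    show ?case
    proof
      assume "h x \<in> N"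
      then have "(h x - a) / \<epsilon> = of_int \<lfloor>(h x - a) / \<epsilon>\<rfloor> \<or> (h x - a) / \<epsilon> = of_int \<lfloor>(h x - a) / \<epsilon>\<rfloor> + t"
        unfolding N_def frac_def by auto
      then have "h x = a + \<epsilon> * of_int \<lfloor>(h x - a) / \<epsilon>\<rfloor> \<or> h x = a + \<epsilon> * (of_int \<lfloor>(h x - a) / \<epsilon>\<rfloor> + t)"
        using zy by metis
      moreover have "\<epsilon> * of_int k \<in> S" "\<epsilon> * (of_int k + t) \<in> S" for k :: int
        by (auto simp: S_def)
      ultimately show False using elim by blast
    qed
  qed
  have P1: "\<bar>P z\<bar> \<le> 1" for z by (simp add: P_def)
  have ch: "(\<lambda>x. \<Phi> (h x)) \<in> W1inf \<Omega>"
    "AE x in lebesgue_on \<Omega>. wgrad \<Omega> (\<lambda>x. \<Phi> (h x)) x = P (h x) *\<^sub>R wgrad \<Omega> h x"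
    by (rule W1inf_chain_rule[OF \<Omega>(1) h lip Pm P1 _ aeN]; use deriv in blast)+
  show ?thesis
  \<comment> \<open>The gradient is \<open>wgrad \<Omega> u x + P (h x) *\<^sub>R (wgrad \<Omega> v
    x - wgrad \<Omega> u x)\<close> with \<open>P\<close> equal to 0 or 1. The factors 1 match the
    form of the linear combination lemma.\<close>
  proof (intro bexI[of _ "\<lambda>x. 1 * u x + 1 * \<Phi> (h x)"] conjI allI)
    show "(\<lambda>x. 1 * u x + 1 * \<Phi> (h x)) \<in> W1inf \<Omega>"
      by (rule W1inf_linear_combination[OF \<Omega>(1) u ch(1)])
    show "\<bar>1 * u x + 1 * \<Phi> (h x) - ((1 - t) * u x + t * v x)\<bar> \<le> \<epsilon>" for x
      using close[of "h x"] by (simp add: h_def algebra_simps)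
    show "AE x in lebesgue_on \<Omega>. wgrad \<Omega> (\<lambda>x. 1 * u x + 1 * \<Phi> (h x)) x = wgrad \<Omega> u x \<or>
        wgrad \<Omega> (\<lambda>x. 1 * u x + 1 * \<Phi> (h x)) x = wgrad \<Omega> v x"
      using W1inf_linear_combination(2)[OF \<Omega>(1) u ch(1), of 1 1] ch(2) Dh
      by eventually_elim (auto simp: P_def)
  qed
qed

section \<open>Separation of convex sets in the weak* topology\<close>

text \<open>The image of \<open>D\<close> under \<open>(p, q)\<close> is a convex plane set that
  misses the open negative quadrant, so a line through the origin with nonnegative normal separates
  it. Convex combinations are abstract because the elements will be functions, which form no real
  vector space type.\<close>

lemma two_function_minimax:
  fixes p q :: "'c \<Rightarrow> real" and comb :: "real \<Rightarrow> 'c \<Rightarrow> 'c \<Rightarrow> 'c"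
  assumes D: "\<And>a b t. a \<in> D \<Longrightarrow> b \<in> D \<Longrightarrow> 0 \<le> t \<Longrightarrow> t \<le> 1 \<Longrightarrow> comb t a b \<in> D"
    and p: "\<And>a b t. a \<in> D \<Longrightarrow> b \<in> D \<Longrightarrow> 0 \<le> t \<Longrightarrow> t \<le> 1 \<Longrightarrow> p (comb t a b) = (1 - t) * p a + t * p b"
    and q: "\<And>a b t. a \<in> D \<Longrightarrow> b \<in> D \<Longrightarrow> 0 \<le> t \<Longrightarrow> t \<le> 1 \<Longrightarrow> q (comb t a b) = (1 - t) * q a + t * q b"
    and pq: "\<And>a. a \<in> D \<Longrightarrow> 0 \<le> p a \<or> 0 \<le> q a"
  shows "\<exists>l. 0 \<le> l \<and> l \<le> 1 \<and> (\<forall>a\<in>D. 0 \<le> l * p a + (1 - l) * q a)"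
proof (cases "(\<forall>a\<in>D. 0 \<le> p a) \<or> (\<forall>a\<in>D. 0 \<le> q a)")
  case True
  then show ?thesis
  proof
    assume "\<forall>a\<in>D. 0 \<le> p a" then show ?thesis by (intro exI[of _ 1]) auto
  next
    assume "\<forall>a\<in>D. 0 \<le> q a" then show ?thesis by (intro exI[of _ 0]) auto
  qed
next
  case False
  then obtain d0 e0 where d0: "d0 \<in> D" "p d0 < 0" and e0: "e0 \<in> D" "q e0 < 0"
    by (meson not_le)
  \<comment> \<open>A nonnegative multiplier \<open>c\<close> with
    \<open>0 \<le> c * p a + q a\<close> for all \<open>a\<close> gets lower bounds from points with
    negative \<open>q\<close> and upper bounds from points with negative \<open>p\<close>. Their
    compatibility follows from convexity.\<close>
  have key: "p d * q e \<le> q d * p e" if d: "d \<in> D" "p d < 0" and e: "e \<in> D" "q e < 0" for d e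
  proof (rule ccontr)
    assume "\<not> p d * q e \<le> q d * p e"
    then have lt: "q d * p e < p d * q e" by simp
    have qd: "0 \<le> q d" and pe: "0 \<le> p e"
      using pq[OF d(1)] pq[OF e(1)] d e by auto
    \<comment> \<open>Along the segment from \<open>d\<close> to \<open>e\<close>, \<open>p\<close>
      vanishes at \<open>s1\<close> and is negative before it, \<open>q\<close> vanishes at
      \<open>s2\<close> and is negative after it. If \<open>s2 < s1\<close>, the midpoint makes both
      negative.\<close>
    define s1 s2 where "s1 = - p d / (p e - p d)" and "s2 = q d / (q d - q e)"
    have pos: "0 < p e - p d" "0 < q d - q e" using d e qd pe by auto
    have "s2 < s1"
      unfolding s1_def s2_def using pos lt by (simp add: divide_simps algebra_simps)
    moreover have "0 \<le> s2" "s1 \<le> 1"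
      unfolding s1_def s2_def using pos qd pe by (auto simp: divide_simps)
    moreover define s where "s = (s1 + s2) / 2"
    ultimately have s: "s2 < s" "s < s1" "0 \<le> s" "s \<le> 1" by auto
    have "s * (p e - p d) < - p d"
      using s(2) pos(1) unfolding s1_def by (simp only: pos_less_divide_eq)
    then have "p (comb s d e) < 0"
      using p[OF d(1) e(1) s(3,4)] by (simp add: algebra_simps)
    moreover have "q d < s * (q d - q e)"
      using s(1) pos(2) unfolding s2_def by (simp only: pos_divide_less_eq)
    then have "q (comb s d e) < 0"
      using q[OF d(1) e(1) s(3,4)] by (simp add: algebra_simps)
    ultimately show False
      using pq[OF D[OF d(1) e(1) s(3,4)]] by auto
  qed
  have pe: "0 < p e" if e: "e \<in> D" "q e < 0" for e
  proof -
    have "0 < p d0 * q e" using d0(2) e(2) by (rule mult_neg_neg)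
    also have "\<dots> \<le> q d0 * p e" by (rule key[OF d0 e])
    finally have "p e \<noteq> 0" by auto
    then show ?thesis using pq[OF e(1)] e(2) by auto
  qed
  \<comment> \<open>The set of lower bounds for the multiplier; by \<open>key\<close> each of them
    is below each upper bound, so the supremum is admissible.\<close>
  define X where "X = (\<lambda>e. - q e / p e) ` {e \<in> D. q e < 0}"
  have ub: "x \<le> q d / (- p d)" if "x \<in> X" and d: "d \<in> D" "p d < 0" for x d
  proof -
    obtain e where e: "e \<in> D" "q e < 0" and x: "x = - q e / p e"
      using \<open>x \<in> X\<close> by (auto simp: X_def)
    show ?thesis
      using key[OF d e] pe[OF e] d(2) unfolding x by (simp add: divide_simps algebra_simps)
  qed
  have ne: "X \<noteq> {}" using e0 by (auto simp: X_def)
  have bdd: "bdd_above X" using ub[OF _ d0] by (rule bdd_aboveI)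
  define c where "c = Sup X"
  have c_ge: "- q e / p e \<le> c" if "e \<in> D" "q e < 0" for e
    unfolding c_def by (rule cSup_upper[OF _ bdd]) (use that in \<open>auto simp: X_def\<close>)
  have c_le: "c \<le> q d / (- p d)" if "d \<in> D" "p d < 0" for d
    unfolding c_def by (rule cSup_least[OF ne]) (use ub that in auto)
  have "0 < - q e0 / p e0" using e0 pe[OF e0] by (simp add: divide_pos_pos divide_neg_pos)
  then have c0: "0 < c" using c_ge[OF e0] by linarith
  have all: "0 \<le> c * p a + q a" if a: "a \<in> D" for a
  proof (cases "q a < 0")
    case True
    have "- q a \<le> c * p a"
      using c_ge[OF a True] pe[OF a True] by (simp only: pos_divide_le_eq)
    then show ?thesis by simp
  next
    case q: False
    show ?thesis
    proof (cases "p a < 0")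
      case True
      then have "0 < - p a" by simp
      then have "c * (- p a) \<le> q a"
        using c_le[OF a True] by (simp only: pos_le_divide_eq)
      then show ?thesis by simp
    next
      case False
      then show ?thesis using q c0 by simp
    qed
  qed
  show ?thesis
  \<comment> \<open>Normalises the multipliers \<open>c\<close> and 1 to weights with sum 1.\<close>
  proof (intro exI[of _ "c / (1 + c)"] conjI ballI)
    fix a assume "a \<in> D"
    have "c / (1 + c) * p a + (1 - c / (1 + c)) * q a = (c * p a + q a) / (1 + c)"
    proof -
      have "1 - c / (1 + c) = 1 / (1 + c)" using c0 by (simp add: field_simps)
      then show ?thesis by (simp add: add_divide_distrib)
    qed
    then show "0 \<le> c / (1 + c) * p a + (1 - c / (1 + c)) * q a"
      using all[OF \<open>a \<in> D\<close>] c0 by simp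
  qed (use c0 in \<open>auto simp: divide_simps\<close>)
qed

section \<open>L2 geometry of bounded functions on a finite measure space\<close>

context finite_measure
begin

lemma bounded_inner_integrable:
  fixes f g :: "'a \<Rightarrow> 'b::euclidean_space"
  assumes f: "f \<in> borel_measurable M" "AE x in M. norm (f x) \<le> R" and g: "integrable M g"
  shows "integrable M (\<lambda>x. f x \<bullet> g x)"
proof (rule Bochner_Integration.integrable_bound)
  show "integrable M (\<lambda>x. R * norm (g x))" using g by auto
  show "AE x in M. norm (f x \<bullet> g x) \<le> norm (R * norm (g x))"
    using f(2)
  proof eventually_elim
    case (elim x)
    have "\<bar>f x \<bullet> g x\<bar> \<le> norm (f x) * norm (g x)" by (rule Cauchy_Schwarz_ineq2)
    also have "\<dots> \<le> R * norm (g x)" using elim by (intro mult_right_mono) auto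
    finally show ?case by (simp add: abs_mult) (smt (verit, best) mult_right_mono norm_ge_zero)
  qed
qed (use f(1) borel_measurable_integrable[OF g] in measurable)

lemma bounded_integrable:
  fixes f :: "'a \<Rightarrow> 'b::euclidean_space"
  assumes f: "f \<in> borel_measurable M" "AE x in M. norm (f x) \<le> R"
  shows "integrable M f"
  using f by (rule integrable_const_bound[rotated])

lemma inner_integral_bound:
  fixes f g :: "'a \<Rightarrow> 'b::euclidean_space"
  assumes f: "f \<in> borel_measurable M" "AE x in M. norm (f x) \<le> R" and g: "integrable M g"
  shows "\<bar>\<integral>x. f x \<bullet> g x \<partial>M\<bar> \<le> R * (\<integral>x. norm (g x) \<partial>M)"
proof -
  have "\<bar>\<integral>x. f x \<bullet> g x \<partial>M\<bar> \<le> (\<integral>x. \<bar>f x \<bullet> g x\<bar> \<partial>M)" by (rule integral_abs_bound)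
  also have "\<dots> \<le> (\<integral>x. R * norm (g x) \<partial>M)"
  proof (rule integral_mono_AE)
    show "integrable M (\<lambda>x. \<bar>f x \<bullet> g x\<bar>)" using bounded_inner_integrable[OF f g] by simp
    show "integrable M (\<lambda>x. R * norm (g x))" using g by auto
    show "AE x in M. \<bar>f x \<bullet> g x\<bar> \<le> R * norm (g x)"
      using f(2)
    proof eventually_elim
      case (elim x)
      have "\<bar>f x \<bullet> g x\<bar> \<le> norm (f x) * norm (g x)" by (rule Cauchy_Schwarz_ineq2)
      also have "\<dots> \<le> R * norm (g x)" using elim by (intro mult_right_mono) auto
      finally show ?case .
    qed
  qed
  finally show ?thesis by simp
qed

definition sqnorm :: "('a \<Rightarrow> 'b::euclidean_space) \<Rightarrow> real" where
  "sqnorm f = (\<integral>x. f x \<bullet> f x \<partial>M)"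

lemma sqnorm_nonneg: "0 \<le> sqnorm f"
  by (simp add: sqnorm_def)

text \<open>The closed ball of radius \<open>R\<close> in L\<infinity>. The radius is explicit
  because the separation argument climbs through the balls of integer radius.\<close>

definition bdd_fun :: "real \<Rightarrow> ('a \<Rightarrow> 'b::euclidean_space) \<Rightarrow> bool" where
  "bdd_fun R f \<longleftrightarrow> f \<in> borel_measurable M \<and> (AE x in M. norm (f x) \<le> R)"

lemma bdd_fun_meas: "bdd_fun R f \<Longrightarrow> f \<in> borel_measurable M"
  by (simp add: bdd_fun_def)

lemma bdd_fun_integrable: "bdd_fun R f \<Longrightarrow> integrable M f"
  by (auto simp: bdd_fun_def intro: bounded_integrable)

lemma bdd_fun_inner: "bdd_fun R f \<Longrightarrow> integrable M g \<Longrightarrow> integrable M (\<lambda>x. f x \<bullet> g x)"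
  by (auto simp: bdd_fun_def intro: bounded_inner_integrable)

lemma bdd_fun_inner_bound:
  "bdd_fun R f \<Longrightarrow> integrable M g \<Longrightarrow> \<bar>\<integral>x. f x \<bullet> g x \<partial>M\<bar> \<le> R * (\<integral>x. norm (g x) \<partial>M)"
  by (auto simp: bdd_fun_def intro: inner_integral_bound)

lemma bdd_fun_combination:
  assumes f: "bdd_fun R f" and g: "bdd_fun S g"
  shows "bdd_fun (\<bar>a\<bar> * R + \<bar>b\<bar> * S) (\<lambda>x. a *\<^sub>R f x + b *\<^sub>R g x)"
  unfolding bdd_fun_def
proof
  note [measurable] = bdd_fun_meas[OF f] bdd_fun_meas[OF g]
  show "(\<lambda>x. a *\<^sub>R f x + b *\<^sub>R g x) \<in> borel_measurable M"
    by measurable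
  show "AE x in M. norm (a *\<^sub>R f x + b *\<^sub>R g x) \<le> \<bar>a\<bar> * R + \<bar>b\<bar> * S"
    using f[unfolded bdd_fun_def, THEN conjunct2] g[unfolded bdd_fun_def, THEN conjunct2]
    by eventually_elim (auto intro!: norm_triangle_le add_mono mult_left_mono)
qed

lemma bdd_fun_diff: "bdd_fun R f \<Longrightarrow> bdd_fun S g \<Longrightarrow> bdd_fun (R + S) (\<lambda>x. f x - g x)"
  using bdd_fun_combination[of R f S g 1 "-1"] by simp

lemma bdd_fun_convex:
  assumes "bdd_fun R f" "bdd_fun R g" "0 \<le> t" "t \<le> 1"
  shows "bdd_fun R (\<lambda>x. (1 - t) *\<^sub>R f x + t *\<^sub>R g x)"
  using bdd_fun_combination[OF assms(1,2), of "1 - t" t] assms(3,4) by (simp add: algebra_simps)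

lemma sqnorm_combination:
  assumes f: "bdd_fun R f" and g: "bdd_fun S g"
  shows "sqnorm (\<lambda>x. a *\<^sub>R f x + b *\<^sub>R g x) = a\<^sup>2 * sqnorm f + 2 * a * b * (\<integral>x. f x \<bullet> g x \<partial>M) + b\<^sup>2 * sqnorm g"
proof -
  have i: "integrable M (\<lambda>x. f x \<bullet> f x)" "integrable M (\<lambda>x. f x \<bullet> g x)" "integrable M (\<lambda>x. g x \<bullet> g x)"
    by (rule bdd_fun_inner[OF f bdd_fun_integrable[OF f]] bdd_fun_inner[OF f bdd_fun_integrable[OF g]]
        bdd_fun_inner[OF g bdd_fun_integrable[OF g]])+
  have "sqnorm (\<lambda>x. a *\<^sub>R f x + b *\<^sub>R g x) =
      (\<integral>x. a\<^sup>2 * (f x \<bullet> f x) + 2 * a * b * (f x \<bullet> g x) + b\<^sup>2 * (g x \<bullet> g x) \<partial>M)"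
    unfolding sqnorm_def
    by (intro Bochner_Integration.integral_cong refl)
      (simp add: inner_add_left inner_add_right inner_commute[of "g _" "f _"] power2_eq_square algebra_simps)
  also have "\<dots> = a\<^sup>2 * sqnorm f + 2 * a * b * (\<integral>x. f x \<bullet> g x \<partial>M) + b\<^sup>2 * sqnorm g"
    unfolding sqnorm_def using i by simp
  finally show ?thesis .
qed

text \<open>Dominated convergence: bounded almost everywhere convergence implies weak* convergence.
  A sequentially weak* closed set is therefore stable under it, which is what the separation
  argument asks for.\<close>

lemma bdd_fun_limit:
  fixes f :: "nat \<Rightarrow> 'a \<Rightarrow> 'b::euclidean_space"
  assumes f: "\<And>n. bdd_fun R (f n)" and g: "g \<in> borel_measurable M"
    and lim: "AE x in M. (\<lambda>n. f n x) \<longlonglongrightarrow> g x"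
  shows "bdd_fun R g"
    and "integrable M h \<Longrightarrow> (\<lambda>n. \<integral>x. f n x \<bullet> h x \<partial>M) \<longlonglongrightarrow> (\<integral>x. g x \<bullet> h x \<partial>M)"
proof -
  have all: "AE x in M. \<forall>n. norm (f n x) \<le> R"
    unfolding AE_all_countable using f by (auto simp: bdd_fun_def)
  then have "AE x in M. norm (g x) \<le> R"
    using lim
  proof eventually_elim
    case (elim x)
    from tendsto_norm[OF elim(2)] show ?case
      by (rule LIMSEQ_le_const2) (use elim(1) in auto)
  qed
  then show gR: "bdd_fun R g" using g by (simp add: bdd_fun_def)
  assume h: "integrable M h"
  show "(\<lambda>n. \<integral>x. f n x \<bullet> h x \<partial>M) \<longlonglongrightarrow> (\<integral>x. g x \<bullet> h x \<partial>M)"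
  proof (rule integral_dominated_convergence[where w="\<lambda>x. R * norm (h x)"])
    show "integrable M (\<lambda>x. R * norm (h x))" using h by auto
    show "AE x in M. (\<lambda>n. f n x \<bullet> h x) \<longlonglongrightarrow> g x \<bullet> h x"
      using lim by eventually_elim (intro tendsto_intros)
    show "AE x in M. norm (f n x \<bullet> h x) \<le> R * norm (h x)" for n
      using all
    proof eventually_elim
      case (elim x)
      have "\<bar>f n x \<bullet> h x\<bar> \<le> norm (f n x) * norm (h x)" by (rule Cauchy_Schwarz_ineq2)
      also have "\<dots> \<le> R * norm (h x)" using elim by (intro mult_right_mono) auto
      finally show ?case by simp
    qed
  qed (use bdd_fun_inner[OF gR h] bdd_fun_inner[OF f h] in auto)
qed

lemma sqnorm_bound:
  assumes "bdd_fun R f"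
  shows "sqnorm f \<le> R\<^sup>2 * measure M (space M)"
proof -
  have "AE x in M. norm (f x) \<le> R" using assms by (simp add: bdd_fun_def)
  then have "AE x in M. f x \<bullet> f x \<le> R\<^sup>2"
    by eventually_elim (metis norm_ge_zero power2_norm_eq_inner power_mono)
  then have "sqnorm f \<le> (\<integral>x. R\<^sup>2 \<partial>M)"
    unfolding sqnorm_def using bdd_fun_inner[OF assms bdd_fun_integrable[OF assms]]
    by (intro integral_mono_AE) auto
  then show ?thesis by (simp add: mult.commute)
qed

text \<open>Pointwise, \<open>norm (f x)\<close> is at most \<open>\<eta>\<close> or at most
  \<open>(f x \<bullet> f x) / \<eta>\<close>, so on a finite measure a small L2 norm forces a small
  L1 norm. The threshold is independent of the bound \<open>R\<close>.\<close>

lemma sqnorm_small_L1_small: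
  assumes "e > 0"
  shows "\<exists>d>0. \<forall>f R. bdd_fun R f \<longrightarrow> sqnorm (f :: 'a \<Rightarrow> 'b::euclidean_space) < d \<longrightarrow> (\<integral>x. norm (f x) \<partial>M) < e"
proof -
  define m where "m = measure M (space M) + 1"
  have m: "m > 0" by (simp add: m_def add_nonneg_pos)
  \<comment> \<open>With this value the constant term integrates to at most \<open>e / 2\<close>,
    and the threshold \<open>\<eta> * e / 2\<close> keeps the quadratic term below
    \<open>e / 2\<close>; the \<open>+ 1\<close> in \<open>m\<close> admits total mass 0.\<close>
  define \<eta> where "\<eta> = e / (2 * m)"
  have \<eta>: "\<eta> > 0" using assms m by (simp add: \<eta>_def)
  show ?thesis
  proof (intro exI[of _ "\<eta> * e / 2"] conjI allI impI)
    show "\<eta> * e / 2 > 0" using \<eta> assms by simp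
    fix f :: "'a \<Rightarrow> 'b" and R assume f: "bdd_fun R f" and s: "sqnorm f < \<eta> * e / 2"
    have pt: "norm (f x) \<le> \<eta> + (f x \<bullet> f x) / \<eta>" for x
    proof (cases "norm (f x) \<le> \<eta>")
      case True
      then show ?thesis using \<eta> by (simp add: add_increasing2)
    next
      case False
      then have "norm (f x) * \<eta> \<le> norm (f x) * norm (f x)" by (intro mult_left_mono) auto
      then have "norm (f x) \<le> (f x \<bullet> f x) / \<eta>"
        using \<eta> by (simp add: pos_le_divide_eq power2_norm_eq_inner[symmetric] power2_eq_square)
      then show ?thesis using \<eta> by linarith
    qed
    have i: "integrable M (\<lambda>x. f x \<bullet> f x)" using f by (intro bdd_fun_inner bdd_fun_integrable)
    have "(\<integral>x. norm (f x) \<partial>M) \<le> (\<integral>x. \<eta> + (f x \<bullet> f x) / \<eta> \<partial>M)"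
      using pt i bdd_fun_integrable[OF f] by (intro integral_mono) auto
    also have "\<dots> = \<eta> * measure M (space M) + sqnorm f / \<eta>"
      using i by (simp add: sqnorm_def mult.commute)
    also have "\<dots> < e"
    proof -
      have "sqnorm f / \<eta> < e / 2"
        using \<eta> s by (simp add: pos_divide_less_eq mult.commute)
      moreover have "\<eta> * measure M (space M) \<le> \<eta> * m"
        using \<eta> by (intro mult_left_mono) (auto simp: m_def)
      moreover have "\<eta> * m = e / 2"
        using m by (simp add: \<eta>_def)
      ultimately show ?thesis by linarith
    qed
    finally show "(\<integral>x. norm (f x) \<partial>M) < e" .
  qed
qed

end

text \<open>For the convex sets below, closedness under bounded almost everywhere convergence replaces
  sequential weak* closedness; it is all that the Krein--Smulian argument needs.\<close>

locale bounded_function_family = finite_measure M for M :: "'a measure" +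
  fixes G :: "('a \<Rightarrow> 'b::euclidean_space) set"
  assumes bdd: "g \<in> G \<Longrightarrow> \<exists>R. bdd_fun R g"
    and combination: "g \<in> G \<Longrightarrow> h \<in> G \<Longrightarrow> 0 \<le> t \<Longrightarrow> t \<le> 1 \<Longrightarrow> (\<lambda>x. (1 - t) *\<^sub>R g x + t *\<^sub>R h x) \<in> G"
    and limit: "(\<And>n. f n \<in> G) \<Longrightarrow> (\<And>n. bdd_fun R (f n)) \<Longrightarrow> g \<in> borel_measurable M \<Longrightarrow>
      AE x in M. (\<lambda>n. f n x) \<longlonglongrightarrow> g x \<Longrightarrow> g \<in> G"
begin

text \<open>Sets of almost minimal elements of \<open>G\<close> shrink in \<open>L\<^sup>2\<close> by the parallelogram law.\<close>

lemma positive_distance: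
  assumes R: "\<And>g. g \<in> G \<Longrightarrow> bdd_fun R g" and r: "\<And>g. g \<in> G \<Longrightarrow> \<not> bdd_fun r g"
  shows "\<exists>\<delta>>0. \<forall>g\<in>G. \<forall>b. bdd_fun r b \<longrightarrow> \<delta> \<le> sqnorm (\<lambda>x. g x - b x)"
proof (rule ccontr)
  assume "\<not> ?thesis"
  then have ex: "\<exists>g\<in>G. \<exists>b. bdd_fun r b \<and> sqnorm (\<lambda>x. g x - b x) < \<delta>" if "\<delta> > 0" for \<delta>
    using that by (meson not_le)
  \<comment> \<open>Elements of \<open>G\<close> whose squared L2 distance to the ball of radius
    \<open>r\<close> is at most \<open>1 / real (Suc k)\<close>: convex, nested, and nonempty by the
    contradiction hypothesis. A common limit point would lie in \<open>G\<close> and in that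
    ball.\<close>
  define T where "T k = {g \<in> G. \<exists>b. bdd_fun r b \<and> sqnorm (\<lambda>x. g x - b x) \<le> 1 / real (Suc k)}" for k
  have Tne: "T k \<noteq> {}" for k
  proof -
    have "0 < 1 / real (Suc k)" by simp
    then obtain g b where "g \<in> G" "bdd_fun r b" "sqnorm (\<lambda>x. g x - b x) < 1 / real (Suc k)"
      using ex by metis
    then have "g \<in> T k" unfolding T_def by (auto intro: less_imp_le)
    then show ?thesis by blast
  qed
  have Tanti: "T m \<subseteq> T k" if "k \<le> m" for k m
  proof -
    have "1 / real (Suc m) \<le> 1 / real (Suc k)" using that by (simp add: frac_le)
    then show ?thesis unfolding T_def by (auto intro: order.trans)
  qed
  have TG: "g \<in> G" if "g \<in> T k" for g k using that by (simp add: T_def)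
  have mid: "(\<lambda>x. (1 / 2) *\<^sub>R g x + (1 / 2) *\<^sub>R h x) \<in> T k" if g: "g \<in> T k" and h: "h \<in> T k" for g h k
  proof -
    obtain b where b: "bdd_fun r b" "sqnorm (\<lambda>x. g x - b x) \<le> 1 / real (Suc k)"
      using g by (auto simp: T_def)
    obtain c where c: "bdd_fun r c" "sqnorm (\<lambda>x. h x - c x) \<le> 1 / real (Suc k)"
      using h by (auto simp: T_def)
    let ?f = "\<lambda>x. g x - b x" and ?h = "\<lambda>x. h x - c x"
    have bf: "bdd_fun (R + r) ?f" "bdd_fun (R + r) ?h"
      by (intro bdd_fun_diff R TG[OF g] TG[OF h] b c)+
    have "0 \<le> sqnorm (\<lambda>x. (1 / 2) *\<^sub>R ?f x + (- 1 / 2) *\<^sub>R ?h x)" by (rule sqnorm_nonneg)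
    then have "sqnorm (\<lambda>x. (1 / 2) *\<^sub>R ?f x + (1 / 2) *\<^sub>R ?h x) \<le> (sqnorm ?f + sqnorm ?h) / 2"
      unfolding sqnorm_combination[OF bf] by (simp add: power2_eq_square)
    also have "\<dots> \<le> 1 / real (Suc k)" using b(2) c(2) by simp
    also have "(\<lambda>x. (1 / 2) *\<^sub>R ?f x + (1 / 2) *\<^sub>R ?h x) =
      (\<lambda>x. ((1 / 2) *\<^sub>R g x + (1 / 2) *\<^sub>R h x) - ((1 / 2) *\<^sub>R b x + (1 / 2) *\<^sub>R c x))"
      by (simp add: algebra_simps)
    finally have "sqnorm (\<lambda>x. ((1 / 2) *\<^sub>R g x + (1 / 2) *\<^sub>R h x) - ((1 / 2) *\<^sub>R b x + (1 / 2) *\<^sub>R c x)) \<le> 1 / real (Suc k)" .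
    moreover have "bdd_fun r (\<lambda>x. (1 / 2) *\<^sub>R b x + (1 / 2) *\<^sub>R c x)"
      using bdd_fun_convex[OF b(1) c(1), of "1 / 2"] by simp
    moreover have "(\<lambda>x. (1 / 2) *\<^sub>R g x + (1 / 2) *\<^sub>R h x) \<in> G"
      using combination[OF TG[OF g] TG[OF h], of "1 / 2"] by simp
    ultimately show ?thesis unfolding T_def by blast
  qed
  \<comment> \<open>Minimal energies over shrinking sets increase and are bounded, so they form a
    Cauchy sequence; this controls the distance between almost minimal elements.\<close>
  define d where "d k = Inf (sqnorm ` T k)" for k
  have bb: "bdd_below (sqnorm ` T k)" for k
    by (rule bdd_belowI[of _ 0]) (auto simp: sqnorm_nonneg)
  have d_le: "d k \<le> sqnorm g" if "g \<in> T k" for g k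
    unfolding d_def by (rule cInf_lower[OF _ bb]) (use that in auto)
  have d_mono: "d k \<le> d m" if "k \<le> m" for k m
    unfolding d_def by (rule cInf_superset_mono) (use Tne bb Tanti[OF that] in auto)
  have d_bound: "d k \<le> R\<^sup>2 * measure M (space M)" for k
  proof -
    obtain g where "g \<in> T k" using Tne by blast
    then show ?thesis using d_le sqnorm_bound[OF R[OF TG]] by (meson order.trans)
  qed
  have "\<exists>l. d \<longlonglongrightarrow> l"
  proof -
    have "incseq d" using d_mono by (simp add: incseq_def)
    then show ?thesis using incseq_convergent[of d] d_bound by metis
  qed
  then have dC: "Cauchy d" by (auto intro: LIMSEQ_imp_Cauchy)
  have "\<exists>g\<in>T k. sqnorm g < d k + 1 / real (Suc k)" for k
  proof -
    have "Inf (sqnorm ` T k) < d k + 1 / real (Suc k)" by (simp add: d_def)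
    then show ?thesis using cInf_lessD[of "sqnorm ` T k"] Tne by blast
  qed
  then obtain g where g: "\<And>k. g k \<in> T k" "\<And>k. sqnorm (g k) < d k + 1 / real (Suc k)" by metis
  have gR: "bdd_fun R (g k)" for k by (rule R[OF TG[OF g(1)]])
  \<comment> \<open>The midpoint of \<open>g k\<close> and \<open>g m\<close> still lies in
    \<open>T k\<close>, so its squared norm is at least \<open>d k\<close>. In the parallelogram
    identity the two minimisation errors appear doubled, which gives
    \<open>4 / real (Suc k)\<close>.\<close>
  have diff: "sqnorm (\<lambda>x. g k x - g m x) \<le> 2 * (d m - d k) + 4 / real (Suc k)" if km: "k \<le> m" for k m
  proof -
    have "d k \<le> sqnorm (\<lambda>x. (1 / 2) *\<^sub>R g k x + (1 / 2) *\<^sub>R g m x)"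
      using g(1)[of m] Tanti[OF km] by (intro d_le mid g) auto
    then have le4: "4 * d k \<le> sqnorm (g k) + 2 * (\<integral>x. g k x \<bullet> g m x \<partial>M) + sqnorm (g m)"
      unfolding sqnorm_combination[OF gR gR] by (simp add: power2_eq_square)
    have eq2: "sqnorm (\<lambda>x. g k x - g m x) = sqnorm (g k) - 2 * (\<integral>x. g k x \<bullet> g m x \<partial>M) + sqnorm (g m)"
      using sqnorm_combination[OF gR gR, of 1 k "-1" m] by simp
    have mk: "1 / real (Suc m) \<le> 1 / real (Suc k)" using km by (simp add: frac_le)
    have "s \<le> 2 * (dm - dk) + 4 / n"
      if "4 * dk \<le> p + 2 * i + q" "s = p - 2 * i + q" "1 / m \<le> 1 / n" "p < dk + 1 / n" "q < dm + 1 / m"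
      for s p q i dk dm m n :: real
    proof -
      have "4 / n = 4 * (1 / n)" by simp
      with that show ?thesis by (smt (verit))
    qed
    note arith = this
    show ?thesis
      by (rule arith[OF le4 eq2 mk g(2) g(2)])
  qed
  have L1C: "\<exists>N. \<forall>i\<ge>N. \<forall>j\<ge>N. (\<integral>x. norm (g i x - g j x) \<partial>M) < e" if e: "e > 0" for e
  proof -
    obtain \<delta> where \<delta>: "\<delta> > 0" and small: "\<And>f :: 'a \<Rightarrow> 'b. \<And>R. bdd_fun R f \<Longrightarrow> sqnorm f < \<delta> \<Longrightarrow> (\<integral>x. norm (f x) \<partial>M) < e"
      using sqnorm_small_L1_small[OF e] by metis
    obtain N1 where N1: "\<And>i j. i \<ge> N1 \<Longrightarrow> j \<ge> N1 \<Longrightarrow> \<bar>d i - d j\<bar> < \<delta> / 4"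
      using CauchyD[OF dC, of "\<delta> / 4"] \<delta> by auto
    obtain N2 where N2: "8 / \<delta> < real N2" using reals_Archimedean2 by blast
    have le: "(\<integral>x. norm (g i x - g j x) \<partial>M) < e" if ij: "max N1 N2 \<le> i" "i \<le> j" for i j
    proof (rule small[OF bdd_fun_diff[OF gR gR]])
      have "8 < \<delta> * real (Suc i)"
      proof -
        have "8 < \<delta> * real N2" using N2 \<delta> by (simp add: field_simps)
        also have "\<dots> \<le> \<delta> * real (Suc i)" using ij \<delta> by (intro mult_left_mono) auto
        finally show ?thesis .
      qed
      then have "4 / real (Suc i) < \<delta> / 2" by (simp add: field_simps)
      moreover have "\<bar>d j - d i\<bar> < \<delta> / 4" using N1[of j i] ij by auto
      then have "2 * (d j - d i) < \<delta> / 2" unfolding right_diff_distrib by linarith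
      ultimately show "sqnorm (\<lambda>x. g i x - g j x) < \<delta>" using diff[OF ij(2)] by linarith
    qed
    have "(\<integral>x. norm (g i x - g j x) \<partial>M) < e" if "max N1 N2 \<le> i" "max N1 N2 \<le> j" for i j
      using le[of i j] le[of j i] that by (cases "i \<le> j") (auto simp: norm_minus_commute)
    then show ?thesis by blast
  qed
  obtain \<rho> where \<rho>: "strict_mono \<rho>" and C: "AE x in M. Cauchy (\<lambda>i. g (\<rho> i) x)"
    using cauchy_L1_AE_cauchy_subseq[of M g] L1C bdd_fun_integrable[OF gR] by metis
  have [measurable]: "g k \<in> borel_measurable M" for k using gR[of k] by (simp add: bdd_fun_def)
  define g' where "g' x = lim (\<lambda>i. g (\<rho> i) x)" for x
  have g'm[measurable]: "g' \<in> borel_measurable M" unfolding g'_def by (rule borel_measurable_lim_metric) measurable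
  have lim: "AE x in M. (\<lambda>i. g (\<rho> i) x) \<longlonglongrightarrow> g' x"
    using C by eventually_elim (simp add: g'_def Cauchy_convergent_iff convergent_LIMSEQ_iff)
  have g'G: "g' \<in> G"
    by (rule limit[of "\<lambda>i. g (\<rho> i)" R, OF TG[OF g(1)] gR g'm lim])
  have "\<forall>k. \<exists>b. bdd_fun r b \<and> sqnorm (\<lambda>x. g k x - b x) \<le> 1 / real (Suc k)"
    using g(1) by (simp add: T_def)
  from choice[OF this] obtain b
    where "\<forall>k. bdd_fun r (b k) \<and> sqnorm (\<lambda>x. g k x - b k x) \<le> 1 / real (Suc k)" ..
  then have b: "\<And>k. bdd_fun r (b k)" "\<And>k. sqnorm (\<lambda>x. g k x - b k x) \<le> 1 / real (Suc k)"
    by simp_all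
  have L1: "(\<lambda>i. \<integral>x. norm (g (\<rho> i) x - b (\<rho> i) x) \<partial>M) \<longlonglongrightarrow> 0"
  proof (rule LIMSEQ_I)
    fix e :: real assume "e > 0"
    obtain \<delta> where \<delta>: "\<delta> > 0" and small: "\<And>f :: 'a \<Rightarrow> 'b. \<And>R. bdd_fun R f \<Longrightarrow> sqnorm f < \<delta> \<Longrightarrow> (\<integral>x. norm (f x) \<partial>M) < e"
      using sqnorm_small_L1_small[OF \<open>e > 0\<close>] by metis
    obtain N where N: "1 / \<delta> < real N" using reals_Archimedean2 by blast
    show "\<exists>N. \<forall>i\<ge>N. norm ((\<integral>x. norm (g (\<rho> i) x - b (\<rho> i) x) \<partial>M) - 0) < e"
    proof (intro exI[of _ N] allI impI)
      fix i assume "N \<le> i"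
      have "N \<le> \<rho> i" using seq_suble[OF \<rho>, of i] \<open>N \<le> i\<close> by linarith
      then have "1 < \<delta> * real (Suc (\<rho> i))"
      proof -
        have "1 < \<delta> * real N" using N \<delta> by (simp add: field_simps)
        also have "\<dots> \<le> \<delta> * real (Suc (\<rho> i))" using \<open>N \<le> \<rho> i\<close> \<delta> by (intro mult_left_mono) auto
        finally show ?thesis .
      qed
      then have "1 / real (Suc (\<rho> i)) < \<delta>" by (simp add: field_simps)
      then have "sqnorm (\<lambda>x. g (\<rho> i) x - b (\<rho> i) x) < \<delta>" using b(2)[of "\<rho> i"] by linarith
      then have "(\<integral>x. norm (g (\<rho> i) x - b (\<rho> i) x) \<partial>M) < e"
        by (rule small[OF bdd_fun_diff[OF gR b(1)]])
      then show "norm ((\<integral>x. norm (g (\<rho> i) x - b (\<rho> i) x) \<partial>M) - 0) < e" by simp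
    qed
  qed
  \<comment> \<open>Along a further subsequence the functions \<open>b\<close> from the ball
    converge almost everywhere to the same limit as \<open>g\<close>; the norm bound
    \<open>r\<close> passes to this limit, which also belongs to \<open>G\<close>.\<close>
  obtain \<sigma> where \<sigma>: "strict_mono \<sigma>" and gb: "AE x in M. (\<lambda>i. g (\<rho> (\<sigma> i)) x - b (\<rho> (\<sigma> i)) x) \<longlonglongrightarrow> 0"
    using tendsto_L1_AE_subseq[OF bdd_fun_integrable[OF bdd_fun_diff[OF gR b(1)]] L1] by blast
  have "AE x in M. \<forall>k. norm (b k x) \<le> r"
    unfolding AE_all_countable using b(1) by (auto simp: bdd_fun_def)
  then have "AE x in M. norm (g' x) \<le> r"
    using gb lim
  proof eventually_elim
    case (elim x)
    have "(\<lambda>i. g (\<rho> (\<sigma> i)) x) \<longlonglongrightarrow> g' x"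
      using LIMSEQ_subseq_LIMSEQ[OF elim(3) \<sigma>] by (simp add: o_def)
    from tendsto_diff[OF this elim(2)] have "(\<lambda>i. b (\<rho> (\<sigma> i)) x) \<longlonglongrightarrow> g' x" by simp
    from tendsto_norm[OF this] show ?case
      by (rule LIMSEQ_le_const2) (use elim(1) in auto)
  qed
  then have "bdd_fun r g'" by (simp add: bdd_fun_def)
  then show False using r[OF g'G] by simp
qed

text \<open>Projection argument in L2: an exact minimiser of the norm on the difference set would
  have inner product at least \<open>\<iota>\<close> with every element, and a near minimiser still
  achieves \<open>\<iota> / 2\<close>. Bounded functions being integrable, the L2 functional is also
  one given by an L1 function.\<close>

lemma separation:
  assumes R: "\<And>g. g \<in> G \<Longrightarrow> bdd_fun R g" and r: "\<And>g. g \<in> G \<Longrightarrow> \<not> bdd_fun r g" and r0: "0 \<le> r"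
  shows "\<exists>x. integrable M x \<and> r * (\<integral>y. norm (x y) \<partial>M) \<le> 2 \<and> (\<forall>g\<in>G. 2 \<le> (\<integral>y. g y \<bullet> x y \<partial>M))"
proof (cases "G = {}")
  case True
  then show ?thesis by (intro exI[of _ "\<lambda>_. 0"]) auto
next
  case False
  obtain \<delta> where \<delta>: "\<delta> > 0" "\<And>g b. g \<in> G \<Longrightarrow> bdd_fun r b \<Longrightarrow> \<delta> \<le> sqnorm (\<lambda>x. g x - b x)"
    using positive_distance[OF R r] by metis
  \<comment> \<open>Separating \<open>G\<close> from the ball of radius \<open>r\<close> means
    separating the difference set from 0; the positive distance makes the infimum of squared norms
    on it positive.\<close>
  define D where "D = {\<lambda>x. g x - b x | g b. g \<in> G \<and> bdd_fun r b}"
  have bdd0: "bdd_fun r (\<lambda>_. 0 :: 'b)" using r0 by (simp add: bdd_fun_def)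
  have Dne: "D \<noteq> {}" using False bdd0 unfolding D_def by blast
  have DB: "bdd_fun (R + r) d" if "d \<in> D" for d
    using that bdd_fun_diff R unfolding D_def by blast
  have Dc: "(\<lambda>x. (1 - t) *\<^sub>R d x + t *\<^sub>R d' x) \<in> D" if dd: "d \<in> D" "d' \<in> D" and t: "0 \<le> t" "t \<le> 1" for d d' t
  proof -
    obtain g b where d: "d = (\<lambda>x. g x - b x)" "g \<in> G" "bdd_fun r b" using dd(1) unfolding D_def by blast
    obtain g' b' where d': "d' = (\<lambda>x. g' x - b' x)" "g' \<in> G" "bdd_fun r b'" using dd(2) unfolding D_def by blast
    have "(\<lambda>x. (1 - t) *\<^sub>R d x + t *\<^sub>R d' x) =
        (\<lambda>x. ((1 - t) *\<^sub>R g x + t *\<^sub>R g' x) - ((1 - t) *\<^sub>R b x + t *\<^sub>R b' x))"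
      unfolding d(1) d'(1) by (simp add: scaleR_diff_right add_diff_add)
    then show ?thesis
      unfolding D_def mem_Collect_eq
      by (intro exI[of _ "\<lambda>x. (1 - t) *\<^sub>R g x + t *\<^sub>R g' x"] exI[of _ "\<lambda>x. (1 - t) *\<^sub>R b x + t *\<^sub>R b' x"]
          conjI combination[OF d(2) d'(2) t] bdd_fun_convex[OF d(3) d'(3) t])
  qed
  define \<iota> where "\<iota> = Inf (sqnorm ` D)"
  have bb: "bdd_below (sqnorm ` D)"
    by (rule bdd_belowI[of _ 0]) (auto simp: sqnorm_nonneg)
  have \<iota>_le: "\<iota> \<le> sqnorm d" if "d \<in> D" for d
    unfolding \<iota>_def by (rule cInf_lower[OF _ bb]) (use that in auto)
  have "\<delta> \<le> \<iota>"
    unfolding \<iota>_def by (rule cInf_greatest) (use Dne \<delta>(2) in \<open>auto simp: D_def\<close>)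
  then have \<iota>: "0 < \<iota>" using \<delta>(1) by linarith
  define B where "B = ((R + r) + (R + r))\<^sup>2 * measure M (space M)"
  have B: "0 \<le> B" by (simp add: B_def)
  \<comment> \<open>\<open>B\<close> bounds the squared distance of two elements of
    \<open>D\<close>. Comparing the near minimiser with the point at parameter \<open>t\<close> on a
    segment costs \<open>t * (1 + B)\<close>, at most \<open>\<iota>\<close> here. The minimisation
    error is taken as \<open>t\<^sup>2\<close> so that a factor \<open>t\<close> cancels.\<close>
  define t where "t = min 1 (\<iota> / (1 + B))"
  have t: "0 < t" "t \<le> 1" using \<iota> B by (auto simp: t_def)
  have tB: "t * (1 + B) \<le> \<iota>"
  proof -
    have "t * (1 + B) \<le> (\<iota> / (1 + B)) * (1 + B)"
      using B by (intro mult_right_mono) (auto simp: t_def)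
    then show ?thesis using B by simp
  qed
  have "Inf (sqnorm ` D) < \<iota> + t\<^sup>2" using t by (simp add: \<iota>_def)
  then obtain z where z: "z \<in> D" "sqnorm z < \<iota> + t\<^sup>2"
    using cInf_lessD[of "sqnorm ` D"] Dne by blast
  have near: "\<iota> / 2 \<le> (\<integral>x. z x \<bullet> d x \<partial>M)" if d: "d \<in> D" for d
  proof -
    let ?I = "\<integral>x. z x \<bullet> d x \<partial>M"
    have "\<iota> \<le> (1 - t)\<^sup>2 * sqnorm z + 2 * (1 - t) * t * ?I + t\<^sup>2 * sqnorm d"
      using \<iota>_le[OF Dc[OF z(1) d, of t]] t unfolding sqnorm_combination[OF DB[OF z(1)] DB[OF d]] by simp
    also have "\<dots> = sqnorm z + 2 * t * (?I - sqnorm z) + t\<^sup>2 * (sqnorm z - 2 * ?I + sqnorm d)"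
      by (simp add: power2_eq_square algebra_simps)
    finally have 1: "\<iota> \<le> sqnorm z + 2 * t * (?I - sqnorm z) + t\<^sup>2 * (sqnorm z - 2 * ?I + sqnorm d)" .
    have "sqnorm z - 2 * ?I + sqnorm d = sqnorm (\<lambda>x. z x - d x)"
      using sqnorm_combination[OF DB[OF z(1)] DB[OF d], of 1 "-1"] by simp
    also have "\<dots> \<le> B"
      unfolding B_def by (rule sqnorm_bound[OF bdd_fun_diff[OF DB[OF z(1)] DB[OF d]]])
    finally have "t\<^sup>2 * (sqnorm z - 2 * ?I + sqnorm d) \<le> t\<^sup>2 * B" by (rule mult_left_mono) simp
    moreover have "2 * t * \<iota> \<le> 2 * t * sqnorm z" using \<iota>_le[OF z(1)] t by simp
    ultimately have "2 * t * \<iota> \<le> t\<^sup>2 + 2 * t * ?I + t\<^sup>2 * B"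
      using 1 z(2) by (simp add: right_diff_distrib)
    then have "t * (2 * \<iota>) \<le> t * (t * (1 + B) + 2 * ?I)"
      by (simp add: power2_eq_square algebra_simps)
    then have "2 * \<iota> \<le> t * (1 + B) + 2 * ?I" using t by simp
    then show ?thesis using tB by linarith
  qed
  note zB = DB[OF z(1)] and zi = bdd_fun_integrable[OF DB[OF z(1)]]
  have [measurable]: "z \<in> borel_measurable M" using zB by (rule bdd_fun_meas)
  \<comment> \<open>The extremal element for L\<infinity>-L1 duality: it attains the supremum
    \<open>r * (\<integral>x. norm (z x) \<partial>M)\<close> of the pairing with \<open>z\<close>
    over the ball, so the worst case over the ball is subtracted.\<close>
  define b where "b x = r *\<^sub>R sgn (z x)" for x
  have b: "bdd_fun r b"
    unfolding bdd_fun_def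
  proof
    show "b \<in> borel_measurable M" unfolding b_def sgn_div_norm by measurable
    show "AE x in M. norm (b x) \<le> r" using r0 by (simp add: b_def norm_sgn)
  qed
  have bz: "(\<integral>x. z x \<bullet> b x \<partial>M) = r * (\<integral>x. norm (z x) \<partial>M)"
  proof -
    have "z x \<bullet> b x = r * norm (z x)" for x
      by (cases "z x = 0") (auto simp: b_def sgn_div_norm power2_eq_square simp flip: power2_norm_eq_inner)
    then show ?thesis by simp
  qed
  \<comment> \<open>The level reached on \<open>G\<close>; it dominates \<open>r\<close> times the
    L1 norm of \<open>z\<close>, so scaling by \<open>2 / \<kappa>\<close> gives level 2 and the
    norm bound at once.\<close>
  define \<kappa> where "\<kappa> = \<iota> / 2 + r * (\<integral>x. norm (z x) \<partial>M)"
  have rz: "0 \<le> r * (\<integral>x. norm (z x) \<partial>M)" using r0 by simp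
  then have \<kappa>: "0 < \<kappa>" using \<iota> by (simp add: \<kappa>_def)
  have gz: "\<kappa> \<le> (\<integral>x. g x \<bullet> z x \<partial>M)" if g: "g \<in> G" for g
  proof -
    have "(\<lambda>x. g x - b x) \<in> D" using g b unfolding D_def by blast
    from near[OF this] have "\<iota> / 2 \<le> (\<integral>x. z x \<bullet> g x - z x \<bullet> b x \<partial>M)"
      by (simp add: inner_diff_right)
    also have "\<dots> = (\<integral>x. z x \<bullet> g x \<partial>M) - (\<integral>x. z x \<bullet> b x \<partial>M)"
      by (intro Bochner_Integration.integral_diff bdd_fun_inner[OF zB] bdd_fun_integrable[OF R[OF g]] bdd_fun_integrable[OF b])
    finally have "\<iota> / 2 \<le> (\<integral>x. z x \<bullet> g x \<partial>M) - r * (\<integral>x. norm (z x) \<partial>M)"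
      by (simp only: bz)
    moreover have "(\<integral>x. z x \<bullet> g x \<partial>M) = (\<integral>x. g x \<bullet> z x \<partial>M)"
      by (intro Bochner_Integration.integral_cong) (auto simp: inner_commute)
    ultimately show ?thesis by (simp add: \<kappa>_def)
  qed
  show ?thesis
  proof (intro exI[of _ "\<lambda>x. (2 / \<kappa>) *\<^sub>R z x"] conjI ballI)
    show "integrable M (\<lambda>x. (2 / \<kappa>) *\<^sub>R z x)" using zi by simp
    have "r * (\<integral>y. norm ((2 / \<kappa>) *\<^sub>R z y) \<partial>M) = (2 / \<kappa>) * (r * (\<integral>x. norm (z x) \<partial>M))"
      using \<kappa> by simp
    also have "\<dots> \<le> (2 / \<kappa>) * \<kappa>" using \<kappa> \<iota> by (intro mult_left_mono) (auto simp: \<kappa>_def)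
    also have "\<dots> = 2" using \<kappa> by simp
    finally show "r * (\<integral>y. norm ((2 / \<kappa>) *\<^sub>R z y) \<partial>M) \<le> 2" .
    fix g assume "g \<in> G"
    have "(2 / \<kappa>) * \<kappa> \<le> (2 / \<kappa>) * (\<integral>x. g x \<bullet> z x \<partial>M)"
      using gz[OF \<open>g \<in> G\<close>] \<kappa> by (intro mult_left_mono) auto
    then show "2 \<le> (\<integral>y. g y \<bullet> ((2 / \<kappa>) *\<^sub>R z y) \<partial>M)" using \<kappa> by simp
  qed
qed

text \<open>\<open>S\<close> collects the elements of the ball of radius \<open>Suc n\<close> that
  \<open>h\<close> fails to lift above \<open>c'\<close>. It misses the ball of radius
  \<open>n\<close>, where \<open>h\<close> reaches \<open>c > c'\<close>, so
  \<open>separation\<close> yields an \<open>x\<close> that is small in L1 and at least 2 on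
  \<open>S\<close>. Mixing \<open>h\<close> and \<open>x\<close> then handles the larger
  ball.\<close>

lemma enlarge_separation:
  fixes n :: nat
  assumes h: "integrable M h" "\<forall>g\<in>G. bdd_fun (real n) g \<longrightarrow> c \<le> (\<integral>y. g y \<bullet> h y \<partial>M)"
    and c: "c' < c" "c' \<le> 2"
  shows "\<exists>x l. integrable M x \<and> real n * (\<integral>y. norm (x y) \<partial>M) \<le> 2 \<and> 0 \<le> l \<and> l \<le> 1 \<and>
    (\<forall>g\<in>G. bdd_fun (real (Suc n)) g \<longrightarrow> c' \<le> (\<integral>y. g y \<bullet> (l *\<^sub>R h y + (1 - l) *\<^sub>R x y) \<partial>M))"
proof -
  define E where "E = {g \<in> G. bdd_fun (real (Suc n)) g}"
  define S where "S = {g \<in> E. (\<integral>y. g y \<bullet> h y \<partial>M) \<le> c'}"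
  have E_comb: "(\<lambda>x. (1 - t) *\<^sub>R f x + t *\<^sub>R g x) \<in> E" if "f \<in> E" "g \<in> E" "0 \<le> t" "t \<le> 1" for f g t
    using that combination[of f g t] bdd_fun_convex[of "real (Suc n)" f g t] unfolding E_def by (simp del: of_nat_Suc)
  have int_comb: "(\<integral>y. ((1 - t) *\<^sub>R f y + t *\<^sub>R g y) \<bullet> k y \<partial>M) = (1 - t) * (\<integral>y. f y \<bullet> k y \<partial>M) + t * (\<integral>y. g y \<bullet> k y \<partial>M)"
    if "f \<in> E" "g \<in> E" "integrable M k" for f g t k
  proof -
    have "integrable M (\<lambda>y. f y \<bullet> k y)" "integrable M (\<lambda>y. g y \<bullet> k y)"
      using that bdd_fun_inner unfolding E_def by blast+
    then show ?thesis by (simp add: inner_add_left)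
  qed
  interpret S: bounded_function_family M S
  proof
    show "\<exists>R. bdd_fun R g" if "g \<in> S" for g using that by (auto simp: S_def E_def)
    show "(\<lambda>x. (1 - t) *\<^sub>R f x + t *\<^sub>R g x) \<in> S" if fg: "f \<in> S" "g \<in> S" and t: "0 \<le> t" "t \<le> 1" for f g t
    proof -
      have "(1 - t) * (\<integral>y. f y \<bullet> h y \<partial>M) + t * (\<integral>y. g y \<bullet> h y \<partial>M) \<le> (1 - t) * c' + t * c'"
        using fg t by (intro add_mono mult_left_mono) (auto simp: S_def)
      also have "(1 - t) * c' + t * c' = c'" by (simp add: algebra_simps)
      finally show ?thesis
        using fg t int_comb[OF _ _ h(1)] E_comb by (simp add: S_def)
    qed
    show "g \<in> S" if f: "\<And>n. f n \<in> S" and R: "\<And>n. bdd_fun R (f n)" and g: "g \<in> borel_measurable M"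
      and lim: "AE x in M. (\<lambda>n. f n x) \<longlonglongrightarrow> g x" for f R g
    proof -
      have fE: "f k \<in> E" for k using f[of k] by (simp add: S_def)
      then have fb: "bdd_fun (real (Suc n)) (f k)" for k by (simp add: E_def)
      have "g \<in> G" by (rule limit[of f R, OF _ R g lim]) (use fE in \<open>simp add: E_def\<close>)
      moreover have "bdd_fun (real (Suc n)) g" by (rule bdd_fun_limit(1)[OF fb g lim])
      moreover have "(\<integral>y. g y \<bullet> h y \<partial>M) \<le> c'"
        using bdd_fun_limit(2)[OF fb g lim h(1)] by (rule LIMSEQ_le_const2) (use f in \<open>auto simp: S_def\<close>)
      ultimately show ?thesis by (simp add: S_def E_def)
    qed
  qed
  have SR: "bdd_fun (real (Suc n)) g" if "g \<in> S" for g
    using that by (simp add: S_def E_def)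
  have Sr: "\<not> bdd_fun (real n) g" if "g \<in> S" for g
    using bspec[OF h(2), of g] that c(1) by (auto simp: S_def E_def)
  obtain x where x: "integrable M x" "real n * (\<integral>y. norm (x y) \<partial>M) \<le> 2"
    "\<And>g. g \<in> S \<Longrightarrow> 2 \<le> (\<integral>y. g y \<bullet> x y \<partial>M)"
    using S.separation[OF SR Sr] by auto
  \<comment> \<open>Off \<open>S\<close> the old functional exceeds \<open>c'\<close>, on
    \<open>S\<close> the new one is at least 2 and hence at least \<open>c'\<close>: exactly the
    alternative of the minimax lemma.\<close>
  have "\<exists>l. 0 \<le> l \<and> l \<le> 1 \<and> (\<forall>g\<in>E. 0 \<le> l * ((\<integral>y. g y \<bullet> h y \<partial>M) - c') + (1 - l) * ((\<integral>y. g y \<bullet> x y \<partial>M) - c'))"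
  proof (rule two_function_minimax[where comb="\<lambda>t f g x. (1 - t) *\<^sub>R f x + t *\<^sub>R g x"])
    show "0 \<le> (\<integral>y. g y \<bullet> h y \<partial>M) - c' \<or> 0 \<le> (\<integral>y. g y \<bullet> x y \<partial>M) - c'" if "g \<in> E" for g
      using x(3)[of g] c(2) that by (force simp: S_def)
  qed (use E_comb int_comb h(1) x(1) in \<open>auto simp: algebra_simps\<close>)
  then obtain l where l: "0 \<le> l" "l \<le> 1"
    "\<And>g. g \<in> E \<Longrightarrow> 0 \<le> l * ((\<integral>y. g y \<bullet> h y \<partial>M) - c') + (1 - l) * ((\<integral>y. g y \<bullet> x y \<partial>M) - c')" by blast
  have "c' \<le> (\<integral>y. g y \<bullet> (l *\<^sub>R h y + (1 - l) *\<^sub>R x y) \<partial>M)" if g: "g \<in> G" "bdd_fun (real (Suc n)) g" for g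
  proof -
    have "(\<integral>y. g y \<bullet> (l *\<^sub>R h y + (1 - l) *\<^sub>R x y) \<partial>M) = l * (\<integral>y. g y \<bullet> h y \<partial>M) + (1 - l) * (\<integral>y. g y \<bullet> x y \<partial>M)"
      using bdd_fun_inner[OF g(2) h(1)] bdd_fun_inner[OF g(2) x(1)] by (simp add: inner_add_right)
    then show ?thesis using l(3)[of g] g by (simp add: E_def algebra_simps)
  qed
  with x l show ?thesis by blast
qed

text \<open>The functional is a limit of convex combinations \<open>h n = (\<Sum>k<n. a n k *\<^sub>R x k)\<close>, where \<open>h n\<close>
  separates the part of \<open>G\<close> bounded by \<open>n\<close> from \<open>0\<close>. Each weight \<open>a n k\<close> decreases in \<open>n\<close> and hence
  converges, and the mass lost in the limit is harmless because \<open>x k \<rightarrow> 0\<close> in \<open>L\<^sup>1\<close>.\<close>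

theorem weak_star_separation:
  assumes 0: "(\<lambda>_. 0) \<notin> G"
  shows "\<exists>h. integrable M h \<and> (\<forall>g\<in>G. 1 \<le> (\<integral>y. g y \<bullet> h y \<partial>M))"
proof -
  \<comment> \<open>The levels descend strictly from 2 towards 1: each enlargement costs a strict
    loss, level 2 of \<open>separation\<close> is never exceeded, and at least 1 survives.\<close>
  define c where "c n = 1 + 1 / real (Suc n)" for n
  have c: "c (Suc n) < c n" "c (Suc n) \<le> 2" "1 \<le> c n" for n
    by (simp_all add: c_def field_simps)
  define P where "P n h \<longleftrightarrow> integrable M h \<and> (\<forall>g\<in>G. bdd_fun (real n) g \<longrightarrow> c n \<le> (\<integral>y. g y \<bullet> h y \<partial>M))" for n h
  define Q where "Q n h h' \<longleftrightarrow> (\<exists>x l. integrable M x \<and> real n * (\<integral>y. norm (x y) \<partial>M) \<le> 2 \<and> 0 \<le> l \<and> l \<le> 1 \<and>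
      h' = (\<lambda>y. l *\<^sub>R h y + (1 - l) *\<^sub>R x y))" for n :: nat and h h' :: "'a \<Rightarrow> 'b"
  have "\<exists>h. \<forall>n. (P n (h n) \<and> (n = 0 \<longrightarrow> h n = (\<lambda>_. 0))) \<and> Q n (h n) (h (Suc n))"
  proof (rule dependent_nat_choice)
    \<comment> \<open>Radius 0 is vacuous: a member of \<open>G\<close> that vanishes almost
      everywhere would, as a constant sequence converging almost everywhere to 0, put the zero
      function into \<open>G\<close>. Hence the start \<open>h 0 = 0\<close>.\<close>
    have "\<not> bdd_fun 0 g" if g: "g \<in> G" for g
    proof
      assume g0: "bdd_fun 0 g"
      then have "AE x in M. norm (g x) \<le> 0" by (simp add: bdd_fun_def)
      then have "AE x in M. (\<lambda>n::nat. g x) \<longlonglongrightarrow> 0" by eventually_elim simp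
      then have "(\<lambda>_. 0) \<in> G" by (rule limit[of "\<lambda>_. g" 0 "\<lambda>_. 0", OF g g0, rotated]) simp
      then show False using 0 by simp
    qed
    then show "\<exists>h. P 0 h \<and> (0 = 0 \<longrightarrow> h = (\<lambda>_. 0))"
      by (intro exI[of _ "\<lambda>_. 0"]) (simp add: P_def)
    fix h n assume "P n h \<and> (n = 0 \<longrightarrow> h = (\<lambda>_. 0))"
    then have P: "integrable M h" "\<forall>g\<in>G. bdd_fun (real n) g \<longrightarrow> c n \<le> (\<integral>y. g y \<bullet> h y \<partial>M)"
      by (simp_all add: P_def)
    obtain x l where x: "integrable M x" "real n * (\<integral>y. norm (x y) \<partial>M) \<le> 2" "0 \<le> l" "l \<le> 1"
      "\<forall>g\<in>G. bdd_fun (real (Suc n)) g \<longrightarrow> c (Suc n) \<le> (\<integral>y. g y \<bullet> (l *\<^sub>R h y + (1 - l) *\<^sub>R x y) \<partial>M)"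
      using enlarge_separation[OF P c(1,2)] by (elim exE conjE) (rule that)
    show "\<exists>h'. (P (Suc n) h' \<and> (Suc n = 0 \<longrightarrow> h' = (\<lambda>_. 0))) \<and> Q n h h'"
    proof (intro exI[of _ "\<lambda>y. l *\<^sub>R h y + (1 - l) *\<^sub>R x y"] conjI)
      show "P (Suc n) (\<lambda>y. l *\<^sub>R h y + (1 - l) *\<^sub>R x y)"
        unfolding P_def using x(5) P(1) x(1) by auto
      show "Q n h (\<lambda>y. l *\<^sub>R h y + (1 - l) *\<^sub>R x y)"
        unfolding Q_def using x(1-4) by blast
    qed simp
  qed
  then obtain h where hP: "\<And>n. P n (h n)" and h0: "h 0 = (\<lambda>_. 0)" and hQ: "\<And>n. Q n (h n) (h (Suc n))"
    by blast
  have "\<forall>n. \<exists>x l. integrable M x \<and> real n * (\<integral>y. norm (x y) \<partial>M) \<le> 2 \<and> 0 \<le> l \<and> l \<le> 1 \<and>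
      h (Suc n) = (\<lambda>y. l *\<^sub>R h n y + (1 - l) *\<^sub>R x y)"
    using hQ unfolding Q_def by simp
  from choice[OF this] obtain x where "\<forall>n. \<exists>l. integrable M (x n) \<and> real n * (\<integral>y. norm (x n y) \<partial>M) \<le> 2 \<and>
      0 \<le> l \<and> l \<le> 1 \<and> h (Suc n) = (\<lambda>y. l *\<^sub>R h n y + (1 - l) *\<^sub>R x n y)" ..
  from choice[OF this] obtain l where xl: "\<forall>n. integrable M (x n) \<and> real n * (\<integral>y. norm (x n y) \<partial>M) \<le> 2 \<and>
      0 \<le> l n \<and> l n \<le> 1 \<and> h (Suc n) = (\<lambda>y. l n *\<^sub>R h n y + (1 - l n) *\<^sub>R x n y)" ..
  then have x: "\<And>n. integrable M (x n)" "\<And>n. real n * (\<integral>y. norm (x n y) \<partial>M) \<le> 2"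
    and l: "\<And>n. 0 \<le> l n" "\<And>n. l n \<le> (1::real)"
    and hS: "\<And>n. h (Suc n) = (\<lambda>y. l n *\<^sub>R h n y + (1 - l n) *\<^sub>R x n y)"
    by simp_all
  \<comment> \<open>Unfolds the recursion for \<open>h\<close>: \<open>x n\<close> enters with
    weight \<open>1 - l n\<close>, and each later step multiplies it by the current
    \<open>l\<close>. The total may fall short of 1 because \<open>h 0\<close> is zero.\<close>
  define a where "a = rec_nat (\<lambda>k::nat. 0::real) (\<lambda>n f k. if k = n then 1 - l n else l n * f k)"
  have a0: "a 0 k = 0" and aS: "a (Suc n) k = (if k = n then 1 - l n else l n * a n k)" for n k
    by (simp_all add: a_def)
  have a_nonneg: "0 \<le> a n k" for n k
    by (induction n) (auto simp: a0 aS l)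
  have ha: "h n y = (\<Sum>k<n. a n k *\<^sub>R x k y)" for n y
  proof (induction n)
    case (Suc n)
    have "(\<Sum>k<n. a (Suc n) k *\<^sub>R x k y) = (\<Sum>k<n. l n *\<^sub>R (a n k *\<^sub>R x k y))"
      by (intro sum.cong) (auto simp: aS)
    then show ?case by (simp add: hS Suc aS scaleR_sum_right)
  qed (simp add: h0)
  have a_sum: "(\<Sum>k<n. a n k) \<le> 1" for n
  proof (induction n)
    case (Suc n)
    have "(\<Sum>k<n. a (Suc n) k) = l n * (\<Sum>k<n. a n k)"
      by (simp add: aS sum_distrib_left)
    also have "\<dots> \<le> l n * 1" using Suc l by (intro mult_left_mono) auto
    finally show ?case by (simp add: aS)
  qed simp
  have a_decr: "a (Suc n) k \<le> a n k" if "k < n" for n k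
    using that l a_nonneg[of n k] by (simp add: aS mult_left_le_one_le)
  have "\<exists>A. (\<lambda>n. a n k) \<longlonglongrightarrow> A" for k
  proof -
    have "decseq (\<lambda>n. a (n + Suc k) k)"
      by (rule decseq_SucI) (use a_decr[of k] in auto)
    then obtain A where "(\<lambda>n. a (n + Suc k) k) \<longlonglongrightarrow> A"
      using decseq_convergent[of _ 0] a_nonneg by metis
    then have "(\<lambda>n. a n k) \<longlonglongrightarrow> A" by (rule LIMSEQ_offset)
    then show ?thesis ..
  qed
  then obtain A where A: "\<And>k. (\<lambda>n. a n k) \<longlonglongrightarrow> A k" by metis
  have A_nonneg: "0 \<le> A k" for k
    by (rule LIMSEQ_le_const[OF A]) (use a_nonneg in auto)
  have part_le: "(\<Sum>k<K. a n k) \<le> 1" if "K \<le> n" for K n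
  proof -
    have "(\<Sum>k<K. a n k) \<le> (\<Sum>k<n. a n k)"
      using that a_nonneg by (intro sum_mono2) auto
    then show ?thesis using a_sum[of n] by linarith
  qed
  have A_sum: "(\<Sum>k<K. A k) \<le> 1" for K
    by (rule LIMSEQ_le_const2[OF tendsto_sum[OF A]]) (use part_le in auto)
  have A_summable: "summable A"
    using A_sum A_nonneg by (intro summableI_nonneg_bounded[of _ 1]) auto
  define X where "X k = (\<integral>y. norm (x k y) \<partial>M)" for k
  have X_nonneg: "0 \<le> X k" for k by (simp add: X_def)
  have AX: "summable (\<lambda>k. A k * X k)"
  \<comment> \<open>The comparison starts at index 1, since \<open>real k * X k \<le> 2\<close> says
    nothing about \<open>X 0\<close>.\<close>
  proof (rule summable_comparison_test'[of "\<lambda>k. A k * 2" 1])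
    show "summable (\<lambda>k. A k * 2)" using A_summable by (rule summable_mult2)
    fix k :: nat assume "1 \<le> k"
    then have "1 * X k \<le> real k * X k" using X_nonneg by (intro mult_right_mono) auto
    then have "X k \<le> 2" using x(2)[of k] by (simp add: X_def)
    then show "norm (A k * X k) \<le> A k * 2"
      using A_nonneg X_nonneg by (simp add: abs_mult mult_left_mono)
  qed
  define f where "f k y = A k *\<^sub>R x k y" for k y
  have f: "integrable M (f k)" for k using x(1)[of k] by (simp add: f_def[abs_def])
  have fX: "(\<integral>y. norm (f k y) \<partial>M) = A k * X k" for k
    using A_nonneg by (simp add: f_def X_def)
  have AEsum: "AE y in M. summable (\<lambda>k. norm (f k y))"
  proof -
    have "(\<integral>\<^sup>+y. (\<Sum>k. ennreal (norm (f k y))) \<partial>M) = (\<Sum>k. \<integral>\<^sup>+y. ennreal (norm (f k y)) \<partial>M)"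
      using borel_measurable_integrable[OF f] by (intro nn_integral_suminf) auto
    also have "\<dots> = (\<Sum>k. ennreal (A k * X k))"
      using f by (simp add: nn_integral_eq_integral fX)
    also have "\<dots> = ennreal (\<Sum>k. A k * X k)"
      using A_nonneg X_nonneg AX by (intro suminf_ennreal2) auto
    finally have "(\<integral>\<^sup>+y. (\<Sum>k. ennreal (norm (f k y))) \<partial>M) \<noteq> \<infinity>" by simp
    then have "AE y in M. (\<Sum>k. ennreal (norm (f k y))) \<noteq> \<infinity>"
      using borel_measurable_integrable[OF f] by (intro nn_integral_PInf_AE) auto
    then show ?thesis
      by eventually_elim (auto intro!: summable_suminf_not_top)
  qed
  define H where "H y = (\<Sum>k. f k y)" for y
  have Hi: "integrable M H"
    unfolding H_def by (rule integrable_suminf[OF f AEsum]) (simp add: fX AX)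
  have "1 \<le> (\<integral>y. g y \<bullet> H y \<partial>M)" if g: "g \<in> G" for g
  proof -
    obtain R0 where "bdd_fun R0 g" using bdd[OF g] by blast
    then have gb: "bdd_fun (max R0 0) g" unfolding bdd_fun_def by (auto elim!: eventually_mono)
    define R where "R = max R0 0"
    have R: "0 \<le> R" "bdd_fun R g" using gb by (auto simp: R_def)
    define y where "y k = (\<integral>z. g z \<bullet> x k z \<partial>M)" for k
    have yX: "\<bar>y k\<bar> \<le> R * X k" for k
      unfolding y_def X_def by (rule bdd_fun_inner_bound[OF R(2) x(1)])
    have gi: "integrable M (\<lambda>z. g z \<bullet> f k z)" for k by (rule bdd_fun_inner[OF R(2) f])
    have gR: "AE z in M. norm (g z) \<le> R" using R(2) by (simp add: bdd_fun_def)
    have gf: "norm (g z \<bullet> f k z) \<le> R * norm (f k z)" if "norm (g z) \<le> R" for z k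
    proof -
      have "norm (g z \<bullet> f k z) \<le> norm (g z) * norm (f k z)" using Cauchy_Schwarz_ineq2 by simp
      also have "\<dots> \<le> R * norm (f k z)" using that by (intro mult_right_mono) auto
      finally show ?thesis .
    qed
    have "(\<lambda>k. \<integral>z. g z \<bullet> f k z \<partial>M) sums (\<integral>z. (\<Sum>k. g z \<bullet> f k z) \<partial>M)"
    proof (rule sums_integral[OF gi])
      show "AE z in M. summable (\<lambda>k. norm (g z \<bullet> f k z))"
        using AEsum gR
      proof eventually_elim
        case (elim z)
        show ?case
          by (rule summable_comparison_test'[OF summable_mult[OF elim(1), of R], of 0])
            (use gf[OF elim(2)] in simp)
      qed
      show "summable (\<lambda>k. \<integral>z. norm (g z \<bullet> f k z) \<partial>M)"
      proof (rule summable_comparison_test'[OF summable_mult[OF AX, of R], of 0])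
        fix k
        have "(\<integral>z. norm (g z \<bullet> f k z) \<partial>M) \<le> (\<integral>z. R * norm (f k z) \<partial>M)"
        proof (rule integral_mono_AE)
          show "AE z in M. norm (g z \<bullet> f k z) \<le> R * norm (f k z)"
            using gR by eventually_elim (rule gf)
        qed (use gi[of k] f[of k] in auto)
        then show "norm (\<integral>z. norm (g z \<bullet> f k z) \<partial>M) \<le> R * (A k * X k)"
          by (simp add: fX)
      qed
    qed
    also have "(\<integral>z. (\<Sum>k. g z \<bullet> f k z) \<partial>M) = (\<integral>z. g z \<bullet> H z \<partial>M)"
    proof (rule integral_cong_AE)
      show "AE z in M. (\<Sum>k. g z \<bullet> f k z) = g z \<bullet> H z"
        using AEsum
      proof eventually_elim
        case (elim z)
        from summable_norm_cancel[OF elim] show ?case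
          unfolding H_def by (rule bounded_linear.suminf[OF bounded_linear_inner_right, symmetric])
      qed
      show "(\<lambda>z. \<Sum>k. g z \<bullet> f k z) \<in> borel_measurable M"
        using borel_measurable_integrable[OF gi] by measurable
      show "(\<lambda>z. g z \<bullet> H z) \<in> borel_measurable M"
        using bdd_fun_meas[OF R(2)] borel_measurable_integrable[OF Hi] by measurable
    qed
    also have "(\<lambda>k. \<integral>z. g z \<bullet> f k z \<partial>M) = (\<lambda>k. A k * y k)"
      by (simp add: f_def y_def)
    finally have S: "(\<lambda>K. \<Sum>k<K. A k * y k) \<longlonglongrightarrow> (\<integral>z. g z \<bullet> H z \<partial>M)"
      unfolding sums_def .
    show ?thesis
    proof (rule field_le_epsilon)
      fix e :: real assume e: "e > 0"
      obtain K0 where K0: "2 * R / e < real K0" using reals_Archimedean2 by blast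
      \<comment> \<open>Since \<open>X k\<close> is at most \<open>2 / k\<close>, the pairing of the
        bounded function \<open>g\<close> with \<open>x k\<close> is at most
        \<open>2 * R / k\<close>; late terms therefore contribute at most \<open>e\<close> per unit
        of weight.\<close>
      have ye: "y k \<le> e" if k: "max K0 1 \<le> k" for k
      proof -
        have "2 * R < e * real K0" using K0 e by (simp add: field_simps)
        also have "\<dots> \<le> e * real k" using k e by simp
        finally have "2 * R \<le> e * real k" by simp
        have "real k * (R * X k) \<le> R * 2"
          using mult_left_mono[OF x(2)[of k] R(1)] by (simp add: X_def mult_ac)
        then have "real k * (R * X k) \<le> real k * e" using \<open>2 * R \<le> e * real k\<close> by (simp add: mult_ac)
        then have "R * X k \<le> e" using k by simp
        then show ?thesis using yX[of k] by linarith
      qed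
      \<comment> \<open>For \<open>n \<ge> R\<close> the function \<open>g\<close> lies in the ball
        handled by \<open>h n\<close>. The terms beyond \<open>K\<close> contribute at most
        \<open>e\<close> uniformly in \<open>n\<close>, so \<open>n\<close> goes to infinity in a
        finite sum and \<open>K\<close> afterwards.\<close>
      have "1 \<le> (\<Sum>k<K. A k * y k) + e" if K: "max K0 1 \<le> K" for K
      proof (rule LIMSEQ_le_const)
        show "(\<lambda>n. (\<Sum>k<K. a n k * y k) + e) \<longlonglongrightarrow> (\<Sum>k<K. A k * y k) + e"
          by (intro tendsto_intros A)
        show "\<exists>N. \<forall>n\<ge>N. 1 \<le> (\<Sum>k<K. a n k * y k) + e"
        proof (intro exI allI impI)
          fix n assume n: "max K (nat \<lceil>R\<rceil>) \<le> n"
          have "bdd_fun (real n) g"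
          proof -
            have "R \<le> real n" using n by linarith
            then show ?thesis using R(2) unfolding bdd_fun_def by (auto elim!: eventually_mono)
          qed
          then have "c n \<le> (\<integral>z. g z \<bullet> h n z \<partial>M)" using hP[of n] g by (auto simp: P_def)
          also have "(\<integral>z. g z \<bullet> h n z \<partial>M) = (\<Sum>k<n. a n k * y k)"
            using bdd_fun_inner[OF R(2) x(1)] by (simp add: ha inner_sum_right y_def)
          also have "\<dots> = (\<Sum>k<K. a n k * y k) + (\<Sum>k=K..<n. a n k * y k)"
            using n by (simp add: lessThan_atLeast0 sum.atLeastLessThan_concat)
          also have "(\<Sum>k=K..<n. a n k * y k) \<le> (\<Sum>k=K..<n. a n k * e)"
            using K a_nonneg ye by (intro sum_mono mult_left_mono) auto
          also have "\<dots> = (\<Sum>k=K..<n. a n k) * e" by (simp add: sum_distrib_right)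
          also have "\<dots> \<le> 1 * e"
          proof (intro mult_right_mono)
            have "(\<Sum>k=K..<n. a n k) \<le> (\<Sum>k<n. a n k)"
              using a_nonneg by (intro sum_mono2) auto
            then show "(\<Sum>k=K..<n. a n k) \<le> 1" using a_sum[of n] by linarith
          qed (use e in auto)
          finally show "1 \<le> (\<Sum>k<K. a n k * y k) + e" using c(3)[of n] by linarith
        qed
      qed
      then show "1 \<le> (\<integral>z. g z \<bullet> H z \<partial>M) + e"
        by (intro LIMSEQ_le_const[OF tendsto_add[OF S tendsto_const[of e]]]) blast
    qed
  qed
  with Hi show ?thesis by blast
qed

end

section \<open>Envelopes and topologies on the Sobolev space\<close>

text \<open>If \<open>u\<close> lies outside a closure \<open>K\<close>, the functional equal to
  \<open>-\<infinity>\<close> on \<open>K\<close> and to \<open>c'\<close> elsewhere is a lower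
  semicontinuous minorant with value \<open>c'\<close> at \<open>u\<close>. Conversely, the sublevel
  sets of any such minorant are closed and contain those of \<open>F\<close>. The levels
  \<open>c' > c\<close> are needed since the envelope may attain a value that \<open>F\<close> only
  approaches.\<close>

lemma lsc_envelope_le_iff:
  assumes u: "u \<in> topspace T"
  shows "lsc_envelope T F u \<le> ereal c \<longleftrightarrow> (\<forall>c'>c. u \<in> T closure_of {v \<in> topspace T. F v \<le> ereal c'})"
proof
  assume le: "lsc_envelope T F u \<le> ereal c"
  show "\<forall>c'>c. u \<in> T closure_of {v \<in> topspace T. F v \<le> ereal c'}"
  proof (intro allI impI, rule ccontr)
    fix c' assume c': "c < c'" and nu: "u \<notin> T closure_of {v \<in> topspace T. F v \<le> ereal c'}"
    define K where "K = T closure_of {v \<in> topspace T. F v \<le> ereal c'}"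
    define H where "H v = (if v \<in> K then -\<infinity> else ereal c')" for v
    have K: "closedin T K" by (simp add: K_def)
    have "lsc_on T H"
      unfolding lsc_on_def
    proof
      fix d
      have "{v \<in> topspace T. H v \<le> ereal d} = (if c' \<le> d then topspace T else K)"
        using closedin_subset[OF K] by (auto simp: H_def)
      then show "closedin T {v \<in> topspace T. H v \<le> ereal d}" using K by simp
    qed
    moreover have "H v \<le> F v" if v: "v \<in> topspace T" for v
    proof (cases "v \<in> K")
      case False
      then have "\<not> F v \<le> ereal c'"
        using v closure_of_subset[of "{v \<in> topspace T. F v \<le> ereal c'}" T] by (auto simp: K_def)
      then have "ereal c' \<le> F v" by simp
      then show ?thesis using False by (simp add: H_def)
    qed (simp add: H_def)
    ultimately have "H u \<le> lsc_envelope T F u"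
      unfolding lsc_envelope_def by (intro SUP_upper) auto
    then have "ereal c' \<le> lsc_envelope T F u" using nu by (simp add: H_def K_def)
    then have "ereal c' \<le> ereal c" using le by (rule order.trans)
    then show False using c' by simp
  qed
next
  assume cl: "\<forall>c'>c. u \<in> T closure_of {v \<in> topspace T. F v \<le> ereal c'}"
  show "lsc_envelope T F u \<le> ereal c"
    unfolding lsc_envelope_def
  proof (rule SUP_least)
    fix H assume H: "H \<in> {G. lsc_on T G \<and> (\<forall>v\<in>topspace T. G v \<le> F v)}"
    show "H u \<le> ereal c"
    proof (rule ereal_le_epsilon2)
      fix e :: real assume "0 < e"
      have "T closure_of {v \<in> topspace T. F v \<le> ereal (c + e)} \<subseteq> {v \<in> topspace T. H v \<le> ereal (c + e)}"
      proof (rule closure_of_minimal)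
        have "H v \<le> ereal (c + e)" if "v \<in> topspace T" "F v \<le> ereal (c + e)" for v
        proof -
          have "H v \<le> F v" using H that(1) by simp
          then show ?thesis using that(2) by (rule order.trans)
        qed
        then show "{v \<in> topspace T. F v \<le> ereal (c + e)} \<subseteq> {v \<in> topspace T. H v \<le> ereal (c + e)}" by blast
        show "closedin T {v \<in> topspace T. H v \<le> ereal (c + e)}" using H by (simp add: lsc_on_def)
      qed
      moreover have "u \<in> T closure_of {v \<in> topspace T. F v \<le> ereal (c + e)}"
        using cl \<open>0 < e\<close> by simp
      ultimately have "H u \<le> ereal (c + e)" by blast
      then show "H u \<le> ereal c + ereal e" by simp
    qed
  qed
qed

text \<open>Two passes: with one endpoint fixed in \<open>A\<close>, continuity carries the other
  one to the closure; then that one is fixed in the closure and the first is moved. Continuity in a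
  single argument suffices, as is convenient for the sequential topology.\<close>

lemma closure_of_convex:
  assumes X: "topspace T = X" and A: "A \<subseteq> X"
    and cont: "\<And>v t. v \<in> X \<Longrightarrow> 0 \<le> t \<Longrightarrow> t \<le> 1 \<Longrightarrow> continuous_map T T (\<lambda>u x. (1 - t) * u x + t * v x)"
    and seg: "\<And>u v t. u \<in> A \<Longrightarrow> v \<in> A \<Longrightarrow> 0 \<le> t \<Longrightarrow> t \<le> 1 \<Longrightarrow> (\<lambda>x. (1 - t) * u x + t * v x) \<in> T closure_of A"
  shows "convex_funs (T closure_of A)"
  unfolding convex_funs_def
proof (intro ballI)
  have clX: "T closure_of A \<subseteq> X" using X closure_of_subset_topspace by metis
  have step: "(\<lambda>x. (1 - t) * u x + t * v x) \<in> T closure_of A"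
    if u: "u \<in> T closure_of A" and v: "v \<in> X" and t: "0 \<le> t" "t \<le> 1"
      and img: "\<And>w. w \<in> A \<Longrightarrow> (\<lambda>x. (1 - t) * w x + t * v x) \<in> T closure_of A" for u v t
  proof -
    let ?f = "\<lambda>u x. (1 - t) * u x + t * v x"
    have "?f ` (T closure_of A) \<subseteq> T closure_of (?f ` A)"
      by (rule continuous_map_image_closure_subset[OF cont[OF v t]])
    also have "\<dots> \<subseteq> T closure_of A"
      by (rule closure_of_minimal) (use img in auto)
    finally show ?thesis using u by blast
  qed
  have step1: "(\<lambda>x. (1 - t) * u x + t * v x) \<in> T closure_of A"
    if "u \<in> T closure_of A" "v \<in> A" "0 \<le> t" "t \<le> 1" for u v t
    by (rule step) (use that A seg in auto)
  fix u v and t :: real assume uv: "u \<in> T closure_of A" "v \<in> T closure_of A" and t: "t \<in> {0..1}"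
  \<comment> \<open>The second pass varies \<open>v\<close>, so the roles are exchanged by replacing
    \<open>t\<close> with \<open>1 - t\<close>.\<close>
  have "(\<lambda>x. (1 - (1 - t)) * v x + (1 - t) * u x) \<in> T closure_of A"
  proof (rule step[OF uv(2)])
    fix w assume "w \<in> A"
    from step1[OF uv(1) this, of t] show "(\<lambda>x. (1 - (1 - t)) * w x + (1 - t) * u x) \<in> T closure_of A"
      using t by (simp add: add.commute)
  qed (use uv clX t in auto)
  then show "(\<lambda>x. (1 - t) * u x + t * v x) \<in> T closure_of A"
    by (simp add: add.commute)
qed

section \<open>The uniform topology on the Sobolev space\<close>

lemma Linf_norm_less_iff:
  assumes "g \<in> borel_measurable (lebesgue_on \<Omega>)"
  shows "Linf_norm \<Omega> g < ereal e \<longleftrightarrow> (\<exists>d<e. AE x in lebesgue_on \<Omega>. norm (g x) \<le> d)"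
proof
  assume "Linf_norm \<Omega> g < ereal e"
  then obtain d where d: "Linf_norm \<Omega> g < ereal d" "ereal d < ereal e"
    using ereal_dense2 by blast
  have "AE x in lebesgue_on \<Omega>. ereal (norm (g x)) \<le> Linf_norm \<Omega> g"
    unfolding Linf_norm_def by (rule esssup_AE)
  then have "AE x in lebesgue_on \<Omega>. norm (g x) \<le> d"
  proof eventually_elim
    case (elim x)
    then have "ereal (norm (g x)) \<le> ereal d" using d(1) by (meson less_imp_le order.trans)
    then show ?case by simp
  qed
  then show "\<exists>d<e. AE x in lebesgue_on \<Omega>. norm (g x) \<le> d" using d(2) by auto
next
  assume "\<exists>d<e. AE x in lebesgue_on \<Omega>. norm (g x) \<le> d"
  then obtain d where d: "d < e" "AE x in lebesgue_on \<Omega>. norm (g x) \<le> d" by blast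
  have "Linf_norm \<Omega> g \<le> ereal d"
    unfolding Linf_norm_def by (rule esssup_I) (use assms d(2) in auto)
  also have "\<dots> < ereal e" using d(1) by simp
  finally show "Linf_norm \<Omega> g < ereal e" .
qed

text \<open>The balls only generate the topology, so the neighbourhood property is propagated
  through finite intersections and unions by induction; a generating ball around another centre is
  handled by the triangle inequality.\<close>

lemma openin_Linf_norm_topologyD:
  assumes "openin (Linf_norm_topology \<Omega>) U" "g \<in> U"
  shows "\<exists>e>0. \<forall>h\<in>Linf \<Omega>. (AE x in lebesgue_on \<Omega>. norm (h x - g x) \<le> e) \<longrightarrow> h \<in> U"
proof -
  have "generate_topology_on {{h \<in> Linf \<Omega>. Linf_norm \<Omega> (\<lambda>x. h x - g x) < ereal e} | g e. g \<in> Linf \<Omega> \<and> 0 < e} U"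
    using assms(1) unfolding Linf_norm_topology_def by (rule openin_topology_generated_by)
  then show ?thesis
    using assms(2)
  proof (induction arbitrary: g)
    case (Int a b)
    from Int.IH(1)[of g] Int.prems obtain e where e: "e > 0"
      "\<forall>h\<in>Linf \<Omega>. (AE x in lebesgue_on \<Omega>. norm (h x - g x) \<le> e) \<longrightarrow> h \<in> a" by blast
    from Int.IH(2)[of g] Int.prems obtain d where d: "d > 0"
      "\<forall>h\<in>Linf \<Omega>. (AE x in lebesgue_on \<Omega>. norm (h x - g x) \<le> d) \<longrightarrow> h \<in> b" by blast
    show ?case
    proof (intro exI[of _ "min e d"] conjI ballI impI)
      fix h assume h: "h \<in> Linf \<Omega>" and ae: "AE x in lebesgue_on \<Omega>. norm (h x - g x) \<le> min e d"
      have "AE x in lebesgue_on \<Omega>. norm (h x - g x) \<le> e" "AE x in lebesgue_on \<Omega>. norm (h x - g x) \<le> d"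
        using ae by (auto elim!: eventually_mono)
      then show "h \<in> a \<inter> b" using e d h by blast
    qed (use e d in auto)
  next
    case (UN K)
    then obtain k where k: "k \<in> K" "g \<in> k" by blast
    from UN.IH[OF k] k(1) show ?case by blast
  next
    case (Basis s)
    then obtain g0 e0 where s: "s = {h \<in> Linf \<Omega>. Linf_norm \<Omega> (\<lambda>x. h x - g0 x) < ereal e0}"
      and g0: "g0 \<in> Linf \<Omega>" "0 < e0" by blast
    then have g: "g \<in> Linf \<Omega>" "Linf_norm \<Omega> (\<lambda>x. g x - g0 x) < ereal e0" using Basis.prems by auto
    then obtain d where d: "d < e0" "AE x in lebesgue_on \<Omega>. norm (g x - g0 x) \<le> d"
      using Linf_norm_less_iff[OF Linf_measurable[OF Linf_diff[OF g(1) g0(1)]]] by blast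
    show ?case
    \<comment> \<open>Half of the slack \<open>e0 - d\<close>, because membership in the ball
      requires an essential supremum strictly below \<open>e0\<close>.\<close>
    proof (intro exI[of _ "(e0 - d) / 2"] conjI ballI impI)
      fix h assume h: "h \<in> Linf \<Omega>" and ae: "AE x in lebesgue_on \<Omega>. norm (h x - g x) \<le> (e0 - d) / 2"
      have "AE x in lebesgue_on \<Omega>. norm (h x - g0 x) \<le> (e0 + d) / 2"
        using ae d(2)
      proof eventually_elim
        case (elim x)
        have "norm (h x - g0 x) \<le> norm (h x - g x) + norm (g x - g0 x)"
          using norm_triangle_ineq[of "h x - g x" "g x - g0 x"] by simp
        also have "\<dots> \<le> (e0 - d) / 2 + d" using elim by linarith
        also have "\<dots> = (e0 + d) / 2" by (simp add: field_simps)
        finally show ?case .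
      qed
      moreover have "(e0 + d) / 2 < e0" using d(1) by simp
      ultimately have "Linf_norm \<Omega> (\<lambda>x. h x - g0 x) < ereal e0"
        using Linf_norm_less_iff[OF Linf_measurable[OF Linf_diff[OF h g0(1)]]] by blast
      then show "h \<in> s" using h by (simp add: s)
    qed (use d in auto)
  qed simp
qed

lemma openin_tau_inf:
  "openin (tau_inf \<Omega>) S \<longleftrightarrow> S \<subseteq> W1inf \<Omega> \<and>
    (\<forall>g\<in>S. \<exists>e>0. \<forall>h\<in>W1inf \<Omega>. (AE x in lebesgue_on \<Omega>. norm (h x - g x) \<le> e) \<longrightarrow> h \<in> S)"
proof
  assume "openin (tau_inf \<Omega>) S"
  then obtain T where T: "openin (Linf_norm_topology \<Omega>) T" "S = T \<inter> W1inf \<Omega>"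
    unfolding tau_inf_def openin_subtopology by blast
  show "S \<subseteq> W1inf \<Omega> \<and>
    (\<forall>g\<in>S. \<exists>e>0. \<forall>h\<in>W1inf \<Omega>. (AE x in lebesgue_on \<Omega>. norm (h x - g x) \<le> e) \<longrightarrow> h \<in> S)"
  proof (intro conjI ballI)
    fix g assume "g \<in> S"
    then have "g \<in> T" using T(2) by simp
    from openin_Linf_norm_topologyD[OF T(1) this] obtain e where e: "e > 0"
      "\<forall>h\<in>Linf \<Omega>. (AE x in lebesgue_on \<Omega>. norm (h x - g x) \<le> e) \<longrightarrow> h \<in> T" by blast
    then show "\<exists>e>0. \<forall>h\<in>W1inf \<Omega>. (AE x in lebesgue_on \<Omega>. norm (h x - g x) \<le> e) \<longrightarrow> h \<in> S"
      unfolding T(2) using W1inf_Linf by blast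
  qed (use T in auto)
next
  assume S: "S \<subseteq> W1inf \<Omega> \<and>
    (\<forall>g\<in>S. \<exists>e>0. \<forall>h\<in>W1inf \<Omega>. (AE x in lebesgue_on \<Omega>. norm (h x - g x) \<le> e) \<longrightarrow> h \<in> S)"
  then have "\<forall>g\<in>S. \<exists>e>0. \<forall>h\<in>W1inf \<Omega>. (AE x in lebesgue_on \<Omega>. norm (h x - g x) \<le> e) \<longrightarrow> h \<in> S" ..
  from bchoice[OF this] obtain e where e: "\<forall>g\<in>S. e g > 0 \<and>
    (\<forall>h\<in>W1inf \<Omega>. (AE x in lebesgue_on \<Omega>. norm (h x - g x) \<le> e g) \<longrightarrow> h \<in> S)" ..
  define B where "B g = {h \<in> Linf \<Omega>. Linf_norm \<Omega> (\<lambda>x. h x - g x) < ereal (e g)}" for g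
  have SL: "g \<in> Linf \<Omega>" if "g \<in> S" for g using that S W1inf_Linf by blast
  have B: "openin (Linf_norm_topology \<Omega>) (B g)" if "g \<in> S" for g
    unfolding Linf_norm_topology_def
  proof (rule topology_generated_by_Basis)
    show "B g \<in> {{h \<in> Linf \<Omega>. Linf_norm \<Omega> (\<lambda>x. h x - g x) < ereal e} | g e. g \<in> Linf \<Omega> \<and> 0 < e}"
      unfolding B_def using SL[OF that] e that by blast
  qed
  have "S = (\<Union>g\<in>S. B g) \<inter> W1inf \<Omega>"
  proof (intro equalityI subsetI)
    fix g assume g: "g \<in> S"
    have "Linf_norm \<Omega> (\<lambda>x. g x - g x) < ereal (e g)"
      using Linf_norm_less_iff[OF Linf_measurable[OF Linf_diff[OF SL[OF g] SL[OF g]]]] e g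
      by (auto intro!: exI[of _ 0])
    then have "g \<in> B g" using SL[OF g] by (simp add: B_def)
    then show "g \<in> (\<Union>g\<in>S. B g) \<inter> W1inf \<Omega>" using g S by blast
  next
    fix h assume "h \<in> (\<Union>g\<in>S. B g) \<inter> W1inf \<Omega>"
    then obtain g where g: "g \<in> S" "h \<in> B g" and h: "h \<in> W1inf \<Omega>" by blast
    then obtain d where "d < e g" "AE x in lebesgue_on \<Omega>. norm (h x - g x) \<le> d"
      using Linf_norm_less_iff[OF Linf_measurable[OF Linf_diff[OF W1inf_Linf[OF h] SL[OF g(1)]]]]
      by (auto simp: B_def)
    then have "AE x in lebesgue_on \<Omega>. norm (h x - g x) \<le> e g" by (auto elim!: eventually_mono)
    then show "h \<in> S" using e g(1) h by blast
  qed
  moreover have "openin (Linf_norm_topology \<Omega>) (\<Union>g\<in>S. B g)" using B by blast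
  ultimately show "openin (tau_inf \<Omega>) S"
    unfolding tau_inf_def openin_subtopology by blast
qed

text \<open>The map does not increase uniform distances, as \<open>1 - t \<le> 1\<close>, so the
  same radius works at the source.\<close>

lemma tau_inf_combination_continuous:
  assumes \<Omega>: "open \<Omega>" and v: "v \<in> W1inf \<Omega>" and t: "0 \<le> t" "t \<le> 1"
  shows "continuous_map (tau_inf \<Omega>) (tau_inf \<Omega>) (\<lambda>u x. (1 - t) * u x + t * v x)"
  unfolding continuous_map topspace_tau_inf
proof (intro conjI allI impI)
  show "(\<lambda>u x. (1 - t) * u x + t * v x) ` W1inf \<Omega> \<subseteq> W1inf \<Omega>"
    using W1inf_linear_combination(1)[OF \<Omega> _ v] by blast
  fix U assume U: "openin (tau_inf \<Omega>) U"
  show "openin (tau_inf \<Omega>) {u \<in> W1inf \<Omega>. (\<lambda>x. (1 - t) * u x + t * v x) \<in> U}"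
    unfolding openin_tau_inf[of _ "{u \<in> W1inf \<Omega>. (\<lambda>x. (1 - t) * u x + t * v x) \<in> U}"]
  proof (intro conjI ballI)
    fix u assume "u \<in> {u \<in> W1inf \<Omega>. (\<lambda>x. (1 - t) * u x + t * v x) \<in> U}"
    then have u: "(\<lambda>x. (1 - t) * u x + t * v x) \<in> U" by simp
    obtain e where e: "e > 0" "\<forall>h\<in>W1inf \<Omega>.
      (AE x in lebesgue_on \<Omega>. norm (h x - ((1 - t) * u x + t * v x)) \<le> e) \<longrightarrow> h \<in> U"
      using bspec[OF conjunct2[OF U[unfolded openin_tau_inf]] u] by blast
    show "\<exists>e>0. \<forall>h\<in>W1inf \<Omega>. (AE x in lebesgue_on \<Omega>. norm (h x - u x) \<le> e) \<longrightarrow>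
        h \<in> {u \<in> W1inf \<Omega>. (\<lambda>x. (1 - t) * u x + t * v x) \<in> U}"
    proof (intro exI[of _ e] conjI ballI impI e(1))
      fix h assume h: "h \<in> W1inf \<Omega>" and ae: "AE x in lebesgue_on \<Omega>. norm (h x - u x) \<le> e"
      have "AE x in lebesgue_on \<Omega>. norm (((1 - t) * h x + t * v x) - ((1 - t) * u x + t * v x)) \<le> e"
        using ae
      proof eventually_elim
        case (elim x)
        have "((1 - t) * h x + t * v x) - ((1 - t) * u x + t * v x) = (1 - t) * (h x - u x)"
          by (simp add: algebra_simps)
        moreover have "(1 - t) * \<bar>h x - u x\<bar> \<le> 1 * e"
          using elim t e(1) by (intro mult_mono) auto
        ultimately show ?case using t by (simp add: abs_mult)
      qed
      then show "h \<in> {u \<in> W1inf \<Omega>. (\<lambda>x. (1 - t) * u x + t * v x) \<in> U}"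
        using e(2) h W1inf_linear_combination(1)[OF \<Omega> h v] by simp
    qed
  qed auto
qed

lemma tau_inf_closure_of:
  assumes u: "u \<in> W1inf \<Omega>"
    and approx: "\<And>e. e > 0 \<Longrightarrow> \<exists>w\<in>A. w \<in> W1inf \<Omega> \<and> (AE x in lebesgue_on \<Omega>. norm (w x - u x) \<le> e)"
  shows "u \<in> tau_inf \<Omega> closure_of A"
  unfolding in_closure_of topspace_tau_inf
proof (intro conjI allI impI u)
  fix T assume "u \<in> T \<and> openin (tau_inf \<Omega>) T"
  then obtain e where "e > 0" "\<forall>h\<in>W1inf \<Omega>. (AE x in lebesgue_on \<Omega>. norm (h x - u x) \<le> e) \<longrightarrow> h \<in> T"
    unfolding openin_tau_inf by blast
  then show "\<exists>y. y \<in> A \<and> y \<in> T" using approx[of e] by blast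
qed

section \<open>The weak* topology as an initial topology\<close>

lemma continuous_map_weak_star_pairing:
  assumes "\<phi> \<in> L1 \<Omega>"
  shows "continuous_map (Linf_weak_star_topology \<Omega>) euclideanreal (\<lambda>g. \<integral>x. g x \<bullet> \<phi> x \<partial>lebesgue_on \<Omega>)"
proof -
  have "continuous_map (Linf_weak_star_topology \<Omega>) euclideanreal
      ((\<lambda>F. F \<phi>) \<circ> (\<lambda>g. \<lambda>\<phi>\<in>L1 \<Omega>. (\<integral>x. g x \<bullet> \<phi> x \<partial>lebesgue_on \<Omega>)))"
    unfolding Linf_weak_star_topology_def
    by (intro continuous_map_pullback continuous_map_product_projection assms)
  then show ?thesis using assms by (simp add: o_def)
qed

lemma continuous_map_w_star_pairing:
  shows "\<phi> \<in> L1 \<Omega> \<Longrightarrow> continuous_map (w_star \<Omega>) euclideanreal (\<lambda>u. \<integral>x. u x \<bullet> \<phi> x \<partial>lebesgue_on \<Omega>)"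
    and "\<Phi> \<in> L1 \<Omega> \<Longrightarrow> continuous_map (w_star \<Omega>) euclideanreal (\<lambda>u. \<integral>x. wgrad \<Omega> u x \<bullet> \<Phi> x \<partial>lebesgue_on \<Omega>)"
proof -
  assume "\<phi> \<in> L1 \<Omega>"
  then have "continuous_map (prod_topology (Linf_weak_star_topology \<Omega>) (Linf_weak_star_topology \<Omega>))
     euclideanreal ((\<lambda>g. \<integral>x. g x \<bullet> \<phi> x \<partial>lebesgue_on \<Omega>) \<circ> fst)"
    by (intro continuous_map_compose[OF continuous_map_fst] continuous_map_weak_star_pairing)
  from continuous_map_pullback[OF this, of "W1inf \<Omega>" "\<lambda>u. (u, wgrad \<Omega> u)"]
  show "continuous_map (w_star \<Omega>) euclideanreal (\<lambda>u. \<integral>x. u x \<bullet> \<phi> x \<partial>lebesgue_on \<Omega>)"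
    unfolding w_star_def by (simp add: o_def)
next
  assume "\<Phi> \<in> L1 \<Omega>"
  then have "continuous_map (prod_topology (Linf_weak_star_topology \<Omega>) (Linf_weak_star_topology \<Omega>))
     euclideanreal ((\<lambda>g. \<integral>x. g x \<bullet> \<Phi> x \<partial>lebesgue_on \<Omega>) \<circ> snd)"
    by (intro continuous_map_compose[OF continuous_map_snd] continuous_map_weak_star_pairing)
  from continuous_map_pullback[OF this, of "W1inf \<Omega>" "\<lambda>u. (u, wgrad \<Omega> u)"]
  show "continuous_map (w_star \<Omega>) euclideanreal (\<lambda>u. \<integral>x. wgrad \<Omega> u x \<bullet> \<Phi> x \<partial>lebesgue_on \<Omega>)"
    unfolding w_star_def by (simp add: o_def)
qed

lemma continuous_map_into_weak_star:
  assumes "\<And>x. x \<in> topspace X \<Longrightarrow> m x \<in> Linf \<Omega>"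
    and "\<And>\<phi>. \<phi> \<in> L1 \<Omega> \<Longrightarrow> continuous_map X euclideanreal (\<lambda>x. \<integral>y. m x y \<bullet> \<phi> y \<partial>lebesgue_on \<Omega>)"
  shows "continuous_map X (Linf_weak_star_topology \<Omega>) m"
  unfolding Linf_weak_star_topology_def
proof (rule continuous_map_pullback')
  show "continuous_map X (product_topology (\<lambda>_. euclideanreal) (L1 \<Omega>))
      ((\<lambda>g. \<lambda>\<phi>\<in>L1 \<Omega>. (\<integral>x. g x \<bullet> \<phi> x \<partial>lebesgue_on \<Omega>)) \<circ> m)"
    unfolding continuous_map_componentwise using assms(2) by auto
qed (use assms(1) in auto)

lemma continuous_map_into_w_star:
  assumes W: "\<And>x. x \<in> topspace X \<Longrightarrow> m x \<in> W1inf \<Omega>"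
    and "\<And>\<phi>. \<phi> \<in> L1 \<Omega> \<Longrightarrow> continuous_map X euclideanreal (\<lambda>x. \<integral>y. m x y \<bullet> \<phi> y \<partial>lebesgue_on \<Omega>)"
    and "\<And>\<Phi>. \<Phi> \<in> L1 \<Omega> \<Longrightarrow> continuous_map X euclideanreal (\<lambda>x. \<integral>y. wgrad \<Omega> (m x) y \<bullet> \<Phi> y \<partial>lebesgue_on \<Omega>)"
  shows "continuous_map X (w_star \<Omega>) m"
  unfolding w_star_def
proof (rule continuous_map_pullback')
  have "continuous_map X (prod_topology (Linf_weak_star_topology \<Omega>) (Linf_weak_star_topology \<Omega>))
      (\<lambda>x. (m x, wgrad \<Omega> (m x)))"
    by (intro continuous_map_pairedI continuous_map_into_weak_star W1inf_Linf[OF W] wgrad(1)[OF W] assms(2,3))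
  then show "continuous_map X (prod_topology (Linf_weak_star_topology \<Omega>) (Linf_weak_star_topology \<Omega>))
      ((\<lambda>u. (u, wgrad \<Omega> u)) \<circ> m)" by (simp add: o_def)
qed (use W in auto)

lemma limitin_pullback_topology:
  assumes "l \<in> A" "\<And>n. s n \<in> A" "limitin T (\<lambda>n. f (s n)) (f l) F"
  shows "limitin (pullback_topology A f T) s l F"
  unfolding limitin_def
proof (intro conjI allI impI)
  show "l \<in> topspace (pullback_topology A f T)"
    using assms(1) limitin_topspace[OF assms(3)] by (simp add: topspace_pullback_topology)
  fix U assume U: "openin (pullback_topology A f T) U \<and> l \<in> U"
  then obtain V where V: "openin T V" "U = f -` V \<inter> A" by (auto simp: openin_pullback_topology)
  then have "\<forall>\<^sub>F n in F. f (s n) \<in> V"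
    using U by (intro limitinD[OF assms(3)]) auto
  then show "\<forall>\<^sub>F n in F. s n \<in> U"
    by eventually_elim (use V assms(2) in auto)
qed

lemma limitin_weak_star:
  assumes "\<And>n. s n \<in> Linf \<Omega>" "l \<in> Linf \<Omega>"
    and "\<And>\<phi>. \<phi> \<in> L1 \<Omega> \<Longrightarrow> ((\<lambda>n. \<integral>x. s n x \<bullet> \<phi> x \<partial>lebesgue_on \<Omega>) \<longlongrightarrow> (\<integral>x. l x \<bullet> \<phi> x \<partial>lebesgue_on \<Omega>)) F"
  shows "limitin (Linf_weak_star_topology \<Omega>) s l F"
  unfolding Linf_weak_star_topology_def
proof (rule limitin_pullback_topology[OF assms(2,1)])
  show "limitin (product_topology (\<lambda>_. euclideanreal) (L1 \<Omega>))
      (\<lambda>n. \<lambda>\<phi>\<in>L1 \<Omega>. \<integral>x. s n x \<bullet> \<phi> x \<partial>lebesgue_on \<Omega>) (\<lambda>\<phi>\<in>L1 \<Omega>. \<integral>x. l x \<bullet> \<phi> x \<partial>lebesgue_on \<Omega>) F"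
    unfolding limitin_componentwise using assms(3) by simp
qed

lemma limitin_w_star:
  assumes "\<And>n. s n \<in> W1inf \<Omega>" "l \<in> W1inf \<Omega>"
    and "\<And>\<phi>. \<phi> \<in> L1 \<Omega> \<Longrightarrow> ((\<lambda>n. \<integral>x. s n x \<bullet> \<phi> x \<partial>lebesgue_on \<Omega>) \<longlongrightarrow> (\<integral>x. l x \<bullet> \<phi> x \<partial>lebesgue_on \<Omega>)) F"
    and "\<And>\<Phi>. \<Phi> \<in> L1 \<Omega> \<Longrightarrow> ((\<lambda>n. \<integral>x. wgrad \<Omega> (s n) x \<bullet> \<Phi> x \<partial>lebesgue_on \<Omega>) \<longlongrightarrow>
      (\<integral>x. wgrad \<Omega> l x \<bullet> \<Phi> x \<partial>lebesgue_on \<Omega>)) F"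
  shows "limitin (w_star \<Omega>) s l F"
  unfolding w_star_def
proof (intro limitin_pullback_topology assms(1,2))
  show "limitin (prod_topology (Linf_weak_star_topology \<Omega>) (Linf_weak_star_topology \<Omega>))
      (\<lambda>n. (s n, wgrad \<Omega> (s n))) (l, wgrad \<Omega> l) F"
    unfolding limitin_pairwise o_def fst_conv snd_conv
    by (intro conjI limitin_weak_star assms(3,4) W1inf_Linf[OF assms(1)] W1inf_Linf[OF assms(2)]
        wgrad(1)[OF assms(1)] wgrad(1)[OF assms(2)])
qed

lemma Linf_L1_integral_combination:
  assumes "f \<in> Linf \<Omega>" "g \<in> Linf \<Omega>" "\<phi> \<in> L1 \<Omega>"
  shows "(\<integral>x. (a *\<^sub>R f x + b *\<^sub>R g x) \<bullet> \<phi> x \<partial>lebesgue_on \<Omega>) =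
    a * (\<integral>x. f x \<bullet> \<phi> x \<partial>lebesgue_on \<Omega>) + b * (\<integral>x. g x \<bullet> \<phi> x \<partial>lebesgue_on \<Omega>)"
  using Linf_L1_integrable[OF assms(1,3)] Linf_L1_integrable[OF assms(2,3)] by (simp add: inner_add_left)

lemma pairing_cong_AE:
  assumes "f \<in> Linf \<Omega>" "g \<in> Linf \<Omega>" "\<phi> \<in> L1 \<Omega>" "AE x in lebesgue_on \<Omega>. f x = g x"
  shows "(\<integral>x. f x \<bullet> \<phi> x \<partial>lebesgue_on \<Omega>) = (\<integral>x. g x \<bullet> \<phi> x \<partial>lebesgue_on \<Omega>)"
proof (rule integral_cong_AE)
  show "(\<lambda>x. f x \<bullet> \<phi> x) \<in> borel_measurable (lebesgue_on \<Omega>)"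
    using Linf_L1_integrable[OF assms(1,3)] by simp
  show "(\<lambda>x. g x \<bullet> \<phi> x) \<in> borel_measurable (lebesgue_on \<Omega>)"
    using Linf_L1_integrable[OF assms(2,3)] by simp
  show "AE x in lebesgue_on \<Omega>. f x \<bullet> \<phi> x = g x \<bullet> \<phi> x"
    using assms(4) by eventually_elim simp
qed

lemma w_star_combination_continuous:
  assumes \<Omega>: "open \<Omega>" and v: "v \<in> W1inf \<Omega>"
  shows "continuous_map (w_star \<Omega>) (w_star \<Omega>) (\<lambda>u x. (1 - t) * u x + t * v x)"
proof (rule continuous_map_into_w_star)
  note vL = W1inf_Linf[OF v]
  show "(\<lambda>x. (1 - t) * u x + t * v x) \<in> W1inf \<Omega>" if "u \<in> topspace (w_star \<Omega>)" for u
    using that W1inf_linear_combination(1)[OF \<Omega> _ v] by (simp add: topspace_w_star)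
  show "continuous_map (w_star \<Omega>) euclideanreal
      (\<lambda>u. \<integral>y. ((1 - t) * u y + t * v y) \<bullet> \<phi> y \<partial>lebesgue_on \<Omega>)" if \<phi>: "\<phi> \<in> L1 \<Omega>" for \<phi>
  proof (rule continuous_map_eq)
    show "continuous_map (w_star \<Omega>) euclideanreal
      (\<lambda>u. (1 - t) * (\<integral>y. u y \<bullet> \<phi> y \<partial>lebesgue_on \<Omega>) + t * (\<integral>y. v y \<bullet> \<phi> y \<partial>lebesgue_on \<Omega>))"
      using continuous_map_w_star_pairing(1)[OF \<phi>]
      by (intro continuous_map_add continuous_map_real_mult_left) auto
    show "(1 - t) * (\<integral>y. u y \<bullet> \<phi> y \<partial>lebesgue_on \<Omega>) + t * (\<integral>y. v y \<bullet> \<phi> y \<partial>lebesgue_on \<Omega>) =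
      (\<integral>y. ((1 - t) * u y + t * v y) \<bullet> \<phi> y \<partial>lebesgue_on \<Omega>)" if "u \<in> topspace (w_star \<Omega>)" for u
      using Linf_L1_integral_combination[OF W1inf_Linf vL \<phi>, of u "1 - t" t] that by (simp add: topspace_w_star)
  qed
  show "continuous_map (w_star \<Omega>) euclideanreal
      (\<lambda>u. \<integral>y. wgrad \<Omega> (\<lambda>x. (1 - t) * u x + t * v x) y \<bullet> \<Phi> y \<partial>lebesgue_on \<Omega>)" if \<Phi>: "\<Phi> \<in> L1 \<Omega>" for \<Phi>
  proof (rule continuous_map_eq)
    show "continuous_map (w_star \<Omega>) euclideanreal
      (\<lambda>u. (1 - t) * (\<integral>y. wgrad \<Omega> u y \<bullet> \<Phi> y \<partial>lebesgue_on \<Omega>) + t * (\<integral>y. wgrad \<Omega> v y \<bullet> \<Phi> y \<partial>lebesgue_on \<Omega>))"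
      using continuous_map_w_star_pairing(2)[OF \<Phi>]
      by (intro continuous_map_add continuous_map_real_mult_left) auto
    fix u assume "u \<in> topspace (w_star \<Omega>)"
    then have u: "u \<in> W1inf \<Omega>" by (simp add: topspace_w_star)
    \<comment> \<open>The gradient is a choice among functions equal almost everywhere, so its
      linearity holds only almost everywhere and is used under the integral.\<close>
    note uv = W1inf_linear_combination[OF \<Omega> u v, of "1 - t" t]
    show "(1 - t) * (\<integral>y. wgrad \<Omega> u y \<bullet> \<Phi> y \<partial>lebesgue_on \<Omega>) + t * (\<integral>y. wgrad \<Omega> v y \<bullet> \<Phi> y \<partial>lebesgue_on \<Omega>) =
      (\<integral>y. wgrad \<Omega> (\<lambda>x. (1 - t) * u x + t * v x) y \<bullet> \<Phi> y \<partial>lebesgue_on \<Omega>)"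
      using Linf_L1_integral_combination[OF wgrad(1)[OF u] wgrad(1)[OF v] \<Phi>, of "1 - t" t]
        pairing_cong_AE[OF wgrad(1)[OF uv(1)] Linf_linear_combination[OF wgrad(1)[OF u] wgrad(1)[OF v]] \<Phi> uv(2)]
      by simp
  qed
qed

section \<open>Sequentially closed sets and sequential convergence\<close>

lemma seq_closedin_closedin: "closedin T C \<Longrightarrow> seq_closedin T C"
  unfolding seq_closedin_def
proof (intro conjI allI impI)
  assume C: "closedin T C"
  then show "C \<subseteq> topspace T" by (rule closedin_subset)
  fix s l assume "(\<forall>n::nat. s n \<in> C) \<and> limitin T s l sequentially"
  then show "l \<in> C" using limitin_closedin[of T s l sequentially C] C by simp
qed

text \<open>Continuous maps preserve limits of sequences, so preimages of sequentially closed sets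
  are sequentially closed.\<close>

lemma sequential_topology_continuous_map:
  assumes f: "continuous_map T T' f"
  shows "continuous_map (sequential_topology T) (sequential_topology T') f"
  unfolding continuous_map_closedin closedin_sequential topspace_sequential
proof (intro conjI allI impI)
  show "f \<in> topspace T \<rightarrow> topspace T'" using f by (rule continuous_map_funspace)
  fix C assume C: "seq_closedin T' C"
  show "seq_closedin T {x \<in> topspace T. f x \<in> C}"
    unfolding seq_closedin_def
  proof (intro conjI allI impI)
    fix s l assume s: "(\<forall>n::nat. s n \<in> {x \<in> topspace T. f x \<in> C}) \<and> limitin T s l sequentially"
    then have "limitin T' (f \<circ> s) (f l) sequentially"
      using continuous_map_limit[OF f] by blast
    moreover have "\<forall>n. (f \<circ> s) n \<in> C" using s by simp
    ultimately have "f l \<in> C" using C unfolding seq_closedin_def by blast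
    then show "l \<in> {x \<in> topspace T. f x \<in> C}" using s limitin_topspace[of T s l sequentially] by simp
  qed auto
qed

lemma limitin_sequential_topology_closed:
  assumes "limitin T s l sequentially" "\<And>n. s n \<in> A" "A \<subseteq> topspace T"
  shows "l \<in> sequential_topology T closure_of A"
proof -
  have "seq_closedin T (sequential_topology T closure_of A)"
    by (simp flip: closedin_sequential)
  moreover have "s n \<in> sequential_topology T closure_of A" for n
    using assms(2) closure_of_subset[of A "sequential_topology T"] assms(3) by auto
  ultimately show ?thesis
    using assms(1) unfolding seq_closedin_def by blast
qed

lemma closure_of_sequential_subset:
  assumes "A \<subseteq> topspace T"
  shows "sequential_topology T closure_of A \<subseteq> T closure_of A"
proof (rule closure_of_minimal)
  show "A \<subseteq> T closure_of A" using assms by (rule closure_of_subset)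
  show "closedin (sequential_topology T) (T closure_of A)"
    unfolding closedin_sequential by (rule seq_closedin_closedin) simp
qed

text \<open>Convergence of the gradients comes for free: against test functions it is integration by
  parts, and the uniform bound extends it to L1 by density.\<close>

lemma W1inf_bounded_limitin_w_star:
  assumes \<Omega>: "open \<Omega>" and s: "\<And>n. s n \<in> W1inf \<Omega>" and l: "l \<in> W1inf \<Omega>"
    and conv: "\<And>\<phi>. \<phi> \<in> L1 \<Omega> \<Longrightarrow>
      (\<lambda>n. \<integral>x. s n x \<bullet> \<phi> x \<partial>lebesgue_on \<Omega>) \<longlonglongrightarrow> (\<integral>x. l x \<bullet> \<phi> x \<partial>lebesgue_on \<Omega>)"
    and C: "\<And>n. AE x in lebesgue_on \<Omega>. norm (wgrad \<Omega> (s n) x) \<le> C"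
      "AE x in lebesgue_on \<Omega>. norm (wgrad \<Omega> l x) \<le> C"
  shows "limitin (w_star \<Omega>) s l sequentially"
proof (rule limitin_w_star[OF s l conv])
  have \<Omega>m: "\<Omega> \<in> sets borel" using \<Omega> by simp
  fix \<Phi> :: "'a \<Rightarrow> 'a" assume \<Phi>: "\<Phi> \<in> L1 \<Omega>"
  have \<Phi>i: "(\<lambda>x. \<Phi> x \<bullet> i) \<in> L1 \<Omega>" for i
    using L1_integrable[OF \<Phi>] by (simp add: L1_def)
  have split: "(\<integral>x. g x \<bullet> \<Phi> x \<partial>lebesgue_on \<Omega>) = (\<Sum>i\<in>Basis. \<integral>x. (g x \<bullet> i) * (\<Phi> x \<bullet> i) \<partial>lebesgue_on \<Omega>)"
    if g: "g \<in> Linf \<Omega>" for g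
    unfolding euclidean_inner[of "g _" "\<Phi> _"]
    by (rule Bochner_Integration.integral_sum) (rule Linf_L1_mult_integrable[OF Linf_inner[OF g] \<Phi>i])
  have comp: "(\<lambda>n. \<integral>x. (wgrad \<Omega> (s n) x \<bullet> i) * (\<Phi> x \<bullet> i) \<partial>lebesgue_on \<Omega>) \<longlonglongrightarrow>
      (\<integral>x. (wgrad \<Omega> l x \<bullet> i) * (\<Phi> x \<bullet> i) \<partial>lebesgue_on \<Omega>)" if i: "i \<in> Basis" for i
  proof (rule L1_weak_convergence[OF \<Omega> _ _ _ _ _ \<Phi>i])
    have le: "norm z \<le> C \<Longrightarrow> \<bar>z \<bullet> i\<bar> \<le> C" for z :: 'a
      using Basis_le_norm[OF i, of z] by linarith
    show "AE x in lebesgue_on \<Omega>. \<bar>wgrad \<Omega> (s n) x \<bullet> i\<bar> \<le> C" for n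
      using C(1)[of n] by eventually_elim (rule le)
    show "AE x in lebesgue_on \<Omega>. \<bar>wgrad \<Omega> l x \<bullet> i\<bar> \<le> C"
      using C(2) by eventually_elim (rule le)
    fix \<phi> assume "\<phi> \<in> test_bumps \<Omega>"
    then have \<phi>: "\<phi> \<in> test_functions \<Omega>" by (simp add: test_bumps_def)
    have eq: "(\<integral>x. (wgrad \<Omega> u x \<bullet> i) * \<phi> x \<partial>lebesgue_on \<Omega>) =
        - (\<integral>x. u x \<bullet> frechet_derivative \<phi> (at x) i \<partial>lebesgue_on \<Omega>)" if u: "u \<in> W1inf \<Omega>" for u
      using wgrad(2)[OF u] \<phi> i by (simp add: weak_gradient_def)
    show "(\<lambda>n. \<integral>x. (wgrad \<Omega> (s n) x \<bullet> i) * \<phi> x \<partial>lebesgue_on \<Omega>) \<longlonglongrightarrow>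
        (\<integral>x. (wgrad \<Omega> l x \<bullet> i) * \<phi> x \<partial>lebesgue_on \<Omega>)"
      unfolding eq[OF s] eq[OF l] by (intro tendsto_minus conv test_function_L1(2)[OF \<phi> \<Omega>m])
  qed (use Linf_measurable[OF Linf_inner[OF wgrad(1)[OF s]]] Linf_measurable[OF Linf_inner[OF wgrad(1)[OF l]]] in auto)
  show "(\<lambda>n. \<integral>x. wgrad \<Omega> (s n) x \<bullet> \<Phi> x \<partial>lebesgue_on \<Omega>) \<longlonglongrightarrow> (\<integral>x. wgrad \<Omega> l x \<bullet> \<Phi> x \<partial>lebesgue_on \<Omega>)"
    unfolding split[OF wgrad(1)[OF s]] split[OF wgrad(1)[OF l]] by (intro tendsto_sum comp)
qed

section \<open>Sublevel sets of supremal functionals\<close>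

lemma supremal_measurable:
  fixes f :: "'a::euclidean_space \<times> 'a \<Rightarrow> ereal"
  assumes f: "f \<in> borel_measurable (restrict_space borel (\<Omega> \<times> UNIV))" and u: "u \<in> W1inf \<Omega>"
  shows "(\<lambda>x. f (x, wgrad \<Omega> u x)) \<in> borel_measurable (lebesgue_on \<Omega>)"
proof -
  have "(\<lambda>x. x) \<in> borel_measurable (lebesgue_on \<Omega>)"
    by (rule borel_measurable_lebesgue_on) simp
  then have "(\<lambda>x. (x, wgrad \<Omega> u x)) \<in> borel_measurable (lebesgue_on \<Omega>)"
    using Linf_measurable[OF wgrad(1)[OF u]] by (rule borel_measurable_Pair)
  then have "(\<lambda>x. (x, wgrad \<Omega> u x)) \<in> lebesgue_on \<Omega> \<rightarrow>\<^sub>M restrict_space borel (\<Omega> \<times> UNIV)"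
    by (intro measurable_restrict_space2) (auto simp: space_restrict_space)
  from measurable_compose[OF this f] show ?thesis .
qed

lemma supremal_interpolation:
  assumes f: "f \<in> borel_measurable (restrict_space borel (\<Omega> \<times> UNIV))" and w: "w \<in> W1inf \<Omega>"
    and ae: "AE x in lebesgue_on \<Omega>. wgrad \<Omega> w x = wgrad \<Omega> u x \<or> wgrad \<Omega> w x = wgrad \<Omega> v x"
    and u: "supremal \<Omega> f u \<le> c" and v: "supremal \<Omega> f v \<le> c"
  shows "supremal \<Omega> f w \<le> c"
  unfolding supremal_def
proof (rule esssup_I[OF supremal_measurable[OF f w]])
  have "AE x in lebesgue_on \<Omega>. f (x, wgrad \<Omega> u x) \<le> supremal \<Omega> f u"
    "AE x in lebesgue_on \<Omega>. f (x, wgrad \<Omega> v x) \<le> supremal \<Omega> f v"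
    unfolding supremal_def by (rule esssup_AE)+
  then show "AE x in lebesgue_on \<Omega>. f (x, wgrad \<Omega> w x) \<le> c"
    using ae by eventually_elim (use u v in \<open>auto intro: order.trans\<close>)
qed

definition sublevel :: "'a::euclidean_space set \<Rightarrow> ('a \<times> 'a \<Rightarrow> ereal) \<Rightarrow> real \<Rightarrow> ('a \<Rightarrow> real) set" where
  "sublevel \<Omega> f c = {v \<in> W1inf \<Omega>. supremal \<Omega> f v \<le> ereal c}"

text \<open>Uniform approximation gives the first claim and sequential weak* convergence the third.
  The second follows from the third, because the sequential topology is finer and has smaller
  closures.\<close>

lemma sublevel_segment:
  assumes \<Omega>: "open \<Omega>" "bounded \<Omega>" and f: "f \<in> borel_measurable (restrict_space borel (\<Omega> \<times> UNIV))"
    and u: "u \<in> sublevel \<Omega> f c" and v: "v \<in> sublevel \<Omega> f c" and t: "0 \<le> t" "t \<le> 1"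
  shows "(\<lambda>x. (1 - t) * u x + t * v x) \<in> tau_inf \<Omega> closure_of sublevel \<Omega> f c"
    and "(\<lambda>x. (1 - t) * u x + t * v x) \<in> w_star \<Omega> closure_of sublevel \<Omega> f c"
    and "(\<lambda>x. (1 - t) * u x + t * v x) \<in> w_star_seq \<Omega> closure_of sublevel \<Omega> f c"
proof -
  let ?l = "\<lambda>x. (1 - t) * u x + t * v x"
  have uv: "u \<in> W1inf \<Omega>" "v \<in> W1inf \<Omega>" "supremal \<Omega> f u \<le> ereal c" "supremal \<Omega> f v \<le> ereal c"
    using u v by (auto simp: sublevel_def)
  have lW: "?l \<in> W1inf \<Omega>" by (rule W1inf_linear_combination(1)[OF \<Omega>(1) uv(1,2)])
  have "\<exists>w. w \<in> sublevel \<Omega> f c \<and> (\<forall>x. \<bar>w x - ?l x\<bar> \<le> e) \<and>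
      (AE x in lebesgue_on \<Omega>. wgrad \<Omega> w x = wgrad \<Omega> u x \<or> wgrad \<Omega> w x = wgrad \<Omega> v x)" if e: "e > 0" for e
  proof -
    obtain w where w: "w \<in> W1inf \<Omega>" "\<forall>x. \<bar>w x - ?l x\<bar> \<le> e"
      "AE x in lebesgue_on \<Omega>. wgrad \<Omega> w x = wgrad \<Omega> u x \<or> wgrad \<Omega> w x = wgrad \<Omega> v x"
      using W1inf_interpolation[OF \<Omega> uv(1,2) t e] by blast
    from supremal_interpolation[OF f w(1,3) uv(3,4)] w show ?thesis
      unfolding sublevel_def by blast
  qed
  note approx = this
  show "?l \<in> tau_inf \<Omega> closure_of sublevel \<Omega> f c"
  proof (rule tau_inf_closure_of[OF lW])
    fix e :: real assume "e > 0"
    from approx[OF this] obtain w where "w \<in> sublevel \<Omega> f c" "\<forall>x. \<bar>w x - ?l x\<bar> \<le> e" by blast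
    then show "\<exists>w\<in>sublevel \<Omega> f c. w \<in> W1inf \<Omega> \<and> (AE x in lebesgue_on \<Omega>. norm (w x - ?l x) \<le> e)"
      by (auto simp: sublevel_def)
  qed
  have "\<forall>n. \<exists>w. w \<in> sublevel \<Omega> f c \<and> (\<forall>x. \<bar>w x - ?l x\<bar> \<le> 1 / real (Suc n)) \<and>
      (AE x in lebesgue_on \<Omega>. wgrad \<Omega> w x = wgrad \<Omega> u x \<or> wgrad \<Omega> w x = wgrad \<Omega> v x)"
    by (intro allI approx) simp
  from choice[OF this] obtain w where w: "\<forall>n. w n \<in> sublevel \<Omega> f c \<and> (\<forall>x. \<bar>w n x - ?l x\<bar> \<le> 1 / real (Suc n)) \<and>
      (AE x in lebesgue_on \<Omega>. wgrad \<Omega> (w n) x = wgrad \<Omega> u x \<or> wgrad \<Omega> (w n) x = wgrad \<Omega> v x)" ..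
  have wW: "w n \<in> W1inf \<Omega>" for n using w by (auto simp: sublevel_def)
  have unif: "\<bar>w n x - ?l x\<bar> \<le> 1 / real (Suc n)" for n x using w by blast
  interpret fm: finite_measure "lebesgue_on \<Omega>" by (rule finite_measure_lebesgue_on[OF \<Omega>(2,1)])
  have lim: "limitin (w_star \<Omega>) w ?l sequentially"
  proof -
    obtain Cu where Cu: "Cu \<ge> 0" "AE x in lebesgue_on \<Omega>. norm (wgrad \<Omega> u x) \<le> Cu"
      using wgrad(1)[OF uv(1)] by (rule LinfE)
    obtain Cv where Cv: "Cv \<ge> 0" "AE x in lebesgue_on \<Omega>. norm (wgrad \<Omega> v x) \<le> Cv"
      using wgrad(1)[OF uv(2)] by (rule LinfE)
    obtain B where B: "B \<ge> 0" "AE x in lebesgue_on \<Omega>. norm (?l x) \<le> B"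
      using W1inf_Linf[OF lW] by (rule LinfE)
    show ?thesis
    proof (rule W1inf_bounded_limitin_w_star[OF \<Omega>(1) wW lW])
      show "AE x in lebesgue_on \<Omega>. norm (wgrad \<Omega> (w n) x) \<le> Cu + Cv" for n
      proof -
        have "AE x in lebesgue_on \<Omega>. wgrad \<Omega> (w n) x = wgrad \<Omega> u x \<or> wgrad \<Omega> (w n) x = wgrad \<Omega> v x"
          using w by blast
        then show ?thesis using Cu(2) Cv(2)
        proof eventually_elim
          case (elim x)
          show ?case using elim(1)
          proof
            assume "wgrad \<Omega> (w n) x = wgrad \<Omega> u x"
            then show ?thesis using elim(2) Cv(1) by simp
          next
            assume "wgrad \<Omega> (w n) x = wgrad \<Omega> v x"
            then show ?thesis using elim(3) Cu(1) by simp
          qed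
        qed
      qed
      show "AE x in lebesgue_on \<Omega>. norm (wgrad \<Omega> ?l x) \<le> Cu + Cv"
        using W1inf_linear_combination(2)[OF \<Omega>(1) uv(1,2), of "1 - t" t] Cu(2) Cv(2)
      proof eventually_elim
        case (elim x)
        have "norm ((1 - t) *\<^sub>R wgrad \<Omega> u x + t *\<^sub>R wgrad \<Omega> v x) \<le>
            norm ((1 - t) *\<^sub>R wgrad \<Omega> u x) + norm (t *\<^sub>R wgrad \<Omega> v x)" by (rule norm_triangle_ineq)
        also have "\<dots> = (1 - t) * norm (wgrad \<Omega> u x) + t * norm (wgrad \<Omega> v x)"
          using t by simp
        also have "\<dots> \<le> 1 * Cu + 1 * Cv"
          using elim(2,3) t by (intro add_mono mult_mono) auto
        finally show ?case using elim(1) by simp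
      qed
      fix \<phi> :: "'a \<Rightarrow> real" assume \<phi>: "\<phi> \<in> L1 \<Omega>"
      show "(\<lambda>n. \<integral>x. w n x \<bullet> \<phi> x \<partial>lebesgue_on \<Omega>) \<longlonglongrightarrow> (\<integral>x. ?l x \<bullet> \<phi> x \<partial>lebesgue_on \<Omega>)"
      proof (rule fm.bdd_fun_limit(2))
        \<comment> \<open>The uniform error \<open>1 / real (Suc n)\<close> is at most 1, so
          \<open>B + 1\<close> bounds the whole sequence.\<close>
        show "fm.bdd_fun (B + 1) (w n)" for n
          unfolding fm.bdd_fun_def
        proof
          show "w n \<in> borel_measurable (lebesgue_on \<Omega>)" by (rule Linf_measurable[OF W1inf_Linf[OF wW]])
          show "AE x in lebesgue_on \<Omega>. norm (w n x) \<le> B + 1"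
            using B(2)
          proof eventually_elim
            case (elim x)
            have "1 / real (Suc n) \<le> 1" by simp
            then have "\<bar>w n x - ?l x\<bar> \<le> 1" using unif[of n x] by linarith
            then show ?case using elim unfolding real_norm_def by linarith
          qed
        qed
        show "?l \<in> borel_measurable (lebesgue_on \<Omega>)" by (rule Linf_measurable[OF W1inf_Linf[OF lW]])
        have "(\<lambda>n. w n x) \<longlonglongrightarrow> ?l x" for x
        proof (rule LIM_zero_cancel, rule Lim_null_comparison)
          show "\<forall>\<^sub>F n in sequentially. norm (w n x - ?l x) \<le> 1 / real (Suc n)"
            using unif by (intro always_eventually allI) simp
          show "(\<lambda>n. 1 / real (Suc n)) \<longlonglongrightarrow> 0" by real_asymp
        qed
        then show "AE x in lebesgue_on \<Omega>. (\<lambda>n. w n x) \<longlonglongrightarrow> ?l x" by simp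
      qed (rule L1_integrable[OF \<phi>])
    qed
  qed
  have "w n \<in> sublevel \<Omega> f c" for n using w by blast
  from limitin_sequential_topology_closed[OF lim this]
  show seq: "?l \<in> w_star_seq \<Omega> closure_of sublevel \<Omega> f c"
    unfolding w_star_seq_def by (auto simp: topspace_w_star sublevel_def)
  then show "?l \<in> w_star \<Omega> closure_of sublevel \<Omega> f c"
    using closure_of_sequential_subset[of "sublevel \<Omega> f c" "w_star \<Omega>"]
    unfolding w_star_seq_def by (auto simp: topspace_w_star sublevel_def)
qed

text \<open>Krein--Smulian, through the embedding \<open>u \<mapsto> (u, Du)\<close>.\<close>

lemma seq_closed_convex_imp_w_star_closed:
  assumes \<Omega>: "open \<Omega>" "bounded \<Omega>" and C: "seq_closedin (w_star \<Omega>) C" and conv: "convex_funs C"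
  shows "closedin (w_star \<Omega>) C"
proof -
  have CW: "C \<subseteq> W1inf \<Omega>" using C by (simp add: seq_closedin_def topspace_w_star)
  have \<Omega>m: "\<Omega> \<in> sets borel" using \<Omega>(1) by simp
  interpret fm: finite_measure "lebesgue_on \<Omega>" by (rule finite_measure_lebesgue_on[OF \<Omega>(2,1)])
  have "\<exists>V. openin (w_star \<Omega>) V \<and> u0 \<in> V \<and> V \<subseteq> topspace (w_star \<Omega>) - C" if u0: "u0 \<in> W1inf \<Omega> - C" for u0
  proof -
    have u0W: "u0 \<in> W1inf \<Omega>" and u0C: "u0 \<notin> C" using u0 by auto
    note u0L = W1inf_Linf[OF u0W] and Du0L = wgrad(1)[OF u0W]
    \<comment> \<open>Subtracting \<open>u0\<close> turns the task into separating 0 from a convex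
      set. Function and gradient are paired so that one integrable \<open>h\<close> supplies both
      test functions.\<close>
    define J where "J u x = (u x - u0 x, wgrad \<Omega> u x - wgrad \<Omega> u0 x)" for u x
    \<comment> \<open>Saturated under almost everywhere equality, because the limits that
      \<open>G\<close> must contain are arbitrary measurable functions determined only up to null
      sets.\<close>
    define G where "G = {g \<in> borel_measurable (lebesgue_on \<Omega>). \<exists>u\<in>C. AE x in lebesgue_on \<Omega>. g x = J u x}"
    have Jm: "J u \<in> borel_measurable (lebesgue_on \<Omega>)" if "u \<in> W1inf \<Omega>" for u
      unfolding J_def
      by (intro borel_measurable_Pair Linf_measurable Linf_diff W1inf_Linf wgrad(1) that u0W)
    have Jb: "\<exists>R. fm.bdd_fun R (J u)" if u: "u \<in> W1inf \<Omega>" for u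
    proof -
      obtain A where A: "A \<ge> 0" "AE x in lebesgue_on \<Omega>. norm (u x - u0 x) \<le> A"
        using Linf_diff[OF W1inf_Linf[OF u] u0L] by (rule LinfE)
      obtain B where B: "B \<ge> 0" "AE x in lebesgue_on \<Omega>. norm (wgrad \<Omega> u x - wgrad \<Omega> u0 x) \<le> B"
        using Linf_diff[OF wgrad(1)[OF u] Du0L] by (rule LinfE)
      have "AE x in lebesgue_on \<Omega>. norm (J u x) \<le> A + B"
        using A(2) B(2)
      proof eventually_elim
        case (elim x)
        have "norm (J u x) \<le> norm (u x - u0 x) + norm (wgrad \<Omega> u x - wgrad \<Omega> u0 x)"
          unfolding J_def by (rule norm_Pair_le)
        then show ?case using elim by linarith
      qed
      then show ?thesis using Jm[OF u] unfolding fm.bdd_fun_def by blast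
    qed
    interpret G: bounded_function_family "lebesgue_on \<Omega>" G
    proof
      show "\<exists>R. fm.bdd_fun R g" if g: "g \<in> G" for g
      proof -
        obtain u where u: "u \<in> C" "AE x in lebesgue_on \<Omega>. g x = J u x" using g by (auto simp: G_def)
        then obtain R where "fm.bdd_fun R (J u)" using Jb CW by blast
        then have "AE x in lebesgue_on \<Omega>. norm (J u x) \<le> R" by (simp add: fm.bdd_fun_def)
        then have "AE x in lebesgue_on \<Omega>. norm (g x) \<le> R" using u(2) by eventually_elim simp
        then show ?thesis using g unfolding fm.bdd_fun_def G_def by blast
      qed
      show "(\<lambda>x. (1 - t) *\<^sub>R g x + t *\<^sub>R h x) \<in> G" if gh: "g \<in> G" "h \<in> G" and t: "0 \<le> t" "t \<le> 1" for g h t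
      proof -
        obtain u where u: "u \<in> C" "AE x in lebesgue_on \<Omega>. g x = J u x" using gh by (auto simp: G_def)
        obtain v where v: "v \<in> C" "AE x in lebesgue_on \<Omega>. h x = J v x" using gh by (auto simp: G_def)
        let ?w = "\<lambda>x. (1 - t) * u x + t * v x"
        have "?w \<in> C" using conv u(1) v(1) t by (auto simp: convex_funs_def)
        moreover have "AE x in lebesgue_on \<Omega>. (1 - t) *\<^sub>R g x + t *\<^sub>R h x = J ?w x"
          using u(2) v(2) W1inf_linear_combination(2)[OF \<Omega>(1) subsetD[OF CW u(1)] subsetD[OF CW v(1)], of "1 - t" t]
          by eventually_elim (simp add: J_def algebra_simps)
        moreover have "(\<lambda>x. (1 - t) *\<^sub>R g x + t *\<^sub>R h x) \<in> borel_measurable (lebesgue_on \<Omega>)"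
        proof -
          have [measurable]: "g \<in> borel_measurable (lebesgue_on \<Omega>)" "h \<in> borel_measurable (lebesgue_on \<Omega>)"
            using gh by (auto simp: G_def)
          show ?thesis by measurable
        qed
        ultimately show ?thesis unfolding G_def by blast
      qed
      show "g \<in> G" if f: "\<And>n. f n \<in> G" and fR: "\<And>n. fm.bdd_fun R (f n)"
        and g: "g \<in> borel_measurable (lebesgue_on \<Omega>)" and lim: "AE x in lebesgue_on \<Omega>. (\<lambda>n. f n x) \<longlonglongrightarrow> g x" for f R g
      proof -
        have "\<forall>n. \<exists>u. u \<in> C \<and> (AE x in lebesgue_on \<Omega>. f n x = J u x)" using f by (auto simp: G_def)
        from choice[OF this] obtain s where s: "\<forall>n. s n \<in> C \<and> (AE x in lebesgue_on \<Omega>. f n x = J (s n) x)" ..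
        then have sC: "s n \<in> C" and sf: "AE x in lebesgue_on \<Omega>. f n x = J (s n) x" for n by auto
        have sW: "s n \<in> W1inf \<Omega>" for n using sC CW by blast
        have gR: "fm.bdd_fun R g" by (rule fm.bdd_fun_limit(1)[OF fR g lim])
        \<comment> \<open>The limit function and the candidate for its gradient are read off from
          \<open>g\<close>. Once \<open>D\<close> is known to be a weak gradient of
          \<open>u\<close>, the sequence converges weak* to \<open>u\<close>, which then belongs to
          \<open>C\<close>.\<close>
        define u where "u x = u0 x + fst (g x)" for x
        define D where "D x = wgrad \<Omega> u0 x + snd (g x)" for x
        have gAE: "AE x in lebesgue_on \<Omega>. norm (g x) \<le> R" using gR by (simp add: fm.bdd_fun_def)
        have nfst: "norm (fst p) \<le> norm p" and nsnd: "norm (snd p) \<le> norm p" for p :: "real \<times> 'a"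
          by (metis norm_fst_le prod.collapse, metis norm_snd_le prod.collapse)
        have fstL: "(\<lambda>x. fst (g x)) \<in> Linf \<Omega>"
        proof (rule LinfI)
          show "(\<lambda>x. fst (g x)) \<in> borel_measurable (lebesgue_on \<Omega>)"
            using g by (rule measurable_compose[OF _ borel_measurable_continuous_onI]) (intro continuous_intros)
          show "AE x in lebesgue_on \<Omega>. norm (fst (g x)) \<le> R"
            using gAE by eventually_elim (rule order.trans[OF nfst])
        qed
        have sndL: "(\<lambda>x. snd (g x)) \<in> Linf \<Omega>"
        proof (rule LinfI)
          show "(\<lambda>x. snd (g x)) \<in> borel_measurable (lebesgue_on \<Omega>)"
            using g by (rule measurable_compose[OF _ borel_measurable_continuous_onI]) (intro continuous_intros)
          show "AE x in lebesgue_on \<Omega>. norm (snd (g x)) \<le> R"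
            using gAE by eventually_elim (rule order.trans[OF nsnd])
        qed
        have uL: "u \<in> Linf \<Omega>"
          using Linf_linear_combination[OF u0L fstL, of 1 1] by (simp add: u_def[abs_def])
        have DL: "D \<in> Linf \<Omega>"
          using Linf_linear_combination[OF Du0L sndL, of 1 1] by (simp add: D_def[abs_def])
        have pair: "(\<lambda>n. (\<integral>x. (s n x - u0 x) \<bullet> \<phi> x + (wgrad \<Omega> (s n) x - wgrad \<Omega> u0 x) \<bullet> \<Phi> x \<partial>lebesgue_on \<Omega>)) \<longlonglongrightarrow>
            (\<integral>x. fst (g x) \<bullet> \<phi> x + snd (g x) \<bullet> \<Phi> x \<partial>lebesgue_on \<Omega>)" if \<phi>: "\<phi> \<in> L1 \<Omega>" and \<Phi>: "\<Phi> \<in> L1 \<Omega>" for \<phi> \<Phi>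
        proof -
          have int: "integrable (lebesgue_on \<Omega>) (\<lambda>x. (\<phi> x, \<Phi> x))"
          proof -
            have "integrable (lebesgue_on \<Omega>) (\<lambda>x. (\<phi> x, 0) + (0, \<Phi> x))"
              by (intro Bochner_Integration.integrable_add
                  integrable_bounded_linear[OF bounded_linear_Pair[OF bounded_linear_ident bounded_linear_zero] L1_integrable[OF \<phi>]]
                  integrable_bounded_linear[OF bounded_linear_Pair[OF bounded_linear_zero bounded_linear_ident] L1_integrable[OF \<Phi>]])
            then show ?thesis by simp
          qed
          have "(\<integral>x. f n x \<bullet> (\<phi> x, \<Phi> x) \<partial>lebesgue_on \<Omega>) =
              (\<integral>x. (s n x - u0 x) \<bullet> \<phi> x + (wgrad \<Omega> (s n) x - wgrad \<Omega> u0 x) \<bullet> \<Phi> x \<partial>lebesgue_on \<Omega>)" for n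
          proof -
            have "(\<integral>x. f n x \<bullet> (\<phi> x, \<Phi> x) \<partial>lebesgue_on \<Omega>) = (\<integral>x. J (s n) x \<bullet> (\<phi> x, \<Phi> x) \<partial>lebesgue_on \<Omega>)"
            proof (rule integral_cong_AE)
              show "(\<lambda>x. f n x \<bullet> (\<phi> x, \<Phi> x)) \<in> borel_measurable (lebesgue_on \<Omega>)"
                using fm.bdd_fun_inner[OF fR int] by simp
              obtain R' where "fm.bdd_fun R' (J (s n))" using Jb[OF sW] by blast
              then show "(\<lambda>x. J (s n) x \<bullet> (\<phi> x, \<Phi> x)) \<in> borel_measurable (lebesgue_on \<Omega>)"
                using fm.bdd_fun_inner[OF _ int] by blast
              show "AE x in lebesgue_on \<Omega>. f n x \<bullet> (\<phi> x, \<Phi> x) = J (s n) x \<bullet> (\<phi> x, \<Phi> x)"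
                using sf[of n] by eventually_elim simp
            qed
            then show ?thesis by (simp add: J_def)
          qed
          moreover have "(\<integral>x. g x \<bullet> (\<phi> x, \<Phi> x) \<partial>lebesgue_on \<Omega>) = (\<integral>x. fst (g x) \<bullet> \<phi> x + snd (g x) \<bullet> \<Phi> x \<partial>lebesgue_on \<Omega>)"
            by (simp add: inner_prod_def)
          ultimately show ?thesis
            using fm.bdd_fun_limit(2)[OF fR g lim int] by simp
        qed
        have zero1: "(\<lambda>x. 0 :: real) \<in> L1 \<Omega>" and zero2: "(\<lambda>x. 0 :: 'a) \<in> L1 \<Omega>" by (simp_all add: L1_def)
        have conv1: "(\<lambda>n. \<integral>x. s n x \<bullet> \<phi> x \<partial>lebesgue_on \<Omega>) \<longlonglongrightarrow> (\<integral>x. u x \<bullet> \<phi> x \<partial>lebesgue_on \<Omega>)" if \<phi>: "\<phi> \<in> L1 \<Omega>" for \<phi>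
        proof -
          have "(\<integral>x. s n x \<bullet> \<phi> x \<partial>lebesgue_on \<Omega>) = (\<integral>x. u0 x \<bullet> \<phi> x \<partial>lebesgue_on \<Omega>) + (\<integral>x. (s n x - u0 x) \<bullet> \<phi> x \<partial>lebesgue_on \<Omega>)" for n
            using Linf_L1_integral_combination[OF W1inf_Linf[OF sW[of n]] u0L \<phi>, of 1 "-1"] by simp
          moreover have "(\<integral>x. u x \<bullet> \<phi> x \<partial>lebesgue_on \<Omega>) = (\<integral>x. u0 x \<bullet> \<phi> x \<partial>lebesgue_on \<Omega>) + (\<integral>x. fst (g x) \<bullet> \<phi> x \<partial>lebesgue_on \<Omega>)"
            using Linf_L1_integral_combination[OF u0L fstL \<phi>, of 1 1] by (simp add: u_def)
          ultimately show ?thesis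
            using tendsto_add[OF tendsto_const pair[OF \<phi> zero2]] by simp
        qed
        have conv2: "(\<lambda>n. \<integral>x. wgrad \<Omega> (s n) x \<bullet> \<Phi> x \<partial>lebesgue_on \<Omega>) \<longlonglongrightarrow> (\<integral>x. D x \<bullet> \<Phi> x \<partial>lebesgue_on \<Omega>)" if \<Phi>: "\<Phi> \<in> L1 \<Omega>" for \<Phi>
        proof -
          have "(\<integral>x. wgrad \<Omega> (s n) x \<bullet> \<Phi> x \<partial>lebesgue_on \<Omega>) = (\<integral>x. wgrad \<Omega> u0 x \<bullet> \<Phi> x \<partial>lebesgue_on \<Omega>) +
              (\<integral>x. (wgrad \<Omega> (s n) x - wgrad \<Omega> u0 x) \<bullet> \<Phi> x \<partial>lebesgue_on \<Omega>)" for n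
            using Linf_L1_integral_combination[OF wgrad(1)[OF sW[of n]] Du0L \<Phi>, of 1 "-1"] by simp
          moreover have "(\<integral>x. D x \<bullet> \<Phi> x \<partial>lebesgue_on \<Omega>) = (\<integral>x. wgrad \<Omega> u0 x \<bullet> \<Phi> x \<partial>lebesgue_on \<Omega>) + (\<integral>x. snd (g x) \<bullet> \<Phi> x \<partial>lebesgue_on \<Omega>)"
            using Linf_L1_integral_combination[OF Du0L sndL \<Phi>, of 1 1] by (simp add: D_def)
          ultimately show ?thesis
            using tendsto_add[OF tendsto_const pair[OF zero1 \<Phi>]] by simp
        qed
        \<comment> \<open>Both sides of the defining identity are pairings with L1 functions, the
          partial derivative of \<open>\<phi>\<close> and \<open>\<phi> x *\<^sub>R i\<close>, so it
          passes to the weak* limit.\<close>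
        have weak: "weak_gradient \<Omega> u D"
          unfolding weak_gradient_def
        proof (intro ballI)
          fix \<phi> and i :: 'a assume \<phi>: "\<phi> \<in> test_functions \<Omega>" and i: "i \<in> Basis"
          have \<Phi>: "(\<lambda>x. \<phi> x *\<^sub>R i) \<in> L1 \<Omega>"
            using L1_integrable[OF test_function_L1(1)[OF \<phi> \<Omega>m]] by (simp add: L1_def)
          have "(\<integral>x. s n x \<bullet> frechet_derivative \<phi> (at x) i \<partial>lebesgue_on \<Omega>) =
              - (\<integral>x. wgrad \<Omega> (s n) x \<bullet> (\<phi> x *\<^sub>R i) \<partial>lebesgue_on \<Omega>)" for n
            using wgrad(2)[OF sW[of n]] \<phi> i by (simp add: weak_gradient_def mult.commute)
          then have "(\<lambda>n. \<integral>x. s n x \<bullet> frechet_derivative \<phi> (at x) i \<partial>lebesgue_on \<Omega>) \<longlonglongrightarrow> - (\<integral>x. D x \<bullet> (\<phi> x *\<^sub>R i) \<partial>lebesgue_on \<Omega>)"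
            using tendsto_minus[OF conv2[OF \<Phi>]] by simp
          then have "(\<integral>x. u x \<bullet> frechet_derivative \<phi> (at x) i \<partial>lebesgue_on \<Omega>) = - (\<integral>x. D x \<bullet> (\<phi> x *\<^sub>R i) \<partial>lebesgue_on \<Omega>)"
            using LIMSEQ_unique[OF conv1[OF test_function_L1(2)[OF \<phi> \<Omega>m]]] by blast
          then show "(\<integral>x. u x * frechet_derivative \<phi> (at x) i \<partial>lebesgue_on \<Omega>) = - (\<integral>x. (D x \<bullet> i) * \<phi> x \<partial>lebesgue_on \<Omega>)"
            by (simp add: mult.commute)
        qed
        note uW = wgrad_AE[OF \<Omega>(1) uL DL weak]
        have "limitin (w_star \<Omega>) s u sequentially"
          by (rule limitin_w_star[OF sW uW(1) conv1])
            (use conv2 pairing_cong_AE[OF wgrad(1)[OF uW(1)] DL _ uW(2)] in simp_all)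
        then have "u \<in> C" using C sC unfolding seq_closedin_def by blast
        moreover have "AE x in lebesgue_on \<Omega>. g x = J u x"
          using uW(2) by eventually_elim (simp add: J_def u_def D_def)
        ultimately show ?thesis using g unfolding G_def by blast
      qed
    qed
    \<comment> \<open>Otherwise some \<open>u\<close> in \<open>C\<close> agrees with
      \<open>u0\<close> almost everywhere. The topology does not distinguish the two, so the
      constant sequence \<open>u\<close> converges to \<open>u0\<close> and sequential closedness
      puts \<open>u0\<close> into \<open>C\<close>.\<close>
    have "(\<lambda>_. 0) \<notin> G"
    proof
      assume "(\<lambda>_. 0) \<in> G"
      then obtain u where u: "u \<in> C" "AE x in lebesgue_on \<Omega>. 0 = J u x" by (auto simp: G_def)
      have uW: "u \<in> W1inf \<Omega>" using u(1) CW by blast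
      have e1: "AE x in lebesgue_on \<Omega>. u x = u0 x" and e2: "AE x in lebesgue_on \<Omega>. wgrad \<Omega> u x = wgrad \<Omega> u0 x"
        using u(2) by (eventually_elim, simp add: J_def zero_prod_def)+
      have "limitin (w_star \<Omega>) (\<lambda>n::nat. u) u0 sequentially"
        by (rule limitin_w_star[OF uW u0W])
          (simp_all add: pairing_cong_AE[OF W1inf_Linf[OF uW] u0L _ e1, simplified] pairing_cong_AE[OF wgrad(1)[OF uW] Du0L _ e2])
      then have "u0 \<in> C"
        using C[unfolded seq_closedin_def, THEN conjunct2, rule_format, of "\<lambda>_. u" u0] u(1) by simp
      then show False using u0C by simp
    qed
    from G.weak_star_separation[OF this] obtain h where h: "integrable (lebesgue_on \<Omega>) h"
      "\<forall>g\<in>G. 1 \<le> (\<integral>y. g y \<bullet> h y \<partial>lebesgue_on \<Omega>)" by blast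
    define \<phi> \<Phi> where "\<phi> x = fst (h x)" and "\<Phi> x = snd (h x)" for x
    have \<phi>: "\<phi> \<in> L1 \<Omega>" and \<Phi>: "\<Phi> \<in> L1 \<Omega>"
      unfolding L1_def \<phi>_def \<Phi>_def mem_Collect_eq
      by (intro integrable_bounded_linear[OF bounded_linear_fst h(1)] integrable_bounded_linear[OF bounded_linear_snd h(1)])+
    \<comment> \<open>The weak* continuous functional given by the two components of
      \<open>h\<close>. It exceeds its value at \<open>u0\<close> by at least 1 on all of
      \<open>C\<close>, so an open half-space around \<open>u0\<close> misses
      \<open>C\<close>.\<close>
    define P where "P u = (\<integral>x. u x \<bullet> \<phi> x \<partial>lebesgue_on \<Omega>) + (\<integral>x. wgrad \<Omega> u x \<bullet> \<Phi> x \<partial>lebesgue_on \<Omega>)" for u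
    have PC: "P u0 + 1 \<le> P u" if u: "u \<in> C" for u
    proof -
      have uW: "u \<in> W1inf \<Omega>" using u CW by blast
      have "J u \<in> G" unfolding G_def using u Jm[OF uW] by auto
      from bspec[OF h(2) this] have "1 \<le> (\<integral>x. (u x - u0 x) \<bullet> \<phi> x + (wgrad \<Omega> u x - wgrad \<Omega> u0 x) \<bullet> \<Phi> x \<partial>lebesgue_on \<Omega>)"
        by (simp add: J_def inner_prod_def \<phi>_def \<Phi>_def)
      also have "\<dots> = (\<integral>x. (u x - u0 x) \<bullet> \<phi> x \<partial>lebesgue_on \<Omega>) + (\<integral>x. (wgrad \<Omega> u x - wgrad \<Omega> u0 x) \<bullet> \<Phi> x \<partial>lebesgue_on \<Omega>)"
        by (intro Bochner_Integration.integral_add Linf_L1_integrable Linf_diff W1inf_Linf wgrad(1) uW u0W \<phi> \<Phi>)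
      also have "\<dots> = P u - P u0"
        using Linf_L1_integral_combination[OF W1inf_Linf[OF uW] u0L \<phi>, of 1 "-1"]
          Linf_L1_integral_combination[OF wgrad(1)[OF uW] Du0L \<Phi>, of 1 "-1"] by (simp add: P_def)
      finally show ?thesis by simp
    qed
    have "continuous_map (w_star \<Omega>) euclideanreal P"
      unfolding P_def by (intro continuous_map_add continuous_map_w_star_pairing \<phi> \<Phi>)
    then have "openin (w_star \<Omega>) {u \<in> topspace (w_star \<Omega>). P u \<in> {..<P u0 + 1}}"
      by (rule openin_continuous_map_preimage) simp
    moreover have "u0 \<in> {u \<in> topspace (w_star \<Omega>). P u \<in> {..<P u0 + 1}}"
      using u0W by (simp add: topspace_w_star)
    moreover have "{u \<in> topspace (w_star \<Omega>). P u \<in> {..<P u0 + 1}} \<subseteq> topspace (w_star \<Omega>) - C"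
      using PC by fastforce
    ultimately show ?thesis by blast
  qed
  then have "openin (w_star \<Omega>) (topspace (w_star \<Omega>) - C)"
    by (subst openin_subopen) (auto simp: topspace_w_star)
  then show ?thesis using CW by (simp add: closedin_def topspace_w_star)
qed

lemma sublevel_closure_convex:
  assumes \<Omega>: "open \<Omega>" "bounded \<Omega>" and f: "f \<in> borel_measurable (restrict_space borel (\<Omega> \<times> UNIV))"
    and \<tau>: "\<tau> \<in> {tau_inf \<Omega>, w_star \<Omega>, w_star_seq \<Omega>}"
  shows "convex_funs (\<tau> closure_of sublevel \<Omega> f c)"
proof -
  have A: "sublevel \<Omega> f c \<subseteq> W1inf \<Omega>" by (auto simp: sublevel_def)
  consider "\<tau> = tau_inf \<Omega>" | "\<tau> = w_star \<Omega>" | "\<tau> = w_star_seq \<Omega>" using \<tau> by blast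
  then show ?thesis
  proof cases
    case 1
    show ?thesis unfolding 1
      by (rule closure_of_convex[OF topspace_tau_inf A tau_inf_combination_continuous[OF \<Omega>(1)]
            sublevel_segment(1)[OF \<Omega> f]])
  next
    case 2
    show ?thesis unfolding 2
      by (rule closure_of_convex[OF topspace_w_star A w_star_combination_continuous[OF \<Omega>(1)]
            sublevel_segment(2)[OF \<Omega> f]])
  next
    case 3
    have "continuous_map (w_star_seq \<Omega>) (w_star_seq \<Omega>) (\<lambda>u x. (1 - t) * u x + t * v x)" if "v \<in> W1inf \<Omega>" for v t
      unfolding w_star_seq_def
      by (rule sequential_topology_continuous_map[OF w_star_combination_continuous[OF \<Omega>(1) that]])
    then show ?thesis unfolding 3
      by (rule closure_of_convex[OF topspace_w_star_seq A _ sublevel_segment(3)[OF \<Omega> f]])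
  qed
qed

text \<open>The closure in the sequential topology is convex and sequentially weak* closed, hence
  weak* closed by Krein--Smulian, and therefore contains the weak* closure. The other inclusion only
  compares topologies.\<close>

lemma sublevel_closure_w_star_eq:
  assumes \<Omega>: "open \<Omega>" "bounded \<Omega>" and f: "f \<in> borel_measurable (restrict_space borel (\<Omega> \<times> UNIV))"
  shows "w_star \<Omega> closure_of sublevel \<Omega> f c = w_star_seq \<Omega> closure_of sublevel \<Omega> f c"
proof
  have A: "sublevel \<Omega> f c \<subseteq> W1inf \<Omega>" by (auto simp: sublevel_def)
  show "w_star_seq \<Omega> closure_of sublevel \<Omega> f c \<subseteq> w_star \<Omega> closure_of sublevel \<Omega> f c"
    unfolding w_star_seq_def by (rule closure_of_sequential_subset) (simp add: topspace_w_star A)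
  show "w_star \<Omega> closure_of sublevel \<Omega> f c \<subseteq> w_star_seq \<Omega> closure_of sublevel \<Omega> f c"
  proof (rule closure_of_minimal)
    show "sublevel \<Omega> f c \<subseteq> w_star_seq \<Omega> closure_of sublevel \<Omega> f c"
      by (rule closure_of_subset) (simp add: topspace_w_star_seq A)
    have "seq_closedin (w_star \<Omega>) (w_star_seq \<Omega> closure_of sublevel \<Omega> f c)"
      unfolding w_star_seq_def by (simp flip: closedin_sequential)
    then show "closedin (w_star \<Omega>) (w_star_seq \<Omega> closure_of sublevel \<Omega> f c)"
      by (rule seq_closed_convex_imp_w_star_closed[OF \<Omega>]) (rule sublevel_closure_convex[OF \<Omega> f], simp)
  qed
qed

theorem theorem3p4:
  fixes \<Omega> :: "(real ^ 'n) set"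
    and f :: "(real ^ 'n) \<times> (real ^ 'n) \<Rightarrow> ereal"
  assumes "bounded \<Omega>" and "connected \<Omega>" and "open \<Omega>" and "lipschitz_boundary \<Omega>"
    and "f \<in> borel_measurable (restrict_space borel (\<Omega> \<times> UNIV))"
    and "\<exists>u :: nat \<Rightarrow> (real ^ 'n) \<Rightarrow> real.
           (\<forall>n. u n \<in> W1inf \<Omega>) \<and>
           (\<lambda>n. supremal \<Omega> f (u n)) \<longlonglongrightarrow> (INF v\<in>W1inf \<Omega>. supremal \<Omega> f v) \<and>
           (\<lambda>n. Limsup (at 0) (\<lambda>\<xi>. supremal \<Omega> f (\<lambda>x. u n x + \<xi> \<bullet> x)))
             \<longlonglongrightarrow> (INF v\<in>W1inf \<Omega>. supremal \<Omega> f v)"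
  shows "(\<forall>\<tau>\<in>{tau_inf \<Omega>, w_star \<Omega>, w_star_seq \<Omega>}.
            level_convex_on (W1inf \<Omega>) (lsc_envelope \<tau> (supremal \<Omega> f))) \<and>
         (\<forall>u\<in>W1inf \<Omega>. lsc_envelope (w_star \<Omega>) (supremal \<Omega> f) u =
                      lsc_envelope (w_star_seq \<Omega>) (supremal \<Omega> f) u)"
proof (intro conjI ballI)
  note \<Omega> = assms(3,1) and f = assms(5)
  have env: "lsc_envelope \<tau> (supremal \<Omega> f) u \<le> ereal c \<longleftrightarrow> (\<forall>c'>c. u \<in> \<tau> closure_of sublevel \<Omega> f c')"
    if "topspace \<tau> = W1inf \<Omega>" "u \<in> W1inf \<Omega>" for \<tau> u c
    using lsc_envelope_le_iff[of u \<tau> "supremal \<Omega> f" c] that by (simp add: sublevel_def)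
  show "level_convex_on (W1inf \<Omega>) (lsc_envelope \<tau> (supremal \<Omega> f))"
    if \<tau>: "\<tau> \<in> {tau_inf \<Omega>, w_star \<Omega>, w_star_seq \<Omega>}" for \<tau>
    unfolding level_convex_on_def convex_funs_def
  proof (intro allI ballI)
    fix c :: real and u v and t :: real
    assume "u \<in> {u \<in> W1inf \<Omega>. lsc_envelope \<tau> (supremal \<Omega> f) u \<le> ereal c}"
      and "v \<in> {u \<in> W1inf \<Omega>. lsc_envelope \<tau> (supremal \<Omega> f) u \<le> ereal c}" and t: "t \<in> {0..1}"
    then have uv: "u \<in> W1inf \<Omega>" "v \<in> W1inf \<Omega>" "lsc_envelope \<tau> (supremal \<Omega> f) u \<le> ereal c"
      "lsc_envelope \<tau> (supremal \<Omega> f) v \<le> ereal c" by auto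
    have top: "topspace \<tau> = W1inf \<Omega>"
      using \<tau> topspace_tau_inf topspace_w_star topspace_w_star_seq by blast
    have w: "(\<lambda>x. (1 - t) * u x + t * v x) \<in> W1inf \<Omega>"
      by (rule W1inf_linear_combination(1)[OF \<Omega>(1) uv(1,2)])
    have "(\<lambda>x. (1 - t) * u x + t * v x) \<in> \<tau> closure_of sublevel \<Omega> f c'" if "c' > c" for c'
      using sublevel_closure_convex[OF \<Omega> f \<tau>, of c'] uv(3,4) that t
      unfolding env[OF top uv(1)] env[OF top uv(2)] convex_funs_def by blast
    then show "(\<lambda>x. (1 - t) * u x + t * v x) \<in> {u \<in> W1inf \<Omega>. lsc_envelope \<tau> (supremal \<Omega> f) u \<le> ereal c}"
      using w env[OF top w] by simp
  qed
  show "lsc_envelope (w_star \<Omega>) (supremal \<Omega> f) u = lsc_envelope (w_star_seq \<Omega>) (supremal \<Omega> f) u"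
    if u: "u \<in> W1inf \<Omega>" for u
  proof -
    \<comment> \<open>Extended reals with the same real upper bounds coincide, so comparison at real
      levels also settles infinite values.\<close>
    have "lsc_envelope (w_star \<Omega>) (supremal \<Omega> f) u \<le> ereal c \<longleftrightarrow>
        lsc_envelope (w_star_seq \<Omega>) (supremal \<Omega> f) u \<le> ereal c" for c
      unfolding env[OF topspace_w_star u] env[OF topspace_w_star_seq u] sublevel_closure_w_star_eq[OF \<Omega> f] ..
    note eq = this
    show ?thesis
      by (rule antisym; rule ereal_le_real; simp add: eq)
  qed
qed

end
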